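(* Let $1\le p<\infty$, $\nu\in\mathcal{D}\cap\widehat{\mathcal{D}}_p$, and assume that $\{z_n\}$ is a finite union of separated sequences and a zero set of $\mathcal{B}^{p,p}_\nu$. Then there exists an outer function $O_\phi\in\mathcal{B}^{p,p}_\nu$ such that $$\sum_n|O_\phi(z_n)|^p\,\frac{\widehat\nu(z_n)}{(1-|z_n|)^{p-1}}<\infty.$$
   Context: $\mathbb{D}$ is the open unit disc of $\mathbb{C}$, $\mathbb{T}$ its boundary, and $\mathcal{H}(\mathbb{D})$ the set of analytic functions in $\mathbb{D}$. For $f\in\mathcal{H}(\mathbb{D})$, $0<p<\infty$ and $0\le r<1$ let $M_p(r,f)=\left(\frac1{2\pi}\int_0^{2\pi}|f(re^{i\theta})|^p\,d\theta\right)^{1/p}$. The Hardy space $H^p$ consists of $f\in\mathcal{H}(\mathbb{D})$ with $\|f\|_{H^p}=\sup_{0\le r<1}M_p(r,f)<\infty$. An outer function for $H^p$ is a function of the form $O_\phi(z)=\exp\left(\frac1{2\pi}\int_0^{2\pi}\frac{e^{i\theta}+z}{e^{i\theta}-z}\log\phi(e^{i\theta})\,d\theta\right)$, $z\in\mathbb{D}$, where $\phi$ is a non-negative function in $L^p(\mathbb{T})$ with $\log\phi\in L^1(\mathbb{T})$. A weight is a function $\nu:\mathbb{D}\to[0,\infty)$ that is integrable over $\mathbb{D}$ and radial, $\nu(z)=\nu(|z|)$. Put $\widehat\nu(z)=\widehat\nu(|z|)=\int_{|z|}^1\nu(s)\,ds$; it is understood that $\widehat\nu(r)>0$ for all $0\le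 r<1$. Write $\nu\in\widehat{\mathcal{D}}$ if there is $C=C(\nu)>0$ with $\widehat\nu(r)\le C\,\widehat\nu\left(\frac{1+r}{2}\right)$ for all $0\le r<1$. Write $\nu\in\check{\mathcal{D}}$ if there are $K=K(\nu)>1$ and $C=C(\nu)>1$ with $\widehat\nu(r)\ge C\,\widehat\nu\left(1-\frac{1-r}{K}\right)$ for all $0\le r<1$. Set $\mathcal{D}=\widehat{\mathcal{D}}\cap\check{\mathcal{D}}$. For $0<p<\infty$, $\widehat{\mathcal{D}}_p$ is the subclass of those $\nu\in\widehat{\mathcal{D}}$ with $$\sup_{0\le r<1}\frac{(1-r)^p}{\widehat\nu(r)}\int_0^r\frac{\nu(s)}{(1-s)^p}\,ds<\infty.$$ The weighted Besov space $\mathcal{B}^{p,p}_\nu$ consists of those $f\in H^p$ with $\int_0^1M_p(r,f')^p\,\nu(r)\,dr<\infty$. A sequence $\{z_n\}\subset\mathbb{D}$ is a zero set of $\mathcal{B}^{p,p}_\nu$ if there is $f\in\mathcal{B}^{p,p}_\nu$, not identically zero, such that $\{z:f(z)=0\}=\{z_n\}$, where each zero is repeated according to its multiplicity. A sequence $\{z_n\}\subset\mathbb{D}$ is separated if there is $\delta=\delta(\{z_n\})>0$ such that $d(z_n,z_k)>\delta$ for all $n\ne k$, where $d(z,w)=\left|\frac{z-w}{1-\overline{z}w}\right|$ is the pseudo-hyperbolic distance. *)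

theory Defs
  imports "HOL-Complex_Analysis.Complex_Analysis"
begin

text \<open>
  Functions on the unit disc and on the unit circle are total functions on \<^typ>\<open>complex\<close>; only their
  values on \<open>ball 0 1\<close>, respectively on \<open>sphere 0 1\<close>, are used below.
\<close>

subsection \<open>Hardy spaces and outer functions\<close>

definition integral_mean :: "real \<Rightarrow> real \<Rightarrow> (complex \<Rightarrow> complex) \<Rightarrow> real" where
  "integral_mean p r f =
     (1 / (2 * pi) * (LINT \<theta>:{0..2*pi}|lebesgue. cmod (f (complex_of_real r * cis \<theta>)) powr p))
       powr (1 / p)"

definition hardy_space :: "real \<Rightarrow> (complex \<Rightarrow> complex) set" where
  "hardy_space p =
     {f. f holomorphic_on ball 0 1 \<and> bdd_above ((\<lambda>r. integral_mean p r f) ` {0..<1})}"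

text \<open>
  Since \<open>ln 0 = 0\<close> in HOL, the condition that \<open>log \<phi>\<close> (with \<open>log 0 = - \<infinity>\<close>) is integrable needs
  the explicit requirement that \<open>\<phi>\<close> is positive almost everywhere.
\<close>

definition outer_symbol :: "real \<Rightarrow> (complex \<Rightarrow> real) \<Rightarrow> bool" where
  "outer_symbol p \<phi> \<longleftrightarrow>
     (\<forall>w\<in>sphere 0 1. 0 \<le> \<phi> w) \<and>
     set_integrable lebesgue {0..2*pi} (\<lambda>\<theta>. \<phi> (cis \<theta>) powr p) \<and>
     (AE \<theta> in lebesgue. \<theta> \<in> {0..2*pi} \<longrightarrow> 0 < \<phi> (cis \<theta>)) \<and>
     set_integrable lebesgue {0..2*pi} (\<lambda>\<theta>. ln (\<phi> (cis \<theta>)))"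

definition outer_function :: "(complex \<Rightarrow> real) \<Rightarrow> complex \<Rightarrow> complex" where
  "outer_function \<phi> z =
     exp (1 / (2 * complex_of_real pi) *
       (LINT \<theta>:{0..2*pi}|lebesgue.
          (cis \<theta> + z) / (cis \<theta> - z) * complex_of_real (ln (\<phi> (cis \<theta>)))))"

subsection \<open>Radial weights\<close>

definition weight_tail :: "(complex \<Rightarrow> real) \<Rightarrow> real \<Rightarrow> real" where
  "weight_tail \<nu> r = (LINT s:{r..<1}|lebesgue. \<nu> (complex_of_real s))"

text \<open>
  The Bochner integral of a non-integrable function is \<open>0\<close>, so positivity of the tail at \<open>r = 0\<close>
  also excludes weights whose radial profile is not integrable near \<open>0\<close>. Such weights have an infinite
  tail at \<open>0\<close> but finite tails elsewhere, hence never satisfy the doubling condition \<open>weight_Dhat\<close>.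
\<close>

definition radial_weight :: "(complex \<Rightarrow> real) \<Rightarrow> bool" where
  "radial_weight \<nu> \<longleftrightarrow>
     (\<forall>z\<in>ball 0 1. 0 \<le> \<nu> z) \<and>
     (\<forall>z\<in>ball 0 1. \<nu> z = \<nu> (complex_of_real (cmod z))) \<and>
     set_integrable lebesgue (ball 0 1) \<nu> \<and>
     (\<forall>r\<in>{0..<1}. 0 < weight_tail \<nu> r)"

definition weight_Dhat :: "(complex \<Rightarrow> real) set" where
  "weight_Dhat =
     {\<nu>. radial_weight \<nu> \<and>
         (\<exists>C>0. \<forall>r\<in>{0..<1}. weight_tail \<nu> r \<le> C * weight_tail \<nu> ((1 + r) / 2))}"

definition weight_Dcheck :: "(complex \<Rightarrow> real) set" where
  "weight_Dcheck =
     {\<nu>. radial_weight \<nu> \<and>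
         (\<exists>K>1. \<exists>C>1. \<forall>r\<in>{0..<1}. C * weight_tail \<nu> (1 - (1 - r) / K) \<le> weight_tail \<nu> r)}"

definition weight_D :: "(complex \<Rightarrow> real) set" where
  "weight_D = weight_Dhat \<inter> weight_Dcheck"

definition weight_Dhat_p :: "real \<Rightarrow> (complex \<Rightarrow> real) set" where
  "weight_Dhat_p p =
     {\<nu>\<in>weight_Dhat.
        bdd_above ((\<lambda>r. (1 - r) powr p / weight_tail \<nu> r *
            (LINT s:{0..r}|lebesgue. \<nu> (complex_of_real s) / (1 - s) powr p)) ` {0..<1})}"

subsection \<open>Weighted Besov spaces and their zero sets\<close>

definition besov_space :: "real \<Rightarrow> (complex \<Rightarrow> real) \<Rightarrow> (complex \<Rightarrow> complex) set" where
  "besov_space p \<nu> =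
     {f\<in>hardy_space p.
        set_integrable lebesgue {0..<1}
          (\<lambda>r. integral_mean p r (deriv f) powr p * \<nu> (complex_of_real r))}"

text \<open>
  A finite or infinite sequence is a family \<open>z\<close> indexed by a set \<open>I\<close> of natural numbers. A point
  may occur several times, and every occurrence counts as a separate term.
\<close>

definition besov_zero_set ::
    "real \<Rightarrow> (complex \<Rightarrow> real) \<Rightarrow> nat set \<Rightarrow> (nat \<Rightarrow> complex) \<Rightarrow> bool" where
  "besov_zero_set p \<nu> I z \<longleftrightarrow>
     (\<exists>f\<in>besov_space p \<nu>.
        (\<exists>w\<in>ball 0 1. f w \<noteq> 0) \<and>
        {w\<in>ball 0 1. f w = 0} = z ` I \<and>
        (\<forall>w\<in>z ` I. finite {n\<in>I. z n = w} \<and> int (card {n\<in>I. z n = w}) = zorder f w))"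

definition pseudo_hyperbolic_dist :: "complex \<Rightarrow> complex \<Rightarrow> real" where
  "pseudo_hyperbolic_dist z w = cmod ((z - w) / (1 - cnj z * w))"

definition separated_seq :: "nat set \<Rightarrow> (nat \<Rightarrow> complex) \<Rightarrow> bool" where
  "separated_seq I z \<longleftrightarrow>
     z ` I \<subseteq> ball 0 1 \<and>
     (\<exists>\<delta>>0. \<forall>n\<in>I. \<forall>k\<in>I. n \<noteq> k \<longrightarrow> \<delta> < pseudo_hyperbolic_dist (z n) (z k))"

definition finite_union_separated :: "nat set \<Rightarrow> (nat \<Rightarrow> complex) \<Rightarrow> bool" where
  "finite_union_separated I z \<longleftrightarrow>
     (\<exists>\<J>. finite \<J> \<and> I = \<Union> \<J> \<and> (\<forall>J\<in>\<J>. separated_seq J z))"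

end

theory Submission
  imports Defs
begin

text \<open>
  Let \<open>f\<close> be a function of the Besov space with the given zeros and \<open>O\<close> its outer part. The mean
  oscillation \<open>A(z) = \<integral> \<bar>f - f(z)\<bar> P\<^sub>z\<close> of the boundary values against the Poisson kernel controls
  everything. Since \<open>ln x \<le> x - 1\<close> and \<open>\<bar>f\<bar> \<le> \<bar>O\<bar>\<close>, it bounds \<open>(1 - \<bar>z\<bar>) \<bar>O'(z)\<bar>\<close> up to a constant, and
  \<open>\<bar>O(z)\<bar> \<le> \<bar>f(z)\<bar> + A(z)\<close>, that is \<open>\<bar>O(z\<^sub>n)\<bar> \<le> A(z\<^sub>n)\<close>. The doubling conditions on the weight turn the
  Besov condition on \<open>f\<close>, by a discrete Hardy inequality over the radii \<open>1 - 2\<^sup>-\<^sup>k\<close>, into a weighted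
  \<open>L\<^sup>p\<close> bound for \<open>A\<close> on the disc. As \<open>A\<close> is essentially constant on Whitney cells, and a separated
  sequence has boundedly many points in each cell, the sum over the zeros is bounded by the same
  integral. The Besov condition also makes the radial variation of \<open>f\<close> integrable, so boundary values
  exist almost everywhere without Fatou's theorem.
\<close>

text \<open>The Hardy inequality is two-sided, because a Poisson average at level k meets two kinds
  of increments. The kernel spreads over nested arcs of the coarser levels i <= k, which are summed
  by the decay of the tails (\<open>weight_Dcheck\<close>). Over each arc the values near the
  boundary are reached radially through the finer levels j >= i, which are summed by the growth of
  2^(k p) times the tail; this growth combines \<open>weight_Dhat_p\<close> with
  \<open>weight_Dcheck\<close>. The doubling of \<open>weight_Dhat\<close> pays for shifting a level
  by one. All these estimates concern the values of f on the circle of radius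
  \<open>whitney m\<close>, where everything is continuous, and their constants do not depend on m;
  summability of the radial variation then lets m tend to infinity. The oscillation is taken of f,
  not of its modulus or its outer part, because f vanishes at the given points and is the Poisson
  integral of its boundary values. No factorisation of f is involved: |f| <= |O| comes from Jensen's
  inequality with |f| + e in place of |f|, where e > 0 removes the singularity of the logarithm at
  zeros.\<close>

abbreviation polar :: "real \<Rightarrow> real \<Rightarrow> complex" where
  "polar r t \<equiv> complex_of_real r * cis t"

abbreviation circle :: "real measure" where
  "circle \<equiv> lebesgue_on {0..2 * pi}"

subsection \<open>Power means\<close>

text \<open>The tangent to x^p at y lies below the graph; Young's inequality for x * y^(p-1) gives
  it directly. Averaged at y equal to a mean, its linear term vanishes, and this yields the
  Jensen-type bounds that follow.\<close>

lemma powr_ge_tangent: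
  fixes p x y :: real
  assumes "1 \<le> p" "0 \<le> x" "0 < y"
  shows "y powr p + p * y powr (p - 1) * (x - y) \<le> x powr p"
proof -
  have "x * y powr (p - 1) \<le> 1 / p * x powr p + (1 - 1 / p) * y powr p"
  proof (cases "x = 0")
    case False
    have "(x powr p) powr (1 / p) * (y powr p) powr (1 - 1 / p) \<le> 1 / p * x powr p + (1 - 1 / p) * y powr p"
      by (rule Youngs_inequality_0) (use assms False in auto)
    moreover have "(y powr p) powr (1 - 1 / p) = y powr (p - 1)"
      using assms by (simp add: powr_powr algebra_simps)
    ultimately show ?thesis
      using assms by (simp add: powr_powr)
  next
    case True
    have "0 \<le> (1 - 1 / p) * y powr p"
      using assms by (intro mult_nonneg_nonneg) auto
    then show ?thesis using True by simp
  qed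
  then have "p * (x * y powr (p - 1)) \<le> p * (1 / p * x powr p + (1 - 1 / p) * y powr p)"
    using assms by (intro mult_left_mono) auto
  then have "p * (x * y powr (p - 1)) \<le> x powr p + (p - 1) * y powr p"
    using assms by (simp add: algebra_simps)
  moreover have "y powr (p - 1) * y = y powr p"
    using assms powr_mult_base[of y "p - 1"] by (simp add: mult.commute)
  ultimately show ?thesis
    by (simp add: algebra_simps)
qed

text \<open>Jensen's inequality for x^p with unnormalised weights of mass s: the tangent inequality
  is averaged at the weighted mean y, and s^p = s^(p-1) * s restores the normalisation.\<close>

lemma sum_powr_le:
  fixes c x :: "'a \<Rightarrow> real"
  assumes "1 \<le> p" "finite S" "\<And>i. i \<in> S \<Longrightarrow> 0 \<le> c i" "\<And>i. i \<in> S \<Longrightarrow> 0 \<le> x i"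
  shows "(\<Sum>i\<in>S. c i * x i) powr p \<le> (\<Sum>i\<in>S. c i) powr (p - 1) * (\<Sum>i\<in>S. c i * x i powr p)"
proof (cases "(\<Sum>i\<in>S. c i * x i) = 0")
  case True
  then show ?thesis using assms by (auto intro!: mult_nonneg_nonneg sum_nonneg)
next
  case False
  define s where "s = (\<Sum>i\<in>S. c i)"
  define y where "y = (\<Sum>i\<in>S. c i * x i) / s"
  have pos: "(\<Sum>i\<in>S. c i * x i) > 0"
    using False assms by (simp add: order_less_le sum_nonneg)
  have "s > 0"
  proof (rule ccontr)
    assume "\<not> s > 0"
    then have "\<forall>i\<in>S. c i = 0"
      using assms sum_nonneg[of S c] sum_nonneg_eq_0_iff[of S c] by (simp add: s_def)
    then show False using False by simp
  qed
  then have y: "y > 0" "s * y = (\<Sum>i\<in>S. c i * x i)"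
    using pos by (auto simp: y_def)
  have "(\<Sum>i\<in>S. c i * (y powr p + p * y powr (p - 1) * (x i - y))) \<le> (\<Sum>i\<in>S. c i * x i powr p)"
    using assms y by (intro sum_mono mult_left_mono powr_ge_tangent) auto
  moreover have "(\<Sum>i\<in>S. c i * (y powr p + p * y powr (p - 1) * (x i - y)))
      = s * y powr p + p * y powr (p - 1) * ((\<Sum>i\<in>S. c i * x i) - s * y)"
    by (simp add: s_def algebra_simps sum.distrib sum_subtractf sum_distrib_left sum_distrib_right)
  ultimately have "s * y powr p \<le> (\<Sum>i\<in>S. c i * x i powr p)"
    using y by simp
  then have "s powr (p - 1) * (s * y powr p) \<le> s powr (p - 1) * (\<Sum>i\<in>S. c i * x i powr p)"
    by (intro mult_left_mono) auto
  moreover have "s powr (p - 1) * s = s powr p"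
    using \<open>s > 0\<close> powr_mult_base[of s "p - 1"] by (simp add: mult.commute)
  ultimately show ?thesis
    using y \<open>s > 0\<close> by (simp flip: s_def y(2) add: powr_mult mult.assoc[symmetric])
qed

lemma add_powr_le:
  fixes x y :: real
  assumes "1 \<le> p" "0 \<le> x" "0 \<le> y"
  shows "(x + y) powr p \<le> 2 powr (p - 1) * (x powr p + y powr p)"
  using sum_powr_le[OF assms(1), of UNIV "\<lambda>_. 1" "\<lambda>b. if b then x else y"] assms
  by (simp add: UNIV_bool add.commute)

lemma integral_powr_le:
  fixes k h :: "real \<Rightarrow> real"
  assumes "1 \<le> p" "continuous_on {a..b} k" "continuous_on {a..b} h"
    and "\<And>t. t \<in> {a..b} \<Longrightarrow> 0 \<le> k t" "\<And>t. t \<in> {a..b} \<Longrightarrow> 0 \<le> h t"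
  shows "(integral {a..b} (\<lambda>t. k t * h t)) powr p
    \<le> (integral {a..b} k) powr (p - 1) * integral {a..b} (\<lambda>t. k t * h t powr p)"
proof -
  have cp: "continuous_on {a..b} (\<lambda>t. h t powr p)"
    using assms by (intro continuous_on_powr' continuous_intros) auto
  have int: "k integrable_on {a..b}" "(\<lambda>t. k t * h t) integrable_on {a..b}"
      "(\<lambda>t. k t * h t powr p) integrable_on {a..b}"
    using assms cp by (auto intro!: integrable_continuous_interval continuous_intros)
  define s where "s = integral {a..b} k"
  define J where "J = integral {a..b} (\<lambda>t. k t * h t)"
  have J0: "J \<ge> 0" and s0: "s \<ge> 0" and R0: "integral {a..b} (\<lambda>t. k t * h t powr p) \<ge> 0"
    unfolding J_def s_def using assms int by (auto intro!: integral_nonneg)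
  show ?thesis
  proof (cases "J = 0")
    case True
    then show ?thesis using R0 assms by (simp flip: J_def)
  next
    case False
    have "s > 0"
    proof (rule ccontr)
      assume "\<not> s > 0"
      \<comment> \<open>A nonnegative continuous kernel of integral zero vanishes identically, so J
        = 0 against the case assumption. Degenerate intervals are treated apart.\<close>
      then have "(k has_integral 0) (cbox a b)"
        using s0 int by (auto simp: s_def has_integral_integral)
      then have "\<forall>t\<in>{a..b}. k t = 0" if "a < b"
        using has_integral_0_cbox_imp_0[of a b k] assms that
        by (auto simp: box_real)
      then have "J = 0" if "a < b"
        using that integral_cong[of "{a..b}" "\<lambda>t. k t * h t" "\<lambda>t. 0"] by (simp add: J_def)
      moreover have "J = 0" if "\<not> a < b"
        using that by (cases "a = b") (auto simp: J_def)
      ultimately show False using False by auto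
    qed
    define y where "y = J / s"
    have y: "y > 0" "s * y = J"
      using J0 False \<open>s > 0\<close> by (auto simp: y_def)
    have "integral {a..b} (\<lambda>t. k t * (y powr p + p * y powr (p - 1) * (h t - y)))
        \<le> integral {a..b} (\<lambda>t. k t * h t powr p)"
      using assms y int
      by (intro integral_le mult_left_mono powr_ge_tangent)
         (auto intro!: integrable_continuous_interval continuous_intros)
    moreover have "integral {a..b} (\<lambda>t. k t * (y powr p + p * y powr (p - 1) * (h t - y)))
        = s * y powr p + p * y powr (p - 1) * (J - s * y)"
    proof -
      have "((\<lambda>t. (y powr p - p * y powr (p - 1) * y) * k t + (p * y powr (p - 1)) * (k t * h t))
          has_integral (y powr p - p * y powr (p - 1) * y) * s + (p * y powr (p - 1)) * J) {a..b}"
        unfolding s_def J_def using int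
        by (intro has_integral_add has_integral_mult_right) (auto simp: has_integral_integral)
      then show ?thesis
        by (intro integral_unique) (simp add: algebra_simps)
    qed
    ultimately have "s * y powr p \<le> integral {a..b} (\<lambda>t. k t * h t powr p)"
      using y by simp
    then have "s powr (p - 1) * (s * y powr p) \<le> s powr (p - 1) * integral {a..b} (\<lambda>t. k t * h t powr p)"
      by (intro mult_left_mono) auto
    moreover have "s powr (p - 1) * s = s powr p"
      using \<open>s > 0\<close> powr_mult_base[of s "p - 1"] by (simp add: mult.commute)
    moreover have "J powr p = s powr p * y powr p"
      using y \<open>s > 0\<close> by (simp flip: y(2) add: powr_mult)
    ultimately show ?thesis
      by (simp flip: s_def J_def add: mult.assoc[symmetric])
  qed
qed

section \<open>Periodic functions and convolution on the circle\<close>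

lemma integral_periodic:
  fixes h :: "real \<Rightarrow> 'a::euclidean_space"
  assumes "continuous_on UNIV h" "\<And>t. h (t + 2 * pi) = h t"
  shows "integral {a..a + 2 * pi} h = integral {0..2 * pi} h"
proof -
  have ci: "h integrable_on {x..y}" for x y
    by (rule integrable_continuous_interval) (rule continuous_on_subset[OF assms(1)], simp)
  have 1: "integral {min 0 a..0} h + integral {0..2 * pi} h = integral {min 0 a..2 * pi} h"
    by (rule Henstock_Kurzweil_Integration.integral_combine) (auto intro: ci)
  have 2: "integral {min 0 a..a} h + integral {a..a + 2 * pi} h = integral {min 0 a..a + 2 * pi} h"
    by (rule Henstock_Kurzweil_Integration.integral_combine) (auto intro: ci)
  have sh: "integral {x + 2 * pi..y + 2 * pi} h = integral {x..y} h" for x y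
    using integral_shift_Icc_real[of x y h "2 * pi"] assms(2)
    by (simp add: o_def add.commute)
  show ?thesis
  proof (cases "a \<le> 0")
    case True
    have "integral {a..a + 2 * pi} h + integral {a + 2 * pi..2 * pi} h = integral {a..2 * pi} h"
      by (rule Henstock_Kurzweil_Integration.integral_combine) (use True ci in auto)
    moreover have "integral {a..0} h + integral {0..2 * pi} h = integral {a..2 * pi} h"
      using 1 True by (simp add: min_def split: if_splits)
    ultimately show ?thesis
      using sh[of a 0] by (metis add.commute add_left_cancel add_0)
  next
    case False
    have "integral {0..2 * pi} h + integral {2 * pi..a + 2 * pi} h = integral {0..a + 2 * pi} h"
      by (rule Henstock_Kurzweil_Integration.integral_combine) (use False ci in auto)
    moreover have "integral {0..a} h + integral {a..a + 2 * pi} h = integral {0..a + 2 * pi} h"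
      using 2 False by (simp add: min_def)
    ultimately show ?thesis
      using sh[of 0 a] by (metis add.commute add_left_cancel add_0)
  qed
qed

lemma integral_periodic_shift:
  fixes h :: "real \<Rightarrow> 'a::euclidean_space"
  assumes "continuous_on UNIV h" "\<And>t. h (t + 2 * pi) = h t"
  shows "integral {b..b + 2 * pi} (\<lambda>t. h (t + a)) = integral {0..2 * pi} h"
  using integral_shift_Icc_real[of b "b + 2 * pi" h a] integral_periodic[OF assms, of "a + b"]
  by (simp add: o_def add_ac)

lemma continuous_on_integral_Icc:
  fixes f :: "'a::topological_space \<Rightarrow> real \<Rightarrow> 'b::banach"
  assumes "continuous_on (U \<times> {a..b}) (\<lambda>x. f (fst x) (snd x))"
  shows "continuous_on U (\<lambda>x. integral {a..b} (f x))"
  using integral_continuous_on_param[of U a b f] assms by (simp add: case_prod_unfold)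

text \<open>Young's convolution inequality, L^1 against L^p: Jensen pointwise with the mass of k,
  then Fubini, then translation invariance of the integral of the periodic function h^p.\<close>

lemma integral_powr_convolution_le:
  fixes k h :: "real \<Rightarrow> real"
  assumes p: "1 \<le> p" and k: "continuous_on {a..b} k" "\<And>t. t \<in> {a..b} \<Longrightarrow> 0 \<le> k t"
    and h: "continuous_on UNIV h" "\<And>t. 0 \<le> h t" "\<And>t. h (t + 2 * pi) = h t"
  shows "integral {0..2 * pi} (\<lambda>\<theta>. (integral {a..b} (\<lambda>t. k t * h (\<theta> + t))) powr p)
    \<le> (integral {a..b} k) powr p * integral {0..2 * pi} (\<lambda>\<theta>. h \<theta> powr p)"
proof -
  have hc: "continuous_on S (\<lambda>x. h (g x))" if "continuous_on S g" for S and g :: "'b::topological_space \<Rightarrow> real"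
    by (rule continuous_on_compose2[OF h(1) that]) auto
  have hpc: "continuous_on S (\<lambda>x. h (g x) powr p)" if "continuous_on S g" for S and g :: "'b::topological_space \<Rightarrow> real"
    using h p by (intro continuous_on_powr' hc that continuous_intros) auto
  have kc: "continuous_on S (\<lambda>x. k (g x))" if "continuous_on S g" "g ` S \<subseteq> {a..b}"
    for S and g :: "real \<times> real \<Rightarrow> real"
    by (rule continuous_on_compose2[OF k(1) that(1)]) (use that in auto)
  define s where "s = integral {a..b} k"
  have s0: "s \<ge> 0"
    unfolding s_def using k by (intro integral_nonneg integrable_continuous_interval) auto
  have i1: "continuous_on {0..2 * pi} (\<lambda>\<theta>. integral {a..b} (\<lambda>t. k t * h (\<theta> + t)))"
    by (intro continuous_on_integral_Icc continuous_intros hc kc) auto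
  have i2: "continuous_on {0..2 * pi} (\<lambda>\<theta>. integral {a..b} (\<lambda>t. k t * h (\<theta> + t) powr p))"
    by (intro continuous_on_integral_Icc continuous_intros hpc kc) auto
  have nn: "integral {a..b} (\<lambda>t. k t * h (\<theta> + t)) \<ge> 0" for \<theta>
    using k h by (intro integral_nonneg integrable_continuous_interval continuous_intros hc mult_nonneg_nonneg) auto
  have "integral {0..2 * pi} (\<lambda>\<theta>. (integral {a..b} (\<lambda>t. k t * h (\<theta> + t))) powr p)
      \<le> integral {0..2 * pi} (\<lambda>\<theta>. s powr (p - 1) * integral {a..b} (\<lambda>t. k t * h (\<theta> + t) powr p))"
    unfolding s_def using p k h nn
    by (intro integral_le integral_powr_le hc continuous_intros integrable_continuous_interval
          continuous_on_powr' i1 i2) auto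
  also have "\<dots> = s powr (p - 1) * integral {0..2 * pi} (\<lambda>\<theta>. integral {a..b} (\<lambda>t. k t * h (\<theta> + t) powr p))"
    by simp
  also have "integral {0..2 * pi} (\<lambda>\<theta>. integral {a..b} (\<lambda>t. k t * h (\<theta> + t) powr p))
      = integral {a..b} (\<lambda>t. integral {0..2 * pi} (\<lambda>\<theta>. k t * h (\<theta> + t) powr p))"
    using integral_swap_continuous[of 0 a "2 * pi" b "\<lambda>\<theta> t. k t * h (\<theta> + t) powr p"]
    unfolding case_prod_unfold cbox_Pair_eq box_real
    by (simp, force intro!: continuous_intros hpc kc)
  also have "\<dots> = integral {a..b} (\<lambda>t. k t * integral {0..2 * pi} (\<lambda>\<theta>. h \<theta> powr p))"
  proof (rule integral_cong)
    fix t assume "t \<in> {a..b}"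
    have "integral {0..2 * pi} (\<lambda>\<theta>. h (\<theta> + t) powr p) = integral {0..2 * pi} (\<lambda>\<theta>. h \<theta> powr p)"
      using integral_periodic_shift[of "\<lambda>\<theta>. h \<theta> powr p" 0 t] h
      by (simp add: hpc continuous_on_id)
    then show "integral {0..2 * pi} (\<lambda>\<theta>. k t * h (\<theta> + t) powr p)
        = k t * integral {0..2 * pi} (\<lambda>\<theta>. h \<theta> powr p)"
      by simp
  qed
  also have "\<dots> = s * integral {0..2 * pi} (\<lambda>\<theta>. h \<theta> powr p)"
    by (simp add: s_def)
  finally show ?thesis
    using powr_mult_base[OF s0, of "p - 1"]
    by (simp add: s_def mult_ac) (simp add: mult.assoc[symmetric])
qed

subsection \<open>The Poisson kernel\<close>

text \<open>Normalised to mass 2 * pi on the circle, so averages carry the factor 1 / (2 *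
  pi).\<close>

definition poisson :: "complex \<Rightarrow> complex \<Rightarrow> real" where
  "poisson z w = (1 - (cmod z)\<^sup>2) / (cmod (w - z))\<^sup>2"

lemma poisson_nonneg: "cmod z < 1 \<Longrightarrow> 0 \<le> poisson z w"
  by (auto simp: poisson_def power_le_one_iff abs_square_le_1 intro!: divide_nonneg_nonneg)

lemma circle_minus_ge: "cmod w = 1 \<Longrightarrow> 1 - cmod z \<le> cmod (w - z)"
  using norm_triangle_ineq2[of w z] by simp

lemma poisson_le:
  assumes "cmod z < 1" "cmod w = 1"
  shows "poisson z w \<le> 2 / (1 - cmod z)"
proof -
  have "(1 - cmod z)\<^sup>2 \<le> (cmod (w - z))\<^sup>2"
    using assms circle_minus_ge[of w z] by (intro power_mono) auto
  moreover have "w \<noteq> z" using assms by auto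
  ultimately have "poisson z w \<le> (1 - (cmod z)\<^sup>2) / (1 - cmod z)\<^sup>2"
    unfolding poisson_def using assms
    by (intro divide_left_mono mult_pos_pos) (auto simp: power_le_one_iff abs_square_le_1)
  also have "\<dots> = ((1 + cmod z) * (1 - cmod z)) / ((1 - cmod z) * (1 - cmod z))"
    by (simp add: power2_eq_square algebra_simps)
  also have "\<dots> = (1 + cmod z) / (1 - cmod z)"
    using assms by simp
  also have "\<dots> \<le> 2 / (1 - cmod z)"
    using assms by (intro divide_right_mono) auto
  finally show ?thesis .
qed

lemma continuous_on_poisson [continuous_intros]:
  assumes "continuous_on S f" "continuous_on S g" "\<And>x. x \<in> S \<Longrightarrow> f x \<noteq> g x"
  shows "continuous_on S (\<lambda>x. poisson (f x) (g x))"
  unfolding poisson_def using assms by (intro continuous_intros) (auto, metis)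

text \<open>As w * cnj w = 1, the square of |w - z| is (w - z) times (cnj w - cnj z), and partial
  fractions split off the Cauchy kernel. The other term is holomorphic in w near the closed
  disc.\<close>

lemma poisson_eq:
  assumes "cmod w = 1" "cmod z < 1"
  shows "complex_of_real (poisson z w) = w / (w - z) + cnj z * w / (1 - cnj z * w)"
proof -
  have ww: "w * cnj w = 1"
    using assms complex_norm_square[of w] by simp
  have ne: "w - z \<noteq> 0" "1 - cnj z * w \<noteq> 0"
  proof -
    show "w - z \<noteq> 0" using assms by auto
    have "cmod (cnj z * w) < 1" using assms by (simp add: norm_mult)
    then show "1 - cnj z * w \<noteq> 0" by auto
  qed
  have ne': "cnj w - cnj z \<noteq> 0"
    using ne(1) by (metis complex_cnj_cancel_iff complex_cnj_diff eq_iff_diff_eq_0)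
  have 1: "1 - cnj z * w = w * (cnj w - cnj z)"
    using ww by (simp add: algebra_simps)
  have "complex_of_real (poisson z w) = (1 - z * cnj z) / ((w - z) * (cnj w - cnj z))"
    by (simp add: poisson_def complex_norm_square[symmetric] of_real_power)
       (metis complex_cnj_diff complex_norm_square of_real_power)
  also have "\<dots> = w / (w - z) + cnj z / (cnj w - cnj z)"
    using ne(1) ne' ww by (simp add: add_frac_eq) (simp add: algebra_simps)
  also have "cnj z / (cnj w - cnj z) = cnj z * w / (1 - cnj z * w)"
    unfolding 1 using ne 1 by auto
  finally show ?thesis .
qed

text \<open>The second summand of the kernel in \<open>poisson_eq\<close> is the boundary value of a function
  that vanishes at the origin, so only the Cauchy kernel contributes.\<close>

lemma poisson_formula:
  fixes f :: "complex \<Rightarrow> complex"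
  assumes f: "continuous_on (cball 0 1) f" "f holomorphic_on ball 0 1" and z: "cmod z < 1"
  shows "((\<lambda>t. complex_of_real (poisson z (cis t)) * f (cis t)) has_integral 2 * pi * f z) {0..2 * pi}"
proof -
  have circ: "(g has_contour_integral I) (circlepath 0 1) \<Longrightarrow>
      ((\<lambda>t. g (cis t) * cis t) has_integral I / \<i>) {0..2 * pi}" for g I
  proof -
    assume "(g has_contour_integral I) (circlepath 0 1)"
    then have "((\<lambda>t. g (cis t) * \<i> * cis t) has_integral I) {0..2 * pi}"
      by (simp add: circlepath_def has_contour_integral_part_circlepath_iff)
    from has_integral_divide[OF this, of \<i>] show ?thesis
      by (simp add: field_simps)
  qed
  have "((\<lambda>w. f w / (w - z)) has_contour_integral (2 * pi * \<i> * f z)) (circlepath 0 1)"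
    using Cauchy_integral_circlepath[OF f] z by (simp add: dist_norm)
  from circ[OF this] have 1: "((\<lambda>t. f (cis t) / (cis t - z) * cis t) has_integral 2 * pi * f z) {0..2 * pi}"
    by (simp add: field_simps)
  have nz: "1 - cnj z * w \<noteq> 0" if "cmod w \<le> 1" for w
  proof -
    have "cmod (cnj z * w) < 1"
      using z that by (simp add: norm_mult) (meson le_less_trans mult_left_le norm_ge_zero)
    then show ?thesis by auto
  qed
  have "((\<lambda>w. (cnj z * w / (1 - cnj z * w) * f w) / (w - 0)) has_contour_integral
      (2 * complex_of_real pi * \<i> * (cnj z * 0 / (1 - cnj z * 0) * f 0))) (circlepath 0 1)"
    using nz z by (intro Cauchy_integral_circlepath[where f = "\<lambda>w. cnj z * w / (1 - cnj z * w) * f w"]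
        continuous_intros holomorphic_intros f) auto
  from circ[OF this] have 2: "((\<lambda>t. cnj z * cis t / (1 - cnj z * cis t) * f (cis t)) has_integral 0) {0..2 * pi}"
    by (simp add: mult_ac)
  show ?thesis
    using has_integral_add[OF 1 2] z by (simp add: poisson_eq algebra_simps)
qed

lemma poisson_has_integral:
  assumes "cmod z < 1"
  shows "((\<lambda>t. poisson z (cis t)) has_integral 2 * pi) {0..2 * pi}"
  using has_integral_linear[OF poisson_formula[of "\<lambda>_. 1" z] bounded_linear_Re] assms
  by (simp add: o_def)

text \<open>A form of Harnack's inequality: |z - w| <= M (1 - |z|) <= M |x - z| compares the
  denominators, and |w| <= |z| compares the numerators.\<close>

lemma poisson_harnack:
  assumes "cmod z < 1" "cmod w \<le> cmod z" "cmod (z - w) \<le> M * (1 - cmod z)" "0 \<le> M" "cmod x = 1"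
  shows "poisson z x \<le> (1 + M)\<^sup>2 * poisson w x"
proof -
  have pos: "0 < 1 - cmod z" "1 - cmod z \<le> cmod (x - z)" "1 - cmod w \<le> cmod (x - w)"
    using assms circle_minus_ge by auto
  have "cmod (x - w) \<le> cmod (x - z) + cmod (z - w)"
    using norm_triangle_ineq[of "x - z" "z - w"] by simp
  also have "\<dots> \<le> cmod (x - z) + M * cmod (x - z)"
    using assms pos mult_left_mono[of "1 - cmod z" "cmod (x - z)" M] by linarith
  finally have "cmod (x - w) \<le> (1 + M) * cmod (x - z)"
    by (simp add: algebra_simps)
  then have le: "(cmod (x - w))\<^sup>2 \<le> (1 + M)\<^sup>2 * (cmod (x - z))\<^sup>2"
    by (simp flip: power_mult_distrib add: power_mono)
  have "poisson z x \<le> (1 - (cmod w)\<^sup>2) / (cmod (x - z))\<^sup>2"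
    unfolding poisson_def using assms by (intro divide_right_mono) (auto intro!: power_mono)
  also have "\<dots> \<le> (1 + M)\<^sup>2 * poisson w x"
  proof -
    have "(1 - (cmod w)\<^sup>2) * (cmod (x - w))\<^sup>2 \<le> (1 - (cmod w)\<^sup>2) * ((1 + M)\<^sup>2 * (cmod (x - z))\<^sup>2)"
      using assms le by (intro mult_left_mono) (auto simp: power_le_one_iff abs_square_le_1)
    moreover have "cmod (x - z) > 0" "cmod (x - w) > 0" using pos assms by linarith+
    ultimately show ?thesis by (simp add: poisson_def field_simps)
  qed
  finally show ?thesis .
qed

section \<open>Dyadic majorant of the Poisson kernel\<close>

lemma cmod_1_minus_cis:
  "(cmod (1 - polar r t))\<^sup>2 = (1 - r)\<^sup>2 + 4 * r * (sin (t / 2))\<^sup>2"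
proof -
  have c: "cos t = 1 - 2 * (sin (t / 2))\<^sup>2"
    using cos_double_sin[of "t / 2"] by simp
  have "(cmod (1 - polar r t))\<^sup>2 = (1 - r * cos t)\<^sup>2 + (r * sin t)\<^sup>2"
    by (simp add: cmod_power2)
  also have "\<dots> = 1 - 2 * r * cos t + r\<^sup>2 * ((sin t)\<^sup>2 + (cos t)\<^sup>2)"
    by (simp only: power2_eq_square) algebra
  also have "\<dots> = (1 - r)\<^sup>2 + 2 * r * (1 - cos t)"
    unfolding sin_cos_squared_add by (simp add: power2_eq_square algebra_simps)
  also have "\<dots> = (1 - r)\<^sup>2 + 4 * r * (sin (t / 2))\<^sup>2"
    unfolding c by simp
  finally show ?thesis .
qed

text \<open>Jordan's inequality, squared: between 0 and pi / 2 the concave sine lies above its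
  chord.\<close>

lemma sin_half_ge:
  assumes "\<bar>t\<bar> \<le> pi" shows "t\<^sup>2 / pi\<^sup>2 \<le> (sin (t / 2))\<^sup>2"
proof -
  have "\<bar>t\<bar> / pi \<le> sin (\<bar>t\<bar> / 2)"
  proof -
    have "concave_on {0..pi} sin"
    proof (rule f''_le0_imp_concave)
      show "convex {0..pi}" by simp
      show "(sin has_real_derivative cos x) (at x)" for x by (rule DERIV_sin)
      show "(cos has_real_derivative - sin x) (at x)" for x by (rule DERIV_cos)
      show "- sin x \<le> 0" if "x \<in> {0..pi}" for x using that by (simp add: sin_ge_zero)
    qed
    then have "sin ((1 - \<bar>t\<bar> / pi) *\<^sub>R 0 + (\<bar>t\<bar> / pi) *\<^sub>R (pi / 2))
        \<ge> (1 - \<bar>t\<bar> / pi) * sin 0 + (\<bar>t\<bar> / pi) * sin (pi / 2)"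
      using assms by (intro concave_onD) (auto simp: divide_simps)
    then show ?thesis by simp
  qed
  then have "(\<bar>t\<bar> / pi)\<^sup>2 \<le> (sin (\<bar>t\<bar> / 2))\<^sup>2"
    by (intro power_mono) auto
  then show ?thesis
    by (cases "t \<ge> 0") (auto simp: power_divide abs_if)
qed


text \<open>For |t| about pi / 2^i the kernel has size (1 - r) / t^2, about 4^i / 2^k. Nested arcs
  replace disjoint dyadic rings: a single suitable term of the sum already dominates, and integrals
  over full arcs are what the convolution inequality handles.\<close>

lemma poisson_dyadic_le:
  assumes "\<bar>t\<bar> \<le> pi" and z: "z = polar (1 - (1 / 2) ^ k) \<theta>"
  shows "poisson z (cis (\<theta> + t)) \<le> 4 * (\<Sum>i\<le>k. 2 ^ (2 * i) / 2 ^ k * (if \<bar>t\<bar> \<le> pi / 2 ^ i then 1 else 0))"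
proof -
  define r :: real where "r = 1 - (1 / 2) ^ k"
  have r: "0 \<le> r" "r < 1" "1 - r = (1 / 2) ^ k"
    by (auto simp: r_def power_le_one)
  have cz: "cmod z = r" using r by (simp add: z norm_mult flip: r_def)
  have term_nonneg: "0 \<le> (2::real) ^ (2 * i) / 2 ^ k * (if \<bar>t\<bar> \<le> pi / 2 ^ i then 1 else 0)" for i
    by simp
  have term_le: "(2::real) ^ (2 * i) / 2 ^ k * (if \<bar>t\<bar> \<le> pi / 2 ^ i then 1 else 0)
      \<le> (\<Sum>i\<le>k. 2 ^ (2 * i) / 2 ^ k * (if \<bar>t\<bar> \<le> pi / 2 ^ i then 1 else 0))" if "i \<le> k" for i
    using that term_nonneg by (intro member_le_sum) auto
  have cd: "cmod (cis (\<theta> + t) - z) = cmod (1 - polar r (- t))"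
  proof -
    have "cis (\<theta> + t) - z = cis (\<theta> + t) * (1 - polar r (- t))"
      unfolding right_diff_distrib z r_def by (simp add: cis_mult mult.left_commute[of "cis (\<theta> + t)"])
    then show ?thesis by (simp add: norm_mult)
  qed
  show ?thesis
  proof (cases "\<bar>t\<bar> \<le> pi / 2 ^ k")
    case True
    have "poisson z (cis (\<theta> + t)) \<le> 2 / (1 - cmod z)"
      using cz r by (intro poisson_le) auto
    also have "\<dots> = 2 * 2 ^ k"
      using r by (simp add: cz power_divide)
    also have "\<dots> \<le> 4 * (2 ^ (2 * k) / 2 ^ k * (if \<bar>t\<bar> \<le> pi / 2 ^ k then 1 else 0))"
      using True by (simp add: power_even_eq power2_eq_square)
    also have "\<dots> \<le> 4 * (\<Sum>i\<le>k. 2 ^ (2 * i) / 2 ^ k * (if \<bar>t\<bar> \<le> pi / 2 ^ i then 1 else 0))"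
      using term_le[of k] by (intro mult_left_mono) auto
    finally show ?thesis .
  next
    case False
    \<comment> \<open>The index of the smallest arc that contains t. It is bounded by k because t
      lies outside the arc of index k, and its maximality gives pi / 2^(i+1) < |t|.\<close>
    define i where "i = (GREATEST i. \<bar>t\<bar> \<le> pi / 2 ^ i)"
    have ex: "\<bar>t\<bar> \<le> pi / 2 ^ 0" using assms by simp
    have bd: "i \<le> k" if "\<bar>t\<bar> \<le> pi / 2 ^ i" for i
    proof (rule ccontr)
      assume "\<not> i \<le> k"
      then have "pi / 2 ^ i \<le> pi / 2 ^ k" by (intro divide_left_mono power_increasing) auto
      then show False using that False by simp
    qed
    have i: "\<bar>t\<bar> \<le> pi / 2 ^ i"
      unfolding i_def by (rule GreatestI_nat[of _ 0 k]) (use ex bd in auto)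
    have "\<not> \<bar>t\<bar> \<le> pi / 2 ^ Suc i"
      using Greatest_le_nat[of "\<lambda>i. \<bar>t\<bar> \<le> pi / 2 ^ i" "Suc i" k] bd
      by (auto simp flip: i_def)
    then have "pi / 2 ^ Suc i \<le> \<bar>t\<bar>" by simp
    then have "(pi / 2 ^ Suc i)\<^sup>2 \<le> \<bar>t\<bar>\<^sup>2" by (intro power_mono) auto
    then have ti: "pi\<^sup>2 / (4 * 2 ^ (2 * i)) \<le> t\<^sup>2"
      by (simp add: power_divide power_mult_distrib power_even_eq)
    have t0: "t \<noteq> 0" using False by auto
    have P: "poisson z (cis (\<theta> + t)) \<le> pi\<^sup>2 / (2 ^ k * t\<^sup>2)"
    \<comment> \<open>For k = 0 the radius is 0, the sine term on which the lower bound of the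
      denominator rests disappears, and the kernel is 1. For k > 0 the radius is at least 1 /
      2.\<close>
    proof (cases "k = 0")
      case True
      then have "poisson z (cis (\<theta> + t)) = 1" by (simp add: poisson_def z)
      moreover have "t\<^sup>2 \<le> pi\<^sup>2" using assms(1) by (metis abs_le_square_iff abs_of_pos pi_gt_zero)
      ultimately show ?thesis using True t0 by simp
    next
      case False
      then have "(1/2::real) ^ k \<le> (1/2) ^ 1" by (intro power_decreasing) auto
      then have r4: "2 \<le> 4 * r" by (simp add: r_def)
      have "2 * t\<^sup>2 / pi\<^sup>2 \<le> 2 * (sin (t / 2))\<^sup>2" using sin_half_ge[OF assms(1)] by simp
      also have "\<dots> \<le> (1 - r)\<^sup>2 + 4 * r * (sin (t / 2))\<^sup>2"
        using mult_right_mono[OF r4 zero_le_power2[of "sin (t / 2)"]] zero_le_power2[of "1 - r"]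
        by linarith
      also have "\<dots> = (cmod (cis (\<theta> + t) - z))\<^sup>2"
        unfolding cd cmod_1_minus_cis by simp
      finally have low: "2 * t\<^sup>2 / pi\<^sup>2 \<le> (cmod (cis (\<theta> + t) - z))\<^sup>2" .
      have "1 - r\<^sup>2 = (1 - r) * (1 + r)" by (simp add: power2_eq_square algebra_simps)
      also have "\<dots> \<le> (1 - r) * 2" using r by (intro mult_left_mono) auto
      finally have "poisson z (cis (\<theta> + t)) \<le> ((1 - r) * 2) / (2 * t\<^sup>2 / pi\<^sup>2)"
        unfolding poisson_def cz using low t0 r
        by (intro frac_le) auto
      also have "\<dots> = pi\<^sup>2 / (2 ^ k * t\<^sup>2)"
        unfolding r(3) by (simp add: power_divide)
      finally show ?thesis .
    qed
    also have "\<dots> \<le> pi\<^sup>2 / (2 ^ k * (pi\<^sup>2 / (4 * 2 ^ (2 * i))))"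
      using ti t0 by (intro divide_left_mono mult_left_mono mult_pos_pos) auto
    also have "\<dots> = 4 * (2 ^ (2 * i) / 2 ^ k * (if \<bar>t\<bar> \<le> pi / 2 ^ i then 1 else 0))"
      using i by simp
    also have "\<dots> \<le> 4 * (\<Sum>i\<le>k. 2 ^ (2 * i) / 2 ^ k * (if \<bar>t\<bar> \<le> pi / 2 ^ i then 1 else 0))"
      using term_le[of i] bd[OF i] by (intro mult_left_mono) auto
    finally show ?thesis .
  qed
qed

lemma norm_le_poisson_integral:
  fixes f :: "complex \<Rightarrow> complex"
  assumes f: "continuous_on (cball 0 1) f" "f holomorphic_on ball 0 1" and z: "cmod z < 1"
  shows "cmod (f z - c) \<le> 1 / (2 * pi) * integral {0..2 * pi} (\<lambda>t. poisson z (cis t) * cmod (f (cis t) - c))"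
proof -
  have ff: "((\<lambda>t. complex_of_real (poisson z (cis t)) * (f (cis t) - c)) has_integral 2 * pi * (f z - c)) {0..2 * pi}"
    using f by (intro poisson_formula z continuous_intros holomorphic_intros)
  have cf: "continuous_on {0..2 * pi} (\<lambda>t. f (cis t))"
    by (rule continuous_on_compose2[OF f(1)]) (auto intro!: continuous_intros)
  have "2 * pi * cmod (f z - c) = cmod (2 * pi * (f z - c))"
    by (simp add: norm_mult)
  also have "\<dots> = cmod (integral {0..2 * pi} (\<lambda>t. complex_of_real (poisson z (cis t)) * (f (cis t) - c)))"
    using integral_unique[OF ff] by simp
  also have "\<dots> \<le> integral {0..2 * pi} (\<lambda>t. poisson z (cis t) * cmod (f (cis t) - c))"
    using ff z
    by (intro Henstock_Kurzweil_Integration.integral_norm_bound_integral)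
       (auto simp: norm_mult poisson_nonneg intro!: integrable_continuous_interval continuous_intros cf)
  finally show ?thesis by (simp add: field_simps)
qed

text \<open>Hardy's monotonicity of integral means: |f| on the circle of radius r is bounded by the
  convolution of |f| on the circle of radius s with the Poisson kernel at r / s, a kernel of mass 1
  after division by 2 * pi.\<close>

lemma integral_powr_circle_mono:
  assumes p: "1 \<le> p" and f: "f holomorphic_on ball 0 1" and rs: "0 \<le> r" "r \<le> s" "s < 1"
  shows "integral {0..2 * pi} (\<lambda>\<theta>. cmod (f (polar r \<theta>)) powr p)
    \<le> integral {0..2 * pi} (\<lambda>\<theta>. cmod (f (polar s \<theta>)) powr p)"
proof (cases "r = s")
  case False
  then have s0: "0 < s" "r / s < 1" "0 \<le> r / s" using rs by (auto simp: divide_simps)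
  have cf: "continuous_on UNIV (\<lambda>\<theta>. f (polar t \<theta>))" if "0 \<le> t" "t < 1" for t
    using that by (intro continuous_on_compose2[OF holomorphic_on_imp_continuous_on[OF f]] continuous_intros)
      (auto simp: norm_mult)
  have cp: "(\<lambda>\<theta>. cmod (f (polar t \<theta>)) powr p) integrable_on {0..2 * pi}" if "0 \<le> t" "t < 1" for t
    using p by (intro integrable_continuous_interval continuous_on_powr' continuous_intros
          continuous_on_subset[OF cf[OF that]]) auto
  define k where "k = (\<lambda>t. 1 / (2 * pi) * poisson (complex_of_real (r / s)) (cis t))"
  have kpos: "0 \<le> k t" for t
    unfolding k_def using s0 rs by (intro mult_nonneg_nonneg poisson_nonneg) (auto simp: norm_divide)
  have "complex_of_real (r / s) \<noteq> cis t" for t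
  proof
    assume "complex_of_real (r / s) = cis t"
    then have "cmod (complex_of_real (r / s)) = 1" by simp
    then show False using s0 rs by (simp add: norm_divide)
  qed
  then have kc: "continuous_on {0..2 * pi} k"
    unfolding k_def by (intro continuous_intros)
  have ki: "integral {0..2 * pi} k = 1"
    unfolding k_def using poisson_has_integral[of "complex_of_real (r / s)"] s0 rs
    by (simp add: integral_unique norm_divide)
  define h where "h = (\<lambda>t. cmod (f (polar s t)))"
  have hn: "0 \<le> h t" for t by (simp add: h_def)
  have hc: "continuous_on UNIV h"
    unfolding h_def using rs s0 by (intro continuous_intros cf) auto
  have "cmod (f (polar r \<theta>)) \<le> integral {0..2 * pi} (\<lambda>t. k t * h (\<theta> + t))" for \<theta>
  proof -
    have sb: "polar s \<theta> * w \<in> ball 0 1" if "cmod w \<le> 1" for w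
    proof -
      have "s * cmod w < 1" using that rs s0
        by (meson le_less_trans mult_left_le order_less_imp_le)
      then show ?thesis using s0 by (simp add: norm_mult)
    qed
    have "cmod (f (polar s \<theta> * complex_of_real (r / s)) - 0) \<le> 1 / (2 * pi) *
       integral {0..2 * pi} (\<lambda>t. poisson (complex_of_real (r / s)) (cis t) * cmod (f (polar s \<theta> * cis t) - 0))"
      using s0 rs
      by (intro norm_le_poisson_integral[of "\<lambda>w. f (polar s \<theta> * w)"]
           continuous_on_compose2[OF holomorphic_on_imp_continuous_on[OF f]]
           holomorphic_on_compose_gen[OF _ f, unfolded o_def] holomorphic_intros continuous_intros)
         (auto intro!: sb simp del: mem_ball simp: norm_divide)
    also have "polar s \<theta> * complex_of_real (r / s) = polar r \<theta>"
      using s0 by simp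
    finally show ?thesis
      by (simp add: k_def h_def cis_mult mult.assoc)
  qed
  then have "integral {0..2 * pi} (\<lambda>\<theta>. cmod (f (polar r \<theta>)) powr p)
      \<le> integral {0..2 * pi} (\<lambda>\<theta>. (integral {0..2 * pi} (\<lambda>t. k t * h (\<theta> + t))) powr p)"
    using rs p
    by (intro integral_le cp powr_mono2 integrable_continuous_interval continuous_on_powr'
          continuous_on_integral_Icc continuous_intros continuous_on_compose2[OF kc]
          continuous_on_compose2[OF hc])
       (auto intro!: integral_nonneg mult_nonneg_nonneg kpos integrable_continuous_interval continuous_intros
         continuous_on_compose2[OF hc] kc hn)
  also have "\<dots> \<le> (integral {0..2 * pi} k) powr p * integral {0..2 * pi} (\<lambda>\<theta>. h \<theta> powr p)"
    by (intro integral_powr_convolution_le p kc kpos hc) (auto simp: h_def simp flip: cis_mult)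
  finally show ?thesis by (simp add: ki h_def)
qed simp

subsection \<open>Jensen's inequality\<close>

text \<open>Real trigonometric polynomials on the circle, as real parts of polynomials in w. The
  rule \<open>cong\<close> identifies functions that agree on the circle, for there cnj w = 1 / w
  and a product is again of this form.\<close>

inductive trig_poly :: "(complex \<Rightarrow> real) \<Rightarrow> bool" where
  monom: "trig_poly (\<lambda>w. Re (c * w ^ n))"
| add: "trig_poly g \<Longrightarrow> trig_poly h \<Longrightarrow> trig_poly (\<lambda>w. g w + h w)"
| cong: "trig_poly g \<Longrightarrow> (\<And>w. cmod w = 1 \<Longrightarrow> h w = g w) \<Longrightarrow> trig_poly h"

text \<open>2 Re a Re b = Re (a b) + Re (a cnj b), and the conjugate of w^m is w^(-m) on the circle;
  taking m <= n keeps the exponent n - m natural.\<close>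

lemma trig_poly_mult_monom: "trig_poly (\<lambda>w. Re (c * w ^ n) * Re (d * w ^ m))"
proof -
  have *: "trig_poly (\<lambda>w. Re (c * w ^ n) * Re (d * w ^ m))" if "m \<le> n" for c d n m
  proof (rule trig_poly.cong)
    show "trig_poly (\<lambda>w. Re (c * d / 2 * w ^ (n + m)) + Re (c * cnj d / 2 * w ^ (n - m)))"
      by (intro trig_poly.intros)
    fix w :: complex assume w: "cmod w = 1"
    have "w ^ n * cnj (w ^ m) = w ^ (n - m) * (w ^ m * cnj (w ^ m))"
      using that by (simp flip: power_add mult.assoc)
    also have "w ^ m * cnj (w ^ m) = 1"
      by (metis complex_norm_square norm_power of_real_1 power_one w)
    finally have "w ^ (n - m) = w ^ n * cnj (w ^ m)" by simp
    then have "c * d / 2 * w ^ (n + m) + c * cnj d / 2 * w ^ (n - m)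
        = (c * w ^ n) * ((d * w ^ m + cnj (d * w ^ m)) / 2)"
      by (simp add: power_add field_simps)
    also have "\<dots> = (c * w ^ n) * complex_of_real (Re (d * w ^ m))"
      unfolding complex_add_cnj by simp
    finally have "Re (c * d / 2 * w ^ (n + m) + c * cnj d / 2 * w ^ (n - m)) = Re (c * w ^ n) * Re (d * w ^ m)"
      by simp
    then show "Re (c * w ^ n) * Re (d * w ^ m)
        = Re (c * d / 2 * w ^ (n + m)) + Re (c * cnj d / 2 * w ^ (n - m))" by simp
  qed
  show ?thesis
    using *[of m n c d] *[of n m d c] by (cases "m \<le> n") (auto simp: mult.commute)
qed

lemma trig_poly_mult:
  assumes "trig_poly g" "trig_poly h" shows "trig_poly (\<lambda>w. g w * h w)"
  using assms(1)
proof induction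
  case (monom c n)
  show ?case
    using assms(2)
  proof induction
    case (monom d m)
    show ?case by (rule trig_poly_mult_monom)
  next
    case (add g h)
    then show ?case by (simp add: distrib_left trig_poly.add)
  next
    case (cong g h)
    show ?case by (rule trig_poly.cong[OF cong.IH]) (simp add: cong.hyps)
  qed
next
  case (add g h)
  then show ?case by (simp add: distrib_right trig_poly.add)
next
  case (cong g h)
  show ?case by (rule trig_poly.cong[OF cong.IH]) (simp add: cong.hyps)
qed

lemma trig_poly_real_polynomial_function: "real_polynomial_function g \<Longrightarrow> trig_poly g"
proof (induction rule: real_polynomial_function.induct)
  case (linear f)
  interpret bounded_linear f by fact
  show ?case
  \<comment> \<open>The real linear form Re w * f 1 + Im w * f \<i> is the real part of (f 1 - \<i>
    f \<i>) w.\<close>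
  proof (rule trig_poly.cong[OF trig_poly.monom[of "Complex (f 1) (- f \<i>)" 1]])
    fix w :: complex
    have "f w = f (Re w *\<^sub>R 1 + Im w *\<^sub>R \<i>)"
      by (rule arg_cong[of _ _ f]) (simp add: complex_eq_iff)
    also have "\<dots> = Re w * f 1 + Im w * f \<i>"
      unfolding add scaleR by simp
    finally show "f w = Re (Complex (f 1) (- f \<i>) * w ^ 1)" by (simp add: mult.commute)
  qed
next
  case (const c)
  then show ?case using trig_poly.monom[of "complex_of_real c" 0] by simp
qed (auto intro: trig_poly.add trig_poly_mult)

lemma trig_poly_eq_Re_holomorphic:
  "trig_poly g \<Longrightarrow> \<exists>h. h holomorphic_on UNIV \<and> (\<forall>w. cmod w = 1 \<longrightarrow> Re (h w) = g w)"
proof (induction rule: trig_poly.induct)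
  case (monom c n)
  show ?case by (intro exI[of _ "\<lambda>w. c * w ^ n"]) (auto intro!: holomorphic_intros)
next
  case (add g h)
  then obtain G H where "G holomorphic_on UNIV" "H holomorphic_on UNIV"
    "\<forall>w. cmod w = 1 \<longrightarrow> Re (G w) = g w" "\<forall>w. cmod w = 1 \<longrightarrow> Re (H w) = h w"
    by blast
  then show ?case by (intro exI[of _ "\<lambda>w. G w + H w"]) (auto intro!: holomorphic_intros)
next
  case (cong g h)
  then show ?case by auto
qed

text \<open>Stone-Weierstrass takes the place of solving a Dirichlet problem: uniform approximation
  by real parts of entire functions suffices for a maximum principle argument.\<close>

lemma real_continuous_approx_Re_holomorphic:
  fixes u :: "complex \<Rightarrow> real"
  assumes "continuous_on (sphere 0 1) u" "0 < e"
  obtains h where "h holomorphic_on UNIV" "\<And>w. cmod w = 1 \<Longrightarrow> \<bar>u w - Re (h w)\<bar> < e"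
proof -
  obtain g where g: "real_polynomial_function g" "\<And>w. w \<in> sphere 0 1 \<Longrightarrow> \<bar>u w - g w\<bar> < e"
    using Stone_Weierstrass_real_polynomial_function[of "sphere 0 1" u e] assms by auto
  obtain h where "h holomorphic_on UNIV" "\<forall>w. cmod w = 1 \<longrightarrow> Re (h w) = g w"
    using trig_poly_eq_Re_holomorphic[OF trig_poly_real_polynomial_function[OF g(1)]] by blast
  then show ?thesis using g(2) by (intro that[of h]) auto
qed

text \<open>Up to an error, \<open>u\<close> is the real part of an entire function \<open>h\<close> on the circle, and the maximum
  principle applies to \<open>f * exp (- h)\<close>; zeros of \<open>f\<close> play no role.\<close>

lemma norm_le_exp_poisson_integral:
  fixes f :: "complex \<Rightarrow> complex" and u :: "complex \<Rightarrow> real"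
  assumes f: "continuous_on (cball 0 1) f" "f holomorphic_on ball 0 1"
    and u: "continuous_on (sphere 0 1) u" "\<And>w. cmod w = 1 \<Longrightarrow> cmod (f w) \<le> exp (u w)"
    and z: "cmod z < 1" "f z \<noteq> 0"
  shows "ln (cmod (f z)) \<le> 1 / (2 * pi) * integral {0..2 * pi} (\<lambda>t. poisson z (cis t) * u (cis t))"
proof (rule field_le_epsilon)
  fix e :: real assume "0 < e"
  then obtain h where h: "h holomorphic_on UNIV" "\<And>w. cmod w = 1 \<Longrightarrow> \<bar>u w - Re (h w)\<bar> < e / 2"
    using real_continuous_approx_Re_holomorphic[OF u(1), of "e / 2"] by auto
  have hc: "continuous_on S h" for S
    using holomorphic_on_imp_continuous_on[OF h(1)] continuous_on_subset by blast
  have "cmod (f z * exp (- h z)) \<le> exp (e / 2)"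
  proof (rule maximum_modulus_frontier[of "\<lambda>z. f z * exp (- h z)" "ball 0 1"])
    show "(\<lambda>z. f z * exp (- h z)) holomorphic_on interior (ball 0 1)"
      using h(1) f(2) by (auto intro!: holomorphic_intros intro: holomorphic_on_subset)
    show "continuous_on (closure (ball 0 1)) (\<lambda>z. f z * exp (- h z))"
      using f(1) by (auto intro!: continuous_intros hc)
    fix w :: complex assume "w \<in> frontier (ball 0 1)"
    then have w: "cmod w = 1" by simp
    have "cmod (f w * exp (- h w)) \<le> exp (u w) * exp (- Re (h w))"
      using u(2)[OF w] by (simp add: norm_mult)
    also have "\<dots> = exp (u w - Re (h w))" by (simp flip: exp_add)
    also have "\<dots> \<le> exp (e / 2)" using h(2)[OF w] abs_ge_self[of "u w - Re (h w)"] by simp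
    finally show "cmod (f w * exp (- h w)) \<le> exp (e / 2)" .
  qed (use z in auto)
  then have "cmod (f z) \<le> exp (e / 2) * exp (Re (h z))"
    by (simp add: norm_mult norm_divide exp_minus field_simps)
  then have "cmod (f z) \<le> exp (e / 2 + Re (h z))" by (simp add: exp_add)
  then have 1: "ln (cmod (f z)) \<le> e / 2 + Re (h z)"
    using z(2) ln_le_cancel_iff[of "cmod (f z)" "exp (e / 2 + Re (h z))"] by simp
  have uc: "continuous_on {0..2 * pi} (\<lambda>t. u (cis t))"
    by (rule continuous_on_compose2[OF u(1)]) (auto intro!: continuous_intros)
  have hi: "((\<lambda>t. poisson z (cis t) * Re (h (cis t))) has_integral 2 * pi * Re (h z)) {0..2 * pi}"
    using has_integral_linear[OF poisson_formula[of h z] bounded_linear_Re] z h(1)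
    by (simp add: o_def hc holomorphic_on_subset)
  have ui: "((\<lambda>t. poisson z (cis t) * u (cis t) + e / 2 * poisson z (cis t)) has_integral
      integral {0..2 * pi} (\<lambda>t. poisson z (cis t) * u (cis t)) + e / 2 * (2 * pi)) {0..2 * pi}"
    using z uc by (intro has_integral_add has_integral_mult_right poisson_has_integral integrable_integral
         integrable_continuous_interval continuous_intros) auto
  have "2 * pi * Re (h z) \<le> integral {0..2 * pi} (\<lambda>t. poisson z (cis t) * u (cis t)) + e / 2 * (2 * pi)"
  proof (rule has_integral_le[OF hi ui])
    fix t
    have "poisson z (cis t) * Re (h (cis t)) \<le> poisson z (cis t) * (u (cis t) + e / 2)"
      using h(2)[of "cis t"] abs_ge_minus_self[of "u (cis t) - Re (h (cis t))"] z
      by (intro mult_left_mono poisson_nonneg) auto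
    then show "poisson z (cis t) * Re (h (cis t)) \<le> poisson z (cis t) * u (cis t) + e / 2 * poisson z (cis t)"
      by (simp add: algebra_simps)
  qed
  then have "Re (h z) \<le> 1 / (2 * pi) * integral {0..2 * pi} (\<lambda>t. poisson z (cis t) * u (cis t)) + e / 2"
    by (simp add: field_simps)
  with 1 show "ln (cmod (f z)) \<le> 1 / (2 * pi) * integral {0..2 * pi} (\<lambda>t. poisson z (cis t) * u (cis t)) + e"
    by simp
qed

subsection \<open>Radial weights at dyadic radii\<close>

definition whitney :: "nat \<Rightarrow> real" where
  "whitney k = 1 - (1 / 2) ^ k"

lemma whitney_ge_0 [simp]: "0 \<le> whitney k"
  and whitney_less_1 [simp]: "whitney k < 1"
  and whitney_0 [simp]: "whitney 0 = 0"
  and one_minus_whitney: "1 - whitney k = 1 / 2 ^ k"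
  by (auto simp: whitney_def power_le_one power_divide)

lemma whitney_le_imp_nonneg: "whitney k \<le> s \<Longrightarrow> 0 \<le> s"
  using order.trans[OF whitney_ge_0] .

lemma less_whitney_imp_less_1: "s < whitney k \<Longrightarrow> s < 1"
  using less_trans[OF _ whitney_less_1] .

lemma le_whitney_imp_less_1: "s \<le> whitney k \<Longrightarrow> s < 1"
  using le_less_trans[OF _ whitney_less_1] .

lemmas whitney_range = whitney_le_imp_nonneg less_whitney_imp_less_1 le_whitney_imp_less_1

lemma whitney_mono: "i \<le> k \<Longrightarrow> whitney i \<le> whitney k"
  by (auto simp: whitney_def intro!: power_decreasing)

lemma whitney_Suc: "whitney (Suc k) = (1 + whitney k) / 2"
  by (simp add: whitney_def field_simps)

lemma whitney_diff: "whitney (Suc k) - whitney k = 1 / 2 ^ Suc k"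
  by (simp add: whitney_def power_divide field_simps)

lemma whitney_less_Suc: "whitney k < whitney (Suc k)"
  by (simp add: whitney_def)

lemma whitney_tendsto: "whitney \<longlonglongrightarrow> 1"
  unfolding whitney_def by real_asymp

lemma whitney_interval:
  assumes "0 \<le> r" "r < 1" obtains k where "whitney k \<le> r" "r < whitney (Suc k)"
proof -
  obtain n where n: "r < whitney n"
    using order_tendstoD(1)[OF whitney_tendsto assms(2)] by (auto simp: eventually_sequentially)
  define m where "m = (LEAST n. r < whitney n)"
  have m: "r < whitney m" unfolding m_def by (rule LeastI[of "\<lambda>n. r < whitney n", OF n])
  then obtain k where k: "m = Suc k" using assms by (cases m) auto
  have "\<not> r < whitney k" using not_less_Least[of k "\<lambda>n. r < whitney n"] k by (simp flip: m_def)
  with m k show ?thesis by (intro that[of k]) auto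
qed

text \<open>Decay by \<rho> over m steps is decay by its m-th root per step; the factor 1 / \<rho>
  pays for the incomplete last block of the k - i steps.\<close>

lemma decseq_geometric_decay:
  fixes a :: "nat \<Rightarrow> real"
  assumes a: "\<And>k. 0 \<le> a k" "\<And>k. a (Suc k) \<le> a k" "\<And>k. a (k + m) \<le> \<rho> * a k"
    and "0 < \<rho>" "0 < m" "i \<le> k" "\<rho> < 1"
  shows "a k \<le> 1 / \<rho> * root m \<rho> ^ (k - i) * a i"
proof -
  define q where "q = root m \<rho>"
  have q: "0 < q" "q < 1" "q ^ m = \<rho>"
    using assms by (auto simp: q_def)
  have st: "a (j + n * m) \<le> \<rho> ^ n * a j" for n j
  proof (induction n)
    case (Suc n)
    have "a (j + Suc n * m) = a ((j + n * m) + m)" by (simp add: algebra_simps)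
    also have "\<dots> \<le> \<rho> * a (j + n * m)" by (rule a)
    also have "\<dots> \<le> \<rho> * (\<rho> ^ n * a j)" using Suc assms by (intro mult_left_mono) auto
    finally show ?case by (simp add: mult.assoc)
  qed simp
  have dec: "decseq a" using a by (simp add: decseq_Suc_iff)
  define n where "n = (k - i) div m"
  have nm: "n * m \<le> k - i" "k - i \<le> n * m + m"
    using assms(5) div_mult_mod_eq[of "k - i" m] mod_less_divisor[of m "k - i"]
    unfolding n_def by linarith+
  have "a k \<le> a (i + n * m)" using nm assms(6) by (intro decseqD[OF dec]) auto
  also have "\<dots> \<le> \<rho> ^ n * a i" by (rule st)
  also have "\<dots> \<le> (1 / \<rho> * q ^ (k - i)) * a i"
  proof (rule mult_right_mono[OF _ a(1)])
    have "\<rho> ^ n * \<rho> = q ^ (n * m + m)" using q by (simp add: power_add mult.commute[of n] power_mult)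
    also have "\<dots> \<le> q ^ (k - i)" using q nm by (intro power_decreasing) auto
    finally show "\<rho> ^ n \<le> 1 / \<rho> * q ^ (k - i)" using assms by (simp add: field_simps)
  qed
  finally show ?thesis by (simp add: q_def)
qed

context
  fixes \<nu> :: "complex \<Rightarrow> real"
  assumes rad: "radial_weight \<nu>"
begin

lemma radial_weight_nonneg: "0 \<le> s \<Longrightarrow> s < 1 \<Longrightarrow> 0 \<le> \<nu> (complex_of_real s)"
  using rad unfolding radial_weight_def by (metis abs_of_nonneg mem_ball_0 norm_of_real)

lemma weight_tail_pos: "0 \<le> r \<Longrightarrow> r < 1 \<Longrightarrow> 0 < weight_tail \<nu> r"
  using rad unfolding radial_weight_def by (metis atLeastLessThan_iff)

text \<open>A non-integrable profile would have Bochner integral 0, against the positivity of the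
  tail at 0.\<close>

lemma radial_weight_integrable: "set_integrable lebesgue {0..<1} (\<lambda>s. \<nu> (complex_of_real s))"
proof (rule ccontr)
  assume "\<not> ?thesis"
  then have "weight_tail \<nu> 0 = 0"
    unfolding weight_tail_def set_lebesgue_integral_def set_integrable_def
    by (rule not_integrable_integral_eq)
  then show False using weight_tail_pos[of 0] by simp
qed

lemma radial_weight_integrable_subset:
  "S \<in> sets lebesgue \<Longrightarrow> S \<subseteq> {0..<1} \<Longrightarrow> set_integrable lebesgue S (\<lambda>s. \<nu> (complex_of_real s))"
  by (rule set_integrable_subset[OF radial_weight_integrable])

lemma weight_tail_diff:
  assumes "0 \<le> a" "a \<le> b" "b < 1"
  shows "weight_tail \<nu> a - weight_tail \<nu> b = (LINT s:{a..<b}|lebesgue. \<nu> (complex_of_real s))"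
proof -
  have "{a..<1} = {a..<b} \<union> {b..<1}" using assms by auto
  then show ?thesis
    unfolding weight_tail_def using assms
    by (simp add: set_integral_Un radial_weight_integrable_subset)
qed

lemma weight_tail_antimono:
  assumes "0 \<le> a" "a \<le> b" "b < 1" shows "weight_tail \<nu> b \<le> weight_tail \<nu> a"
proof -
  have "0 \<le> (LINT s:{a..<b}|lebesgue. \<nu> (complex_of_real s))"
    using assms radial_weight_nonneg
    unfolding set_lebesgue_integral_def by (intro Bochner_Integration.integral_nonneg) (auto simp: indicator_def)
  then show ?thesis using weight_tail_diff[OF assms] by simp
qed

lemma set_integral_ge_weight_tail_diff:
  assumes "0 \<le> a" "a \<le> b" "b < 1" and h: "set_integrable lebesgue {a..<b} (\<lambda>s. h s * \<nu> (complex_of_real s))"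
    and "\<And>s. a \<le> s \<Longrightarrow> s < b \<Longrightarrow> c \<le> h s"
  shows "c * (weight_tail \<nu> a - weight_tail \<nu> b) \<le> (LINT s:{a..<b}|lebesgue. h s * \<nu> (complex_of_real s))"
proof -
  have "c * (weight_tail \<nu> a - weight_tail \<nu> b) = (LINT s:{a..<b}|lebesgue. c * \<nu> (complex_of_real s))"
    using weight_tail_diff[OF assms(1-3)] by simp
  also have "\<dots> \<le> (LINT s:{a..<b}|lebesgue. h s * \<nu> (complex_of_real s))"
    using assms by (intro set_integral_mono set_integrable_mult_right radial_weight_integrable_subset
       mult_right_mono radial_weight_nonneg h) auto
  finally show ?thesis .
qed

lemma set_integral_le_weight_tail_diff:
  assumes "0 \<le> a" "a \<le> b" "b < 1" and h: "set_integrable lebesgue {a..<b} (\<lambda>s. h s * \<nu> (complex_of_real s))"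
    and "\<And>s. a \<le> s \<Longrightarrow> s < b \<Longrightarrow> h s \<le> c"
  shows "(LINT s:{a..<b}|lebesgue. h s * \<nu> (complex_of_real s)) \<le> c * (weight_tail \<nu> a - weight_tail \<nu> b)"
  using set_integral_ge_weight_tail_diff[of a b "\<lambda>s. - h s" "- c"] assms
  by (simp add: set_integrable_def set_lebesgue_integral_def)

text \<open>If K < 2^m, moving up m dyadic levels passes the point 1 - (1 - r) / K, so \<rho> = 1 /
  C works.\<close>

lemma weight_Dcheck_step:
  assumes "\<nu> \<in> weight_Dcheck"
  obtains m \<rho> where "0 < m" "0 < \<rho>" "\<rho> < 1"
    "\<And>k. weight_tail \<nu> (whitney (k + m)) \<le> \<rho> * weight_tail \<nu> (whitney k)"
proof -
  obtain K C where K: "K > 1" "C > 1"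
    and le: "\<And>r. 0 \<le> r \<Longrightarrow> r < 1 \<Longrightarrow> C * weight_tail \<nu> (1 - (1 - r) / K) \<le> weight_tail \<nu> r"
    using assms by (auto simp: weight_Dcheck_def)
  obtain m where m: "K < 2 ^ m" using real_arch_pow[of 2 K] by auto
  have "m \<noteq> 0" using m K by (cases m) auto
  show ?thesis
  proof (rule that[of m "1 / C"])
    fix k
    have "(1 / 2) ^ k / K \<ge> (1 / 2) ^ k / (2 ^ m)"
      using m K by (intro divide_left_mono) auto
    then have "1 - (1 - whitney k) / K \<le> whitney (k + m)"
      by (simp add: whitney_def power_add power_divide)
    moreover have "0 \<le> 1 - (1 - whitney k) / K"
    proof -
      have "1 - whitney k \<le> K" using K whitney_ge_0[of k] by linarith
      then show ?thesis using K by (simp add: divide_le_eq)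
    qed
    ultimately have "weight_tail \<nu> (whitney (k + m)) \<le> weight_tail \<nu> (1 - (1 - whitney k) / K)"
      by (intro weight_tail_antimono) auto
    moreover have "C * weight_tail \<nu> (1 - (1 - whitney k) / K) \<le> weight_tail \<nu> (whitney k)"
      by (rule le) auto
    ultimately have "C * weight_tail \<nu> (whitney (k + m)) \<le> weight_tail \<nu> (whitney k)"
      using K by (meson dual_order.trans mult_left_mono order.strict_implies_order zero_less_one less_trans)
    then show "weight_tail \<nu> (whitney (k + m)) \<le> 1 / C * weight_tail \<nu> (whitney k)"
      using K by (simp add: field_simps)
  qed (use K \<open>m \<noteq> 0\<close> in auto)
qed

lemma weight_tail_decay:
  assumes "\<nu> \<in> weight_Dcheck"
  obtains C q where "0 < C" "0 < q" "q < 1"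
    "\<And>i k. i \<le> k \<Longrightarrow> weight_tail \<nu> (whitney k) \<le> C * q ^ (k - i) * weight_tail \<nu> (whitney i)"
proof -
  obtain m \<rho> where m: "0 < m" "0 < \<rho>" "\<rho> < 1"
    "\<And>k. weight_tail \<nu> (whitney (k + m)) \<le> \<rho> * weight_tail \<nu> (whitney k)"
    using weight_Dcheck_step[OF assms] by blast
  have "weight_tail \<nu> (whitney k) \<le> 1 / \<rho> * root m \<rho> ^ (k - i) * weight_tail \<nu> (whitney i)" if "i \<le> k" for i k
    using that m weight_tail_pos
    by (intro decseq_geometric_decay weight_tail_antimono) (auto simp: less_imp_le whitney_mono)
  moreover have "0 < root m \<rho>" "root m \<rho> < 1" using m by auto
  ultimately show ?thesis using m by (intro that[of "1 / \<rho>" "root m \<rho>"]) auto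
qed

text \<open>Let \<open>S k\<close> be the integral of \<open>\<nu> s / (1 - s) powr p\<close> over \<open>s < whitney k\<close>. The condition of
  \<open>weight_Dhat_p\<close> bounds \<open>S k\<close> by \<open>2 ^ (k p)\<close> times the tail, and \<open>weight_Dcheck\<close> bounds that in turn by
  the increments of \<open>S\<close>; so \<open>S\<close> grows geometrically.\<close>

lemma weight_tail_powr_growth:
  assumes "\<nu> \<in> weight_Dcheck" "\<nu> \<in> weight_Dhat_p p" "0 < p"
  obtains C q where "0 < C" "0 < q" "q < 1"
    "\<And>i k. i \<le> k \<Longrightarrow> (2 ^ i) powr p * weight_tail \<nu> (whitney i)
        \<le> C * q ^ (k - i) * ((2 ^ k) powr p * weight_tail \<nu> (whitney k))"
proof -
  obtain m \<rho> where m: "0 < m" "0 < \<rho>" "\<rho> < 1"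
    "\<And>k. weight_tail \<nu> (whitney (k + m)) \<le> \<rho> * weight_tail \<nu> (whitney k)"
    using weight_Dcheck_step[OF assms(1)] by blast
  define v where "v = (\<lambda>k. weight_tail \<nu> (whitney k))"
  define u where "u = (\<lambda>k. (2 ^ k) powr p * v k)"
  have v: "0 < v k" "v (k + m) \<le> \<rho> * v k" "v (k + j) \<le> v k" for k j
    unfolding v_def using m weight_tail_pos by (auto intro!: weight_tail_antimono whitney_mono)
  have u: "0 < u k" for k using v by (simp add: u_def)
  obtain B where B: "\<And>r. 0 \<le> r \<Longrightarrow> r < 1 \<Longrightarrow> (1 - r) powr p / weight_tail \<nu> r *
            (LINT s:{0..r}|lebesgue. \<nu> (complex_of_real s) / (1 - s) powr p) \<le> B"
    using assms(2) unfolding weight_Dhat_p_def bdd_above_def by force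
  define g where "g = (\<lambda>s. 1 / (1 - s) powr p)"
  have gm: "g a \<le> g b" if "a \<le> b" "b < 1" for a b
    unfolding g_def using that assms(3) by (intro divide_left_mono powr_mono2) auto
  have gw: "g (whitney k) = (2 ^ k) powr p" for k
    unfolding g_def one_minus_whitney by (simp add: powr_divide)
  have g0: "0 \<le> g a" for a by (simp add: g_def)
  have gi: "set_integrable lebesgue S (\<lambda>s. g s * \<nu> (complex_of_real s))"
    if "S \<in> sets lebesgue" "S \<subseteq> {0..b}" "b < 1" for S b
  proof (rule set_integrable_bound)
    show "set_integrable lebesgue S (\<lambda>s. g b * \<nu> (complex_of_real s))"
      using that by (intro set_integrable_mult_right radial_weight_integrable_subset) auto
    show "set_borel_measurable lebesgue S (\<lambda>s. g s * \<nu> (complex_of_real s))"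
    proof -
      have "set_borel_measurable lebesgue S (\<lambda>s. \<nu> (complex_of_real s))"
        using radial_weight_integrable_subset[of S] that
        by (force simp: set_integrable_def set_borel_measurable_def)
      moreover have "g \<in> borel_measurable lebesgue" unfolding g_def by (intro measurable_completion) measurable
      ultimately have "(\<lambda>s. g s * (indicator S s *\<^sub>R \<nu> (complex_of_real s))) \<in> borel_measurable lebesgue"
        unfolding set_borel_measurable_def by (rule borel_measurable_times[rotated])
      then show ?thesis by (simp add: set_borel_measurable_def mult.left_commute)
    qed
    show "AE s in lebesgue. s \<in> S \<longrightarrow> norm (g s * \<nu> (complex_of_real s)) \<le> norm (g b * \<nu> (complex_of_real s))"
    proof (intro AE_I2 impI)
      fix s assume "s \<in> S"
      then have "g s \<le> g b" using that by (intro gm) auto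
      then show "norm (g s * \<nu> (complex_of_real s)) \<le> norm (g b * \<nu> (complex_of_real s))"
        using g0 by (simp add: abs_mult mult_right_mono)
    qed
  qed
  define S where "S = (\<lambda>k. LINT s:{0..<whitney k}|lebesgue. g s * \<nu> (complex_of_real s))"
  have S_diff: "(LINT s:{whitney k..<whitney j}|lebesgue. g s * \<nu> (complex_of_real s)) = S j - S k"
    if "k \<le> j" for k j
  proof -
    have int: "set_integrable lebesgue {a..<b} (\<lambda>s. g s * \<nu> (complex_of_real s))"
      if "0 \<le> a" "b \<le> whitney j" for a b
      by (rule gi[of _ "whitney j"]) (use that in auto)
    have ivl: "{0..<whitney j} = {0..<whitney k} \<union> {whitney k..<whitney j}"
      using whitney_mono[OF that] whitney_ge_0[of k] by (auto simp del: whitney_ge_0)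
    have "S j = S k + (LINT s:{whitney k..<whitney j}|lebesgue. g s * \<nu> (complex_of_real s))"
      unfolding S_def ivl
      by (rule set_integral_Un) (use whitney_mono[OF that] in \<open>auto intro!: int\<close>)
    then show ?thesis by simp
  qed
  have S_le: "S k \<le> B * u k" for k
  proof -
    have ivl_subset: "{0..<whitney k} \<subseteq> {0..whitney k}" by auto
    have "S k \<le> (LINT s:{0..whitney k}|lebesgue. g s * \<nu> (complex_of_real s))"
      unfolding S_def set_lebesgue_integral_def
      using gi[of "{0..whitney k}" "whitney k"] gi[OF _ ivl_subset]
      by (intro integral_mono)
        (auto simp: set_integrable_def indicator_def intro!: mult_nonneg_nonneg g0 radial_weight_nonneg
          dest: whitney_range)
    also have "\<dots> \<le> B * u k"
    proof -
      define X where "X = (LINT s:{0..whitney k}|lebesgue. g s * \<nu> (complex_of_real s))"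
      have "(1 - whitney k) powr p / v k * X \<le> B"
        using B[of "whitney k"] by (simp add: X_def g_def v_def)
      moreover have "(1 - whitney k) powr p = 1 / (2 ^ k) powr p"
        unfolding one_minus_whitney by (simp add: powr_divide)
      ultimately have "1 / (2 ^ k) powr p / v k * X \<le> B" by simp
      then have "X / u k \<le> B" by (simp add: u_def mult.commute)
      then have "X \<le> B * u k" using u[of k] by (simp add: pos_divide_le_eq)
      then show ?thesis by (simp add: X_def)
    qed
    finally show ?thesis .
  qed
  have S_step: "(1 - \<rho>) * u k \<le> S (k + m) - S k" for k
  proof -
    have "(1 - \<rho>) * u k = (2 ^ k) powr p * (v k - \<rho> * v k)"
      by (simp add: u_def algebra_simps)
    also have "\<dots> \<le> g (whitney k) * (v k - v (k + m))"
      unfolding gw using v(2) by (intro mult_left_mono) auto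
    also have "\<dots> \<le> (LINT s:{whitney k..<whitney (k + m)}|lebesgue. g s * \<nu> (complex_of_real s))"
      unfolding v_def
      using whitney_mono[of k "k + m"]
      by (intro set_integral_ge_weight_tail_diff gi[of _ "whitney (k + m)"] gm)
        (auto dest: whitney_range)
    also have "\<dots> = S (k + m) - S k" by (rule S_diff) simp
    finally show ?thesis .
  qed
  have S_mono: "S k \<le> S (Suc k)" for k
  proof -
    have "0 \<le> (LINT s:{whitney k..<whitney (Suc k)}|lebesgue. g s * \<nu> (complex_of_real s))"
      unfolding set_lebesgue_integral_def
    proof (rule Bochner_Integration.integral_nonneg)
      fix s
      show "0 \<le> indicator {whitney k..<whitney (Suc k)} s *\<^sub>R (g s * \<nu> (complex_of_real s))"
        using radial_weight_nonneg[of s] whitney_range(1)[of k s] whitney_range(2)[of s "Suc k"] g0[of s]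
        by (auto simp: indicator_def)
    qed
    then show ?thesis using S_diff[of k "Suc k"] by simp
  qed
  have S0: "0 \<le> S k" for k
  proof (induction k)
    case (Suc k)
    then show ?case using S_mono[of k] by linarith
  qed (simp add: S_def set_lebesgue_integral_def)
  \<comment> \<open>S vanishes at 0, but its shift by m is at least (1 - \<rho>) u and hence
    positive; so the geometric growth is proved for T.\<close>
  define T where "T = (\<lambda>k. S (k + m))"
  have T: "(1 - \<rho>) * u k \<le> T k" for k
    using S_step[of k] S0[of k] by (simp add: T_def)
  have Tpos: "0 < T k" for k
    using T[of k] u[of k] m by (meson diff_gt_0_iff_gt mult_pos_pos less_le_trans)
  have Bpos: "0 < B"
  proof -
    have "0 < B * u (0 + m)" using S_le[of "0 + m"] Tpos[of 0] unfolding T_def by linarith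
    then show ?thesis using u[of m] by (auto simp: zero_less_mult_iff)
  qed
  define D where "D = B * (2 ^ m) powr p"
  have D: "0 < D" using Bpos by (simp add: D_def)
  have T_le: "T k \<le> D * u k" for k
  proof -
    have "T k \<le> B * u (k + m)" unfolding T_def by (rule S_le)
    also have "u (k + m) = (2 ^ m) powr p * ((2 ^ k) powr p * v (k + m))"
      by (simp add: u_def power_add powr_mult)
    also have "B * \<dots> \<le> B * ((2 ^ m) powr p * u k)"
      unfolding u_def using v(3)[of k m] Bpos by (intro mult_left_mono) auto
    finally show ?thesis by (simp add: D_def mult_ac)
  qed
  \<comment> \<open>The relative growth of T over m levels: the increment is at least (1 - \<rho>) u
    (k + m), while T k is at most B u (k + m).\<close>
  define \<gamma> where "\<gamma> = (1 - \<rho>) / B"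
  have \<gamma>: "0 < \<gamma>" using m Bpos by (simp add: \<gamma>_def)
  have grow: "(1 + \<gamma>) * T k \<le> T (k + m)" for k
  proof -
    have "\<gamma> * T k \<le> \<gamma> * (B * u (k + m))"
      unfolding T_def using S_le \<gamma> by (intro mult_left_mono) auto
    also have "\<dots> = (1 - \<rho>) * u (k + m)" using Bpos by (simp add: \<gamma>_def)
    also have "\<dots> \<le> T (k + m) - T k" using S_step[of "k + m"] by (simp add: T_def)
    finally show ?thesis by (simp add: algebra_simps)
  qed
  define q where "q = root m (1 / (1 + \<gamma>))"
  have T_decay: "T i \<le> (1 + \<gamma>) * q ^ (k - i) * T k" if "i \<le> k" for i k
  proof -
    \<comment> \<open>Growth of T by 1 + \<gamma> is decay of 1 / T by its reciprocal, so the lemma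
      on geometric decay applies.\<close>
    have "1 / T k \<le> 1 / (1 / (1 + \<gamma>)) * q ^ (k - i) * (1 / T i)"
      unfolding q_def
    proof (rule decseq_geometric_decay)
      show "1 / T (j + m) \<le> 1 / (1 + \<gamma>) * (1 / T j)" for j
      proof -
        have "0 < (1 + \<gamma>) * T j" using Tpos[of j] \<gamma> by simp
        then have "1 / T (j + m) \<le> 1 / ((1 + \<gamma>) * T j)"
          using grow[of j] Tpos[of "j + m"] by (intro divide_left_mono mult_pos_pos[OF _ Tpos]) (use \<gamma> in auto)
        then show ?thesis by simp
      qed
      show "1 / T (Suc j) \<le> 1 / T j" for j
        using S_mono[of "j + m"] Tpos[of j] Tpos[of "Suc j"] by (simp add: T_def frac_le)
    qed (use that m \<gamma> Tpos in \<open>auto simp: less_imp_le\<close>)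
    then show ?thesis using Tpos[of i] Tpos[of k] by (simp add: field_simps)
  qed
  show ?thesis
  proof (rule that[of "(1 + \<gamma>) / (1 - \<rho>) * D" q])
    show "0 < q" "q < 1" using \<gamma> m by (auto simp: q_def)
    show "0 < (1 + \<gamma>) / (1 - \<rho>) * D" using \<gamma> m D by simp
    fix i k :: nat assume ik: "i \<le> k"
    have "(1 - \<rho>) * u i \<le> T i" by (rule T)
    also have "\<dots> \<le> (1 + \<gamma>) * q ^ (k - i) * T k" by (rule T_decay[OF ik])
    also have "\<dots> \<le> (1 + \<gamma>) * q ^ (k - i) * (D * u k)"
      using \<gamma> \<open>0 < q\<close> T_le by (intro mult_left_mono) auto
    finally show "(2 ^ i) powr p * weight_tail \<nu> (whitney i)
        \<le> (1 + \<gamma>) / (1 - \<rho>) * D * q ^ (k - i) * ((2 ^ k) powr p * weight_tail \<nu> (whitney k))"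
      using m by (simp add: u_def v_def field_simps)
  qed
qed

text \<open>From an integral to a dyadic sum. A tail is bounded by its next m increments, because
  after m levels it has dropped by the factor \<rho>. As G increases, each increment times the value
  of G at the left end is below the integral over that interval.\<close>

lemma sum_weight_tail_le:
  fixes G :: "real \<Rightarrow> real"
  assumes "\<nu> \<in> weight_Dcheck"
    and G: "\<And>s. 0 \<le> s \<Longrightarrow> s < 1 \<Longrightarrow> 0 \<le> G s" "\<And>s t. 0 \<le> s \<Longrightarrow> s \<le> t \<Longrightarrow> t < 1 \<Longrightarrow> G s \<le> G t"
    and int: "set_integrable lebesgue {0..<1} (\<lambda>s. G s * \<nu> (complex_of_real s))"
  obtains C where "\<And>n. (\<Sum>k<n. weight_tail \<nu> (whitney k) * G (whitney k)) \<le> C"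
proof -
  obtain m \<rho> where m: "0 < m" "0 < \<rho>" "\<rho> < 1"
    "\<And>k. weight_tail \<nu> (whitney (k + m)) \<le> \<rho> * weight_tail \<nu> (whitney k)"
    using weight_Dcheck_step[OF assms(1)] by blast
  define v where "v = (\<lambda>k. weight_tail \<nu> (whitney k))"
  define d where "d = (\<lambda>k. v k - v (Suc k))"
  define g where "g = (\<lambda>k. G (whitney k))"
  have d0: "0 \<le> d k" for k
    unfolding d_def v_def using weight_tail_antimono[of "whitney k" "whitney (Suc k)"] whitney_mono[of k "Suc k"] by simp
  have g: "0 \<le> g k" "g k \<le> g (k + l)" for k l
    unfolding g_def using G by (auto intro!: G whitney_mono)
  define J where "J = (LINT s:{0..<1}|lebesgue. G s * \<nu> (complex_of_real s))"
  have intS: "set_integrable lebesgue S (\<lambda>s. G s * \<nu> (complex_of_real s))"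
    if "S \<in> sets lebesgue" "S \<subseteq> {0..<1}" for S
    by (rule set_integrable_subset[OF int that])
  have part: "(\<Sum>k<n. g k * d k) \<le> (LINT s:{0..<whitney n}|lebesgue. G s * \<nu> (complex_of_real s))" for n
  proof (induction n)
    case (Suc n)
    have "g n * d n \<le> (LINT s:{whitney n..<whitney (Suc n)}|lebesgue. G s * \<nu> (complex_of_real s))"
      unfolding g_def d_def v_def using whitney_mono[of n "Suc n"] whitney_less_1[of "Suc n"] whitney_ge_0[of n]
      by (intro set_integral_ge_weight_tail_diff intS G) (auto simp del: whitney_less_1 whitney_ge_0)
    moreover have "{0..<whitney (Suc n)} = {0..<whitney n} \<union> {whitney n..<whitney (Suc n)}"
      using whitney_mono[of n "Suc n"] whitney_ge_0[of n] by (auto simp del: whitney_ge_0)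
    then have "(LINT s:{0..<whitney (Suc n)}|lebesgue. G s * \<nu> (complex_of_real s))
        = (LINT s:{0..<whitney n}|lebesgue. G s * \<nu> (complex_of_real s))
          + (LINT s:{whitney n..<whitney (Suc n)}|lebesgue. G s * \<nu> (complex_of_real s))"
      using intS[of "{0..<whitney n}"] intS[of "{whitney n..<whitney (Suc n)}"] whitney_ge_0[of n]
        whitney_less_1[of n] whitney_less_1[of "Suc n"]
      by (simp only:, subst set_integral_Un) (auto simp del: whitney_less_1 whitney_ge_0)
    ultimately show ?case using Suc by simp
  qed (simp add: set_lebesgue_integral_def)
  have partJ: "(\<Sum>k<n. g k * d k) \<le> J" for n
  proof -
    have "(LINT s:{0..<whitney n}|lebesgue. G s * \<nu> (complex_of_real s)) \<le> J"
      unfolding J_def set_lebesgue_integral_def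
      using int intS[of "{0..<whitney n}"] whitney_less_1[of n]
      by (intro integral_mono)
        (auto simp: set_integrable_def indicator_def G radial_weight_nonneg simp del: whitney_less_1)
    then show ?thesis using part[of n] by linarith
  qed
  have v_le: "(1 - \<rho>) * v k \<le> (\<Sum>l<m. d (k + l))" for k
  proof -
    have "(\<Sum>l<j. d (k + l)) = v k - v (k + j)" for j
      by (induction j) (auto simp: d_def)
    from this[of m] show ?thesis using m(4)[of k] by (simp add: v_def algebra_simps)
  qed
  have "(\<Sum>k<n. v k * g k) \<le> real m * J / (1 - \<rho>)" for n
  proof -
    have "(1 - \<rho>) * (\<Sum>k<n. v k * g k) = (\<Sum>k<n. (1 - \<rho>) * v k * g k)"
      by (simp add: sum_distrib_left mult.assoc)
    also have "\<dots> \<le> (\<Sum>k<n. (\<Sum>l<m. d (k + l)) * g k)"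
      by (intro sum_mono mult_right_mono v_le g)
    also have "\<dots> \<le> (\<Sum>k<n. \<Sum>l<m. g (k + l) * d (k + l))"
      unfolding sum_distrib_right
      by (intro sum_mono) (simp add: mult.commute[of "d _"] mult_right_mono d0 g)
    also have "\<dots> = (\<Sum>l<m. \<Sum>k<n. g (k + l) * d (k + l))" by (rule sum.swap)
    also have "\<dots> \<le> (\<Sum>l<m. J)"
    proof (rule sum_mono)
      fix l
      have "(\<Sum>k<n. g (k + l) * d (k + l)) = (\<Sum>k\<in>(\<lambda>k. k + l) ` {..<n}. g k * d k)"
        by (subst sum.reindex) (auto simp: inj_on_def)
      also have "\<dots> \<le> (\<Sum>k<n + l. g k * d k)"
        using g d0 by (intro sum_mono2) auto
      also have "\<dots> \<le> J" by (rule partJ)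
      finally show "(\<Sum>k<n. g (k + l) * d (k + l)) \<le> J" .
    qed
    also have "\<dots> = real m * J" by simp
    finally show ?thesis using m by (simp add: field_simps)
  qed
  then show ?thesis by (intro that) (simp add: v_def g_def)
qed

text \<open>The converse passage, from a dyadic sum to an integral: monotone convergence along the
  intervals from 0 to \<open>whitney n\<close>, each dyadic piece being bounded by
  \<open>c k\<close> times a difference of tails.\<close>

lemma set_integrable_radial_weight_mult:
  fixes h :: "real \<Rightarrow> real"
  assumes h: "continuous_on {0..<1} h" "\<And>s. 0 \<le> s \<Longrightarrow> s < 1 \<Longrightarrow> 0 \<le> h s"
    and le: "\<And>k s. whitney k \<le> s \<Longrightarrow> s < whitney (Suc k) \<Longrightarrow> h s \<le> c k"
    and sum: "\<And>n. (\<Sum>k<n. c k * weight_tail \<nu> (whitney k)) \<le> C"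
  shows "set_integrable lebesgue {0..<1} (\<lambda>s. h s * \<nu> (complex_of_real s))"
proof -
  have c0: "0 \<le> c k" for k
    using le[of k "whitney k"] h(2)[of "whitney k"] whitney_less_Suc[of k]
    by (auto intro: order.trans)
  have meas: "set_borel_measurable lebesgue S (\<lambda>s. h s * \<nu> (complex_of_real s))"
    if "S \<in> sets lebesgue" "S \<subseteq> {0..<1}" for S
  proof -
    have "set_borel_measurable lebesgue S h"
    proof -
      have "h \<in> borel_measurable (lebesgue_on {0..<1})"
        using h(1) by (intro continuous_imp_measurable_on_sets_lebesgue) auto
      then have "h \<in> borel_measurable (lebesgue_on S)"
        by (rule measurable_restrict_mono) (use that in auto)
      then show ?thesis
        using that by (simp add: set_borel_measurable_def borel_measurable_restrict_space_iff)
    qed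
    moreover have "set_borel_measurable lebesgue S (\<lambda>s. \<nu> (complex_of_real s))"
      using radial_weight_integrable_subset[OF that]
      by (simp add: set_integrable_def set_borel_measurable_def borel_measurable_integrable)
    ultimately have "(\<lambda>s. (indicator S s *\<^sub>R h s) * (indicator S s *\<^sub>R \<nu> (complex_of_real s))) \<in> borel_measurable lebesgue"
      unfolding set_borel_measurable_def by (rule borel_measurable_times)
    also have "(\<lambda>s. (indicator S s *\<^sub>R h s) * (indicator S s *\<^sub>R \<nu> (complex_of_real s)))
        = (\<lambda>s. indicator S s *\<^sub>R (h s * \<nu> (complex_of_real s)))"
      by (auto simp: fun_eq_iff indicator_def)
    finally show ?thesis by (simp add: set_borel_measurable_def)
  qed
  have intk: "set_integrable lebesgue {whitney k..<whitney (Suc k)} (\<lambda>s. h s * \<nu> (complex_of_real s))" for k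
  proof (rule set_integrable_bound)
    have sub: "{whitney k..<whitney (Suc k)} \<subseteq> {0..<1}"
      by (rule subsetI) (auto dest: whitney_range)
    show "set_integrable lebesgue {whitney k..<whitney (Suc k)} (\<lambda>s. c k * \<nu> (complex_of_real s))"
      using sub by (intro set_integrable_mult_right radial_weight_integrable_subset) auto
    show "set_borel_measurable lebesgue {whitney k..<whitney (Suc k)} (\<lambda>s. h s * \<nu> (complex_of_real s))"
      using sub by (intro meas) auto
    show "AE s in lebesgue. s \<in> {whitney k..<whitney (Suc k)} \<longrightarrow>
        norm (h s * \<nu> (complex_of_real s)) \<le> norm (c k * \<nu> (complex_of_real s))"
    proof (intro AE_I2 impI)
      fix s assume s: "s \<in> {whitney k..<whitney (Suc k)}"
      then have "0 \<le> s" "s < 1" by (auto dest: whitney_range)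
      then show "norm (h s * \<nu> (complex_of_real s)) \<le> norm (c k * \<nu> (complex_of_real s))"
        using le[of k s] s c0[of k] h(2)[of s] by (auto simp: abs_mult intro!: mult_right_mono)
    qed
  qed
  define S where "S = (\<lambda>n. {0..<whitney n})"
  have dec: "S (Suc n) = S n \<union> {whitney n..<whitney (Suc n)}" for n
    unfolding S_def using whitney_mono[of n "Suc n"] whitney_ge_0[of n] by (auto simp del: whitney_ge_0)
  have intS: "set_integrable lebesgue (S n) (\<lambda>s. h s * \<nu> (complex_of_real s)) \<and>
      (LINT s:S n|lebesgue. h s * \<nu> (complex_of_real s)) \<le> (\<Sum>k<n. c k * weight_tail \<nu> (whitney k))" for n
  proof (induction n)
    case 0
    then show ?case by (simp add: S_def set_integrable_def set_lebesgue_integral_def)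
  next
    case (Suc n)
    have "(LINT s:{whitney n..<whitney (Suc n)}|lebesgue. h s * \<nu> (complex_of_real s))
        \<le> c n * (weight_tail \<nu> (whitney n) - weight_tail \<nu> (whitney (Suc n)))"
      using whitney_mono[of n "Suc n"] by (intro set_integral_le_weight_tail_diff intk le) auto
    also have "\<dots> \<le> c n * weight_tail \<nu> (whitney n)"
      using c0 weight_tail_pos[of "whitney (Suc n)"] by (intro mult_left_mono) auto
    finally have 1: "(LINT s:{whitney n..<whitney (Suc n)}|lebesgue. h s * \<nu> (complex_of_real s))
        \<le> c n * weight_tail \<nu> (whitney n)" .
    have "(LINT s:S (Suc n)|lebesgue. h s * \<nu> (complex_of_real s))
        = (LINT s:S n|lebesgue. h s * \<nu> (complex_of_real s))
          + (LINT s:{whitney n..<whitney (Suc n)}|lebesgue. h s * \<nu> (complex_of_real s))"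
      unfolding dec using Suc intk[of n] by (subst set_integral_Un) (auto simp: S_def)
    moreover have "set_integrable lebesgue (S (Suc n)) (\<lambda>s. h s * \<nu> (complex_of_real s))"
      unfolding dec using Suc intk[of n] by (intro set_integrable_Un) (auto simp: S_def)
    ultimately show ?case using Suc 1 by simp
  qed
  define F where "F = (\<lambda>n s. indicator (S n) s *\<^sub>R (h s * \<nu> (complex_of_real s)))"
  have F0: "0 \<le> F n s" for n s
    using h(2)[of s] radial_weight_nonneg[of s] whitney_less_1[of n]
    by (auto simp: F_def S_def indicator_def simp del: whitney_less_1)
  have Fmono: "F n s \<le> F (Suc n) s" for n s
    using F0[of "Suc n" s] by (auto simp: F_def dec indicator_def)
  have Fint: "integrable lebesgue (F n)" "integral\<^sup>L lebesgue (F n) \<le> C" for n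
    using intS[of n] sum[of n] unfolding F_def set_integrable_def set_lebesgue_integral_def by auto
  have Imono: "incseq (\<lambda>n. integral\<^sup>L lebesgue (F n))"
    by (intro incseq_SucI integral_mono Fint Fmono)
  obtain L where L: "(\<lambda>n. integral\<^sup>L lebesgue (F n)) \<longlonglongrightarrow> L"
    using incseq_convergent[OF Imono, of C] Fint(2) by blast
  have lim: "(\<lambda>n. F n s) \<longlonglongrightarrow> indicator {0..<1} s *\<^sub>R (h s * \<nu> (complex_of_real s))" for s
  proof (cases "0 \<le> s \<and> s < 1")
    case True
    then obtain k where k: "s < whitney k" using whitney_interval by blast
    have "\<forall>\<^sub>F n in sequentially. F n s = indicator {0..<1} s *\<^sub>R (h s * \<nu> (complex_of_real s))"
      using eventually_ge_at_top[of k]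
    proof eventually_elim
      case (elim n)
      then have "s < whitney n" using k whitney_mono[of k n] by linarith
      then show ?case using True by (auto simp: F_def S_def)
    qed
    then show ?thesis by (rule tendsto_eventually)
  next
    case False
    then have "F n s = 0" for n using whitney_less_1[of n] by (auto simp: F_def S_def indicator_def simp del: whitney_less_1)
    then show ?thesis using False by auto
  qed
  have "integrable lebesgue (\<lambda>s. indicator {0..<1} s *\<^sub>R (h s * \<nu> (complex_of_real s)))"
  proof (rule integrable_monotone_convergence[OF Fint(1) _ _ L])
    show "AE s in lebesgue. mono (\<lambda>n. F n s)"
      by (intro AE_I2) (auto simp: mono_iff_le_Suc Fmono)
    show "AE s in lebesgue. (\<lambda>n. F n s) \<longlonglongrightarrow> indicator {0..<1} s *\<^sub>R (h s * \<nu> (complex_of_real s))"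
      by (intro AE_I2 lim)
    show "(\<lambda>s. indicator {0..<1} s *\<^sub>R (h s * \<nu> (complex_of_real s))) \<in> borel_measurable lebesgue"
      using meas[of "{0..<1}"] by (simp add: set_borel_measurable_def)
  qed
  then show ?thesis by (simp add: set_integrable_def)
qed

end

subsection \<open>Oscillation of a holomorphic function\<close>

lemma whitney_abs_less_1: "whitney j \<le> s \<Longrightarrow> s \<le> whitney k \<Longrightarrow> \<bar>s\<bar> < 1"
  using whitney_le_imp_nonneg[of j s] le_whitney_imp_less_1[of s k] by simp

lemma continuous_on_disc_compose:
  assumes "f holomorphic_on ball 0 1" "continuous_on S g" "\<And>x. x \<in> S \<Longrightarrow> cmod (g x) < 1"
  shows "continuous_on S (\<lambda>x. f (g x))"
  by (rule continuous_on_compose2[OF holomorphic_on_imp_continuous_on[OF assms(1)] assms(2)])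
     (use assms(3) in auto)

lemma norm_diff_le_integral_deriv:
  fixes f :: "complex \<Rightarrow> complex"
  assumes f: "f holomorphic_on ball 0 1" and ab: "a \<le> b"
    and \<gamma>: "\<And>t. t \<in> {a..b} \<Longrightarrow> cmod (\<gamma> t) < 1"
      "\<And>t. t \<in> {a..b} \<Longrightarrow> (\<gamma> has_vector_derivative \<gamma>' t) (at t within {a..b})"
      "\<And>t. t \<in> {a..b} \<Longrightarrow> cmod (\<gamma>' t) \<le> 1"
  shows "cmod (f (\<gamma> b) - f (\<gamma> a)) \<le> integral {a..b} (\<lambda>t. cmod (deriv f (\<gamma> t)))"
proof -
  have \<gamma>c: "continuous_on {a..b} \<gamma>"
    unfolding continuous_on_eq_continuous_within
    by (intro ballI has_vector_derivative_continuous[OF \<gamma>(2)])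
  have hi: "((\<lambda>t. \<gamma>' t * deriv f (\<gamma> t)) has_integral f (\<gamma> b) - f (\<gamma> a)) {a..b}"
  proof (rule fundamental_theorem_of_calculus[OF ab])
    fix t assume t: "t \<in> {a..b}"
    have "(f has_field_derivative deriv f (\<gamma> t)) (at (\<gamma> t) within \<gamma> ` {a..b})"
      using \<gamma>(1)[OF t] by (intro holomorphic_derivI[OF f]) auto
    from field_vector_diff_chain_within[OF \<gamma>(2)[OF t] this]
    show "((\<lambda>t. f (\<gamma> t)) has_vector_derivative \<gamma>' t * deriv f (\<gamma> t)) (at t within {a..b})"
      unfolding o_def .
  qed
  have "cmod (f (\<gamma> b) - f (\<gamma> a)) = cmod (integral {a..b} (\<lambda>t. \<gamma>' t * deriv f (\<gamma> t)))"
    by (simp only: integral_unique[OF hi])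
  also have "integral {a..b} (\<lambda>t. cmod (deriv f (\<gamma> t))) \<ge> cmod (integral {a..b} (\<lambda>t. \<gamma>' t * deriv f (\<gamma> t)))"
  proof (rule Henstock_Kurzweil_Integration.integral_norm_bound_integral)
    show "(\<lambda>t. cmod (deriv f (\<gamma> t))) integrable_on {a..b}"
      using \<gamma>(1) by (intro integrable_continuous_interval continuous_intros \<gamma>c
          continuous_on_disc_compose[of "deriv f"] holomorphic_deriv f) auto
    show "cmod (\<gamma>' t * deriv f (\<gamma> t)) \<le> cmod (deriv f (\<gamma> t))" if "t \<in> {a..b}" for t
      using \<gamma>(3)[OF that] by (simp add: norm_mult mult_left_le_one_le)
  qed (rule has_integral_integrable[OF hi])
  finally show ?thesis .
qed

section \<open>Power sums with geometric weights\<close>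

lemma power_powr_swap: "0 < a \<Longrightarrow> (a ^ n) powr b = (a powr b) ^ n" for a b :: real
  by (simp add: powr_powr mult.commute flip: powr_realpow)

text \<open>Jensen with the weights \<eta>^(n i), whose total is at most 1 / (1 - \<eta>) by
  injectivity of n. The exponent map n is left abstract because both n = j - i with i fixed and n =
  k - i with k fixed occur.\<close>

lemma sum_powr_geometric_le:
  fixes x :: "nat \<Rightarrow> real"
  assumes p: "1 \<le> p" and "finite S" and \<eta>: "0 < \<eta>" "\<eta> < 1" and n: "inj_on n S"
    and x: "\<And>i. i \<in> S \<Longrightarrow> 0 \<le> x i"
  shows "(\<Sum>i\<in>S. x i) powr p \<le> (1 / (1 - \<eta>)) powr (p - 1) * (\<Sum>i\<in>S. \<eta> ^ n i * (x i powr p / (\<eta> powr p) ^ n i))"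
proof -
  have "(\<Sum>i\<in>S. x i) powr p = (\<Sum>i\<in>S. \<eta> ^ n i * (x i / \<eta> ^ n i)) powr p"
    using \<eta> by simp
  also have "\<dots> \<le> (\<Sum>i\<in>S. \<eta> ^ n i) powr (p - 1) * (\<Sum>i\<in>S. \<eta> ^ n i * (x i / \<eta> ^ n i) powr p)"
    using assms by (intro sum_powr_le) auto
  also have "\<dots> \<le> (1 / (1 - \<eta>)) powr (p - 1) * (\<Sum>i\<in>S. \<eta> ^ n i * (x i / \<eta> ^ n i) powr p)"
  proof (intro mult_right_mono powr_mono2 sum_nonneg)
    have "(\<Sum>i\<in>S. \<eta> ^ n i) = (\<Sum>j\<in>n ` S. \<eta> ^ j)"
      using n by (simp add: sum.reindex)
    also have "\<dots> \<le> (\<Sum>j. \<eta> ^ j)"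
      using \<eta> \<open>finite S\<close> by (intro sum_le_suminf summable_geometric) auto
    also have "\<dots> = 1 / (1 - \<eta>)" using \<eta> by (simp add: suminf_geometric)
    finally show "(\<Sum>i\<in>S. \<eta> ^ n i) \<le> 1 / (1 - \<eta>)" .
  qed (use \<eta> p in auto)
  also have "(\<Sum>i\<in>S. \<eta> ^ n i * (x i / \<eta> ^ n i) powr p) = (\<Sum>i\<in>S. \<eta> ^ n i * (x i powr p / (\<eta> powr p) ^ n i))"
    using \<eta> x by (intro sum.cong refl) (simp add: powr_divide power_powr_swap)
  finally show ?thesis .
qed

text \<open>Schur's test for a triangular geometric kernel: after the sums are exchanged, each inner
  sum is part of a geometric series. The relation R and the map n leave the direction of the
  triangle open.\<close>

lemma sum_sum_geometric_le:
  fixes y :: "nat \<Rightarrow> real"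
  assumes \<eta>: "0 < \<eta>" "\<eta> < 1" and y: "\<And>i. 0 \<le> y i" and "finite S" "finite T"
    and n: "\<And>i. i \<in> T \<Longrightarrow> inj_on (n i) {k \<in> S. R k i}"
  shows "(\<Sum>k\<in>S. \<Sum>i\<in>{i \<in> T. R k i}. \<eta> ^ n i k * y i) \<le> 1 / (1 - \<eta>) * (\<Sum>i\<in>T. y i)"
proof -
  have "(\<Sum>k\<in>S. \<Sum>i\<in>{i \<in> T. R k i}. \<eta> ^ n i k * y i) = (\<Sum>i\<in>T. (\<Sum>k\<in>{k \<in> S. R k i}. \<eta> ^ n i k * y i))"
    by (rule sum.swap_restrict) (use assms in auto)
  also have "\<dots> \<le> (\<Sum>i\<in>T. 1 / (1 - \<eta>) * y i)"
  proof (rule sum_mono)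
    fix i assume i: "i \<in> T"
    have "(\<Sum>k\<in>{k \<in> S. R k i}. \<eta> ^ n i k) = (\<Sum>j\<in>n i ` {k \<in> S. R k i}. \<eta> ^ j)"
      using n[OF i] by (simp add: sum.reindex)
    also have "\<dots> \<le> (\<Sum>j. \<eta> ^ j)"
      using \<eta> \<open>finite S\<close> by (intro sum_le_suminf summable_geometric) auto
    also have "\<dots> = 1 / (1 - \<eta>)" using \<eta> by (simp add: suminf_geometric)
    finally show "(\<Sum>k\<in>{k \<in> S. R k i}. \<eta> ^ n i k * y i) \<le> 1 / (1 - \<eta>) * y i"
      unfolding sum_distrib_right[symmetric] by (intro mult_right_mono y) auto
  qed
  finally show ?thesis by (simp add: sum_distrib_left)
qed

text \<open>2 * pi times the p-th power of the integral mean. The codomain is a type variable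
  because the same notion is applied to the real-valued oscillations.\<close>

definition circle_integral :: "real \<Rightarrow> (complex \<Rightarrow> 'a::real_normed_vector) \<Rightarrow> real \<Rightarrow> real" where
  "circle_integral p g r = integral {0..2 * pi} (\<lambda>\<theta>. norm (g (polar r \<theta>)) powr p)"

definition radial_var :: "(complex \<Rightarrow> complex) \<Rightarrow> nat \<Rightarrow> real \<Rightarrow> real" where
  "radial_var f j \<theta> = integral {whitney j..whitney (Suc j)} (\<lambda>s. cmod (deriv f (polar s \<theta>)))"

text \<open>Boundary values are replaced by values on the circle of radius \<open>whitney m\<close>,
  while the centre remains \<open>f z\<close>. The integrand is thus continuous, and m tending to
  infinity produces \<open>boundary_osc\<close>.\<close>

definition oscillation :: "(complex \<Rightarrow> complex) \<Rightarrow> nat \<Rightarrow> complex \<Rightarrow> real" where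
  "oscillation f m z = 1 / (2 * pi) *
     integral {0..2 * pi} (\<lambda>t. poisson z (cis t) * cmod (f (polar (whitney m) t) - f z))"

lemma circle_integral_nonneg: "0 \<le> circle_integral p g r"
  unfolding circle_integral_def
  by (cases "(\<lambda>\<theta>. norm (g (polar r \<theta>)) powr p) integrable_on {0..2 * pi}")
     (auto simp: not_integrable_integral intro: integral_nonneg)

context
  fixes f :: "complex \<Rightarrow> complex"
  assumes f: "f holomorphic_on ball 0 1"
begin

lemma holomorphic_deriv_disc: "deriv f holomorphic_on ball 0 1"
  by (rule holomorphic_deriv[OF f]) simp

lemma radial_var_continuous: "continuous_on S (radial_var f j)"
  unfolding radial_var_def
  by (intro continuous_on_integral_Icc continuous_intros continuous_on_disc_compose[OF holomorphic_deriv_disc])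
     (auto simp: norm_mult intro!: whitney_abs_less_1[of j _ "Suc j"])

lemma radial_var_nonneg: "0 \<le> radial_var f j \<theta>"
  unfolding radial_var_def
  by (intro integral_nonneg integrable_continuous_interval continuous_intros
       continuous_on_disc_compose[OF holomorphic_deriv_disc]) (auto simp: norm_mult intro!: whitney_abs_less_1[of j _ "Suc j"])

lemma radial_var_periodic: "radial_var f j (\<theta> + 2 * pi) = radial_var f j \<theta>"
  by (simp add: radial_var_def flip: cis_mult)

lemma norm_diff_le_sum_radial_var:
  assumes "i \<le> m"
  shows "cmod (f (polar (whitney m) \<theta>) - f (polar (whitney i) \<theta>))
    \<le> (\<Sum>j\<in>{i..<m}. radial_var f j \<theta>)"
  using assms
proof (induction m rule: dec_induct)
  case (step m)
  have "cmod (f (polar (whitney (Suc m)) \<theta>) - f (polar (whitney m) \<theta>))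
      \<le> radial_var f m \<theta>"
    unfolding radial_var_def
    by (rule norm_diff_le_integral_deriv[where \<gamma>' = "\<lambda>_. cis \<theta>"])
       (auto intro!: f whitney_mono whitney_abs_less_1[of m _ "Suc m"] derivative_eq_intros
          simp: norm_mult has_vector_derivative_def scaleR_conv_of_real)
  moreover have "cmod (f (polar (whitney (Suc m)) \<theta>) - f (polar (whitney i) \<theta>))
      \<le> cmod (f (polar (whitney (Suc m)) \<theta>) - f (polar (whitney m) \<theta>))
        + cmod (f (polar (whitney m) \<theta>) - f (polar (whitney i) \<theta>))"
    using norm_triangle_ineq[of "f (polar (whitney (Suc m)) \<theta>) - f (polar (whitney m) \<theta>)"
        "f (polar (whitney m) \<theta>) - f (polar (whitney i) \<theta>)"] by simp
  ultimately show ?case using step by simp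
qed simp

lemma norm_diff_le_arc:
  assumes r: "0 \<le> r" "r < 1" and t: "\<bar>t\<bar> \<le> a"
  shows "cmod (f (polar r (\<theta> + t)) - f (polar r \<theta>))
    \<le> integral {- a..a} (\<lambda>u. cmod (deriv f (polar r (\<theta> + u))))"
proof -
  have *: "cmod (f (polar r y) - f (polar r x))
      \<le> integral {x..y} (\<lambda>u. cmod (deriv f (polar r u)))" if "x \<le> y" for x y
  proof (rule norm_diff_le_integral_deriv[OF f that])
    show "((\<lambda>t. polar r t) has_vector_derivative complex_of_real r * (\<i> * cis t)) (at t within {x..y})" for t
      by (auto intro!: derivative_eq_intros has_vector_derivative_mult_right simp: has_vector_derivative_def)
  qed (use r in \<open>auto simp: norm_mult\<close>)
  have int: "(\<lambda>u. cmod (deriv f (polar r u))) integrable_on {x..y}" for x y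
    using r by (intro integrable_continuous_interval continuous_intros
          continuous_on_disc_compose[OF holomorphic_deriv_disc]) (auto simp: norm_mult)
  have "cmod (f (polar r (\<theta> + t)) - f (polar r \<theta>))
      \<le> integral {min \<theta> (\<theta> + t)..max \<theta> (\<theta> + t)} (\<lambda>u. cmod (deriv f (polar r u)))"
    using *[of \<theta> "\<theta> + t"] *[of "\<theta> + t" \<theta>]
    by (cases "t \<ge> 0") (auto simp: norm_minus_commute min_def max_def)
  also have "\<dots> \<le> integral {- a + \<theta>..a + \<theta>} (\<lambda>u. cmod (deriv f (polar r u)))"
    using t by (intro integral_subset_le int) auto
  also have "\<dots> = integral {- a..a} (\<lambda>u. cmod (deriv f (polar r (\<theta> + u))))"
    using integral_shift_Icc_real[of "- a" a "\<lambda>u. cmod (deriv f (polar r u))" \<theta>]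
    by (simp add: o_def)
  finally show ?thesis .
qed

lemma circle_integral_deriv_mono:
  assumes p: "1 \<le> p"
  shows "0 \<le> r \<Longrightarrow> r \<le> s \<Longrightarrow> s < 1 \<Longrightarrow> circle_integral p (deriv f) r \<le> circle_integral p (deriv f) s"
  unfolding circle_integral_def by (rule integral_powr_circle_mono[OF p holomorphic_deriv_disc])

text \<open>Jensen on a radial segment of length 2^-(j+1), then Fubini to reach circle integrals of
  the derivative, which increase up to the outer radius.\<close>

lemma integral_radial_var_powr_le:
  assumes p: "1 \<le> p"
  shows "integral {0..2 * pi} (\<lambda>\<theta>. radial_var f j \<theta> powr p)
    \<le> (1 / 2 ^ Suc j) powr p * circle_integral p (deriv f) (whitney (Suc j))"
proof -
  define g where "g = (\<lambda>\<theta> s. cmod (deriv f (polar s \<theta>)))"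
  define L where "L = whitney (Suc j) - whitney j"
  have L: "L = 1 / 2 ^ Suc j" "L > 0" by (simp_all add: L_def whitney_diff)
  have gc: "continuous_on S (\<lambda>x. g (a x) (b x))"
    if "continuous_on S a" "continuous_on S b" "\<And>x. x \<in> S \<Longrightarrow> whitney j \<le> b x \<and> b x \<le> whitney (Suc j)" for S a b
    unfolding g_def using that
    by (intro continuous_intros continuous_on_disc_compose[OF holomorphic_deriv_disc])
       (auto simp: norm_mult intro!: whitney_abs_less_1[of j _ "Suc j"])
  have gpc: "continuous_on S (\<lambda>x. g (a x) (b x) powr p)"
    if "continuous_on S a" "continuous_on S b" "\<And>x. x \<in> S \<Longrightarrow> whitney j \<le> b x \<and> b x \<le> whitney (Suc j)" for S a b
    using p that by (intro continuous_on_powr' gc continuous_intros) (auto simp: g_def)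
  have "integral {0..2 * pi} (\<lambda>\<theta>. radial_var f j \<theta> powr p)
      \<le> integral {0..2 * pi} (\<lambda>\<theta>. L powr (p - 1) * integral {whitney j..whitney (Suc j)} (\<lambda>s. g \<theta> s powr p))"
  proof (rule integral_le)
    show "(\<lambda>\<theta>. radial_var f j \<theta> powr p) integrable_on {0..2 * pi}"
      using p by (intro integrable_continuous_interval continuous_on_powr' radial_var_continuous continuous_intros)
        (auto simp: radial_var_nonneg)
    show "(\<lambda>\<theta>. L powr (p - 1) * integral {whitney j..whitney (Suc j)} (\<lambda>s. g \<theta> s powr p)) integrable_on {0..2 * pi}"
      by (intro integrable_continuous_interval continuous_intros continuous_on_integral_Icc gpc) auto
    show "radial_var f j \<theta> powr p \<le> L powr (p - 1) * integral {whitney j..whitney (Suc j)} (\<lambda>s. g \<theta> s powr p)" for \<theta>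
    proof -
      have "continuous_on {whitney j..whitney (Suc j)} (g \<theta>)"
        by (intro gc[of _ "\<lambda>_. \<theta>" "\<lambda>s. s"] continuous_intros) auto
      moreover have "radial_var f j \<theta> = integral {whitney j..whitney (Suc j)} (g \<theta>)"
        by (simp add: radial_var_def g_def)
      moreover have "integral {whitney j..whitney (Suc j)} (\<lambda>_. 1) = L"
        using whitney_mono[of j "Suc j"] by (simp add: L_def)
      moreover have "0 \<le> g \<theta> s" for s by (simp add: g_def)
      ultimately show ?thesis
        using integral_powr_le[OF p, of "whitney j" "whitney (Suc j)" "\<lambda>_. 1" "g \<theta>"] by simp
    qed
  qed
  also have "\<dots> = L powr (p - 1) * integral {whitney j..whitney (Suc j)} (\<lambda>s. integral {0..2 * pi} (\<lambda>\<theta>. g \<theta> s powr p))"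
  proof -
    have "integral {0..2 * pi} (\<lambda>\<theta>. integral {whitney j..whitney (Suc j)} (\<lambda>s. g \<theta> s powr p))
        = integral {whitney j..whitney (Suc j)} (\<lambda>s. integral {0..2 * pi} (\<lambda>\<theta>. g \<theta> s powr p))"
      using integral_swap_continuous[of 0 "whitney j" "2 * pi" "whitney (Suc j)" "\<lambda>\<theta> s. g \<theta> s powr p"]
      unfolding case_prod_unfold cbox_Pair_eq box_real
      by (rule meta_mp) (intro gpc continuous_intros, auto)
    then show ?thesis by simp
  qed
  also have "\<dots> \<le> L powr (p - 1) * integral {whitney j..whitney (Suc j)} (\<lambda>s. circle_integral p (deriv f) (whitney (Suc j)))"
  proof (intro mult_left_mono integral_le)
    show "(\<lambda>s. integral {0..2 * pi} (\<lambda>\<theta>. g \<theta> s powr p)) integrable_on {whitney j..whitney (Suc j)}"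
      by (intro integrable_continuous_interval continuous_on_integral_Icc gpc continuous_intros) auto
    show "integral {0..2 * pi} (\<lambda>\<theta>. g \<theta> s powr p) \<le> circle_integral p (deriv f) (whitney (Suc j))"
      if "s \<in> {whitney j..whitney (Suc j)}" for s
      using circle_integral_deriv_mono[OF p, of s "whitney (Suc j)"] that whitney_range(1)[of j s]
      by (simp add: circle_integral_def g_def)
  qed auto
  also have "\<dots> = L powr (p - 1) * L * circle_integral p (deriv f) (whitney (Suc j))"
    using whitney_mono[of j "Suc j"] by (simp add: L_def)
  also have "L powr (p - 1) * L = L powr p"
    using L powr_mult_base[of L "p - 1"] by (simp add: mult.commute)
  finally show ?thesis by (simp add: L)
qed

end

text \<open>Majorant of 2^i times the integral over |t| <= pi / 2^i of the distance between the
  value of f at level m, angle \<theta> + t, and its value at level k, angle \<theta>. The points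
  are joined by descending radially at \<theta> + t to level i, following the circle, and climbing
  at \<theta>. The terms are the descent, the climb and the arc; the climb is extended to level m,
  so k does not occur. The factor 2 * pi is 2^i times the length of the arc of integration.\<close>

definition osc_bound :: "(complex \<Rightarrow> complex) \<Rightarrow> nat \<Rightarrow> nat \<Rightarrow> real \<Rightarrow> real" where
  "osc_bound f m i \<theta> =
     2 ^ i * integral {- (pi / 2 ^ i)..pi / 2 ^ i} (\<lambda>t. \<Sum>j\<in>{i..<m}. radial_var f j (\<theta> + t))
     + 2 * pi * (\<Sum>j\<in>{i..<m}. radial_var f j \<theta>)
     + 2 * pi * integral {- (pi / 2 ^ i)..pi / 2 ^ i} (\<lambda>u. cmod (deriv f (polar (whitney i) (\<theta> + u))))"

lemma integral_powr_arc_le: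
  assumes p: "1 \<le> p" and h: "continuous_on UNIV h" "\<And>t. 0 \<le> h t" "\<And>t. h (t + 2 * pi) = h t" and "0 \<le> a"
  shows "integral {0..2 * pi} (\<lambda>\<theta>. (integral {- a..a} (\<lambda>t. h (\<theta> + t))) powr p)
    \<le> (2 * a) powr p * integral {0..2 * pi} (\<lambda>\<theta>. h \<theta> powr p)"
  using integral_powr_convolution_le[OF p, of "- a" a "\<lambda>_. 1", OF _ _ h] \<open>0 \<le> a\<close> by simp

lemma continuous_on_circle:
  assumes "g holomorphic_on ball 0 1" "0 \<le> r" "r < 1" "continuous_on S h"
  shows "continuous_on S (\<lambda>x. g (polar r (h x)))"
  using assms by (intro continuous_on_disc_compose[OF assms(1)] continuous_intros) (auto simp: norm_mult)

context
  fixes f :: "complex \<Rightarrow> complex"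
  assumes f: "f holomorphic_on ball 0 1"
begin

lemma radial_var_continuous': "continuous_on S g \<Longrightarrow> continuous_on S (\<lambda>x. radial_var f j (g x))"
  by (rule continuous_on_compose2[OF radial_var_continuous[OF f]]) auto

lemmas circle_continuous_intros = radial_var_continuous' continuous_on_circle[OF f]
  continuous_on_circle[OF holomorphic_deriv_disc[OF f]]

lemma osc_bound_continuous: "continuous_on S (osc_bound f m i)"
  unfolding osc_bound_def
  by (intro continuous_intros continuous_on_integral_Icc circle_continuous_intros) auto

lemma osc_bound_nonneg: "0 \<le> osc_bound f m i \<theta>"
  unfolding osc_bound_def
  by (intro add_nonneg_nonneg mult_nonneg_nonneg integral_nonneg integrable_continuous_interval
      continuous_intros circle_continuous_intros sum_nonneg radial_var_nonneg[OF f]) auto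

lemma integral_arc_le_osc_bound:
  assumes ik: "i \<le> k" "k \<le> m"
  shows "2 ^ i * integral {- (pi / 2 ^ i)..pi / 2 ^ i}
      (\<lambda>t. cmod (f (polar (whitney m) (\<theta> + t)) - f (polar (whitney k) \<theta>)))
    \<le> osc_bound f m i \<theta>"
proof -
  define a where "a = pi / 2 ^ i"
  have a: "0 \<le> a" "2 ^ i * (2 * a) = 2 * pi" by (simp_all add: a_def)
  define R where "R = (\<lambda>\<theta>. \<Sum>j\<in>{i..<m}. radial_var f j \<theta>)"
  define A where "A = integral {- a..a} (\<lambda>u. cmod (deriv f (polar (whitney i) (\<theta> + u))))"
  have Ri: "(\<lambda>t. R (\<theta> + t)) integrable_on {- a..a}"
    unfolding R_def by (intro integrable_continuous_interval continuous_intros circle_continuous_intros)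
  have "integral {- a..a} (\<lambda>t. cmod (f (polar (whitney m) (\<theta> + t)) - f (polar (whitney k) \<theta>)))
      \<le> integral {- a..a} (\<lambda>t. R (\<theta> + t) + (R \<theta> + A))"
  proof (rule integral_le)
    show "(\<lambda>t. cmod (f (polar (whitney m) (\<theta> + t)) - f (polar (whitney k) \<theta>))) integrable_on {- a..a}"
      by (intro integrable_continuous_interval continuous_intros circle_continuous_intros) auto
    show "(\<lambda>t. R (\<theta> + t) + (R \<theta> + A)) integrable_on {- a..a}"
      by (intro integrable_add Ri) auto
    fix t assume "t \<in> {- a..a}"
    then have t: "\<bar>t\<bar> \<le> a" by auto
    let ?m = "f (polar (whitney m) (\<theta> + t))" and ?i = "f (polar (whitney i) (\<theta> + t))"
      and ?j = "f (polar (whitney i) \<theta>)" and ?k = "f (polar (whitney k) \<theta>)"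
    have "cmod (?m - ?k) \<le> cmod (?m - ?i) + cmod (?i - ?j) + cmod (?k - ?j)"
      using norm_triangle_ineq[of "?m - ?i" "?i - ?j"] norm_triangle_ineq4[of "?m - ?j" "?k - ?j"] by simp
    moreover have "cmod (?m - ?i) \<le> R (\<theta> + t)"
      unfolding R_def by (rule norm_diff_le_sum_radial_var[OF f]) (use ik in auto)
    moreover have "cmod (?i - ?j) \<le> A"
      unfolding A_def by (rule norm_diff_le_arc[OF f _ _ t]) auto
    moreover have "cmod (?k - ?j) \<le> R \<theta>"
    proof -
      have "cmod (?k - ?j) \<le> (\<Sum>j\<in>{i..<k}. radial_var f j \<theta>)"
        by (rule norm_diff_le_sum_radial_var[OF f ik(1)])
      also have "\<dots> \<le> R \<theta>"
        unfolding R_def using ik by (intro sum_mono2 radial_var_nonneg[OF f]) auto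
      finally show ?thesis .
    qed
    ultimately show "cmod (?m - ?k) \<le> R (\<theta> + t) + (R \<theta> + A)" by linarith
  qed
  also have "\<dots> = integral {- a..a} (\<lambda>t. R (\<theta> + t)) + 2 * a * (R \<theta> + A)"
    using a by (subst Henstock_Kurzweil_Integration.integral_add[OF Ri]) auto
  finally have "2 ^ i * integral {- a..a} (\<lambda>t. cmod (f (polar (whitney m) (\<theta> + t)) - f (polar (whitney k) \<theta>)))
      \<le> 2 ^ i * (integral {- a..a} (\<lambda>t. R (\<theta> + t)) + 2 * a * (R \<theta> + A))"
    by (rule mult_left_mono) simp
  also have "\<dots> = 2 ^ i * integral {- a..a} (\<lambda>t. R (\<theta> + t)) + (2 ^ i * (2 * a)) * (R \<theta> + A)"
    by (simp only: distrib_left mult.assoc)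
  also have "\<dots> = osc_bound f m i \<theta>"
    unfolding osc_bound_def a(2) by (simp add: R_def A_def a_def distrib_left)
  finally show ?thesis by (simp add: a_def)
qed

text \<open>The dyadic majorant puts the weight 4^i / 2^k on the arc of level i. One factor 2^i
  normalises the arc integral as in \<open>osc_bound\<close>; the remaining 2^i / 2^k is the
  geometric factor.\<close>

lemma oscillation_le_sum_osc_bound:
  assumes km: "k \<le> m"
  shows "oscillation f m (polar (whitney k) \<theta>) \<le> (\<Sum>i\<le>k. osc_bound f m i \<theta> / 2 ^ (k - i))"
proof -
  define z where "z = polar (whitney k) \<theta>"
  have z: "cmod z < 1" by (simp add: z_def norm_mult)
  have zne: "z \<noteq> cis t" for t using z by auto
  define h where "h = (\<lambda>t. cmod (f (polar (whitney m) t) - f z))"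
  have hc: "continuous_on S (\<lambda>x. h (g x))" if "continuous_on S g" for S :: "real set" and g
    unfolding h_def by (intro continuous_intros circle_continuous_intros that) auto
  have h0: "0 \<le> h t" for t by (simp add: h_def)
  define I where "I = (\<lambda>i. integral {- (pi / 2 ^ i)..pi / 2 ^ i} (\<lambda>t. h (\<theta> + t)))"
  have sub: "{- (pi / 2 ^ i)..pi / 2 ^ i} \<subseteq> {- pi..pi}" for i :: nat
    by (auto simp: field_simps intro: order.trans[of _ "pi * 1"] mult_left_mono)
  have hI: "((\<lambda>t. if t \<in> {- (pi / 2 ^ i)..pi / 2 ^ i} then h (\<theta> + t) else 0) has_integral I i) {- pi..pi}" for i
    unfolding has_integral_restrict[OF sub] I_def
    by (intro integrable_integral integrable_continuous_interval hc continuous_intros)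
  have "2 * pi * oscillation f m z = integral {0..2 * pi} (\<lambda>t. poisson z (cis t) * h t)"
    by (simp add: oscillation_def h_def)
  also have "\<dots> = integral {- pi..- pi + 2 * pi} (\<lambda>t. poisson z (cis (t + \<theta>)) * h (t + \<theta>))"
    by (rule integral_periodic_shift[symmetric])
       (intro continuous_intros zne hc, simp add: h_def flip: cis_mult)
  also have "\<dots> = integral {- pi..pi} (\<lambda>t. poisson z (cis (\<theta> + t)) * h (\<theta> + t))"
    by (simp add: add.commute)
  also have "\<dots> \<le> 4 * (\<Sum>i\<le>k. 2 ^ (2 * i) / 2 ^ k * I i)"
  proof (rule has_integral_le)
    show "((\<lambda>t. poisson z (cis (\<theta> + t)) * h (\<theta> + t)) has_integral
        integral {- pi..pi} (\<lambda>t. poisson z (cis (\<theta> + t)) * h (\<theta> + t))) {- pi..pi}"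
      by (intro integrable_integral integrable_continuous_interval continuous_intros zne hc)
    show "((\<lambda>t. 4 * (\<Sum>i\<le>k. 2 ^ (2 * i) / 2 ^ k * (if t \<in> {- (pi / 2 ^ i)..pi / 2 ^ i} then h (\<theta> + t) else 0)))
        has_integral 4 * (\<Sum>i\<le>k. 2 ^ (2 * i) / 2 ^ k * I i)) {- pi..pi}"
      by (intro has_integral_mult_right has_integral_sum hI) auto
    fix t assume t: "t \<in> {- pi..pi}"
    have "poisson z (cis (\<theta> + t)) * h (\<theta> + t)
        \<le> 4 * (\<Sum>i\<le>k. 2 ^ (2 * i) / 2 ^ k * (if \<bar>t\<bar> \<le> pi / 2 ^ i then 1 else 0)) * h (\<theta> + t)"
      using t by (intro mult_right_mono poisson_dyadic_le h0) (auto simp: z_def whitney_def)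
    also have "\<dots> = 4 * (\<Sum>i\<le>k. 2 ^ (2 * i) / 2 ^ k * (if t \<in> {- (pi / 2 ^ i)..pi / 2 ^ i} then h (\<theta> + t) else 0))"
      unfolding mult.assoc sum_distrib_right
      by (intro arg_cong[of _ _ "\<lambda>x. 4 * x"] sum.cong refl) (auto simp: abs_le_iff)
    finally show "poisson z (cis (\<theta> + t)) * h (\<theta> + t)
        \<le> 4 * (\<Sum>i\<le>k. 2 ^ (2 * i) / 2 ^ k * (if t \<in> {- (pi / 2 ^ i)..pi / 2 ^ i} then h (\<theta> + t) else 0))" .
  qed
  also have "\<dots> = 4 * (\<Sum>i\<le>k. (2 ^ i * I i) / 2 ^ (k - i))"
  proof -
    have "(2::real) ^ (2 * i) / 2 ^ k * I i = (2 ^ i * I i) / 2 ^ (k - i)" if "i \<le> k" for i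
    proof -
      have "(2::real) ^ k = 2 ^ i * 2 ^ (k - i)" using that by (simp flip: power_add)
      then show ?thesis by (simp add: mult_2 power_add)
    qed
    then show ?thesis by simp
  qed
  also have "\<dots> \<le> 4 * (\<Sum>i\<le>k. osc_bound f m i \<theta> / 2 ^ (k - i))"
    unfolding I_def h_def z_def using km
    by (intro mult_left_mono sum_mono divide_right_mono integral_arc_le_osc_bound) auto
  \<comment> \<open>The factor 4 of the dyadic majorant is absorbed by the normalisation, since pi
    >= 2.\<close>
  also have "\<dots> \<le> 2 * pi * (\<Sum>i\<le>k. osc_bound f m i \<theta> / 2 ^ (k - i))"
    using pi_ge_two by (intro mult_right_mono sum_nonneg) (auto simp: osc_bound_nonneg)
  finally show ?thesis by (simp add: z_def)
qed

text \<open>The convolution inequality for each leg of the path. In the descent the arc length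
  cancels the factor 2^i; in the arc leg, which has no such factor, it survives as (2 * pi / 2^i)^p.
  Splitting a sum twice costs at most 4^p, and 4^p (2 * pi)^p = (8 * pi)^p.\<close>

lemma integral_osc_bound_powr_le:
  assumes p: "1 \<le> p"
  shows "integral {0..2 * pi} (\<lambda>\<theta>. osc_bound f m i \<theta> powr p)
    \<le> (8 * pi) powr p * (2 * integral {0..2 * pi} (\<lambda>\<theta>. (\<Sum>j\<in>{i..<m}. radial_var f j \<theta>) powr p)
        + (2 * pi / 2 ^ i) powr p * circle_integral p (deriv f) (whitney i))"
proof -
  define a where "a = pi / 2 ^ i"
  have a: "0 \<le> a" "2 ^ i * (2 * a) = 2 * pi" by (simp_all add: a_def)
  define R where "R = (\<lambda>\<theta>. \<Sum>j\<in>{i..<m}. radial_var f j \<theta>)"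
  define F where "F = (\<lambda>\<theta>. cmod (deriv f (polar (whitney i) \<theta>)))"
  define X where "X = (\<lambda>\<theta>. 2 ^ i * integral {- a..a} (\<lambda>t. R (\<theta> + t)))"
  define Y where "Y = (\<lambda>\<theta>. 2 * pi * R \<theta>)"
  define Z where "Z = (\<lambda>\<theta>. 2 * pi * integral {- a..a} (\<lambda>t. F (\<theta> + t)))"
  have Rc: "continuous_on S (\<lambda>x. R (g x))" if "continuous_on S g" for S :: "'b::topological_space set" and g
    unfolding R_def by (intro continuous_on_sum radial_var_continuous' that)
  have Fc: "continuous_on S (\<lambda>x. F (g x))" if "continuous_on S g" for S :: "'b::topological_space set" and g
    unfolding F_def by (intro continuous_intros circle_continuous_intros that) auto
  have R0: "0 \<le> R \<theta>" for \<theta> unfolding R_def by (intro sum_nonneg radial_var_nonneg[OF f])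
  have F0: "0 \<le> F \<theta>" for \<theta> by (simp add: F_def)
  have c: "continuous_on {0..2 * pi} X" "continuous_on {0..2 * pi} Y" "continuous_on {0..2 * pi} Z"
    unfolding X_def Y_def Z_def by (intro continuous_intros continuous_on_integral_Icc Rc Fc)+
  have nn: "0 \<le> X \<theta>" "0 \<le> Y \<theta>" "0 \<le> Z \<theta>" for \<theta>
    unfolding X_def Y_def Z_def using R0 F0
    by (intro mult_nonneg_nonneg integral_nonneg integrable_continuous_interval Rc Fc continuous_intros; simp)+
  have cp: "continuous_on {0..2 * pi} (\<lambda>\<theta>. X \<theta> powr p)" "continuous_on {0..2 * pi} (\<lambda>\<theta>. Y \<theta> powr p)"
    "continuous_on {0..2 * pi} (\<lambda>\<theta>. Z \<theta> powr p)"
    using nn p by (intro continuous_on_powr'[OF _ continuous_on_const] c; auto)+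
  have ip: "(\<lambda>\<theta>. X \<theta> powr p) integrable_on {0..2 * pi}" "(\<lambda>\<theta>. Y \<theta> powr p) integrable_on {0..2 * pi}"
    "(\<lambda>\<theta>. Z \<theta> powr p) integrable_on {0..2 * pi}"
    using cp by (auto intro: integrable_continuous_interval)
  have "integral {0..2 * pi} (\<lambda>\<theta>. osc_bound f m i \<theta> powr p)
      \<le> integral {0..2 * pi} (\<lambda>\<theta>. 4 powr p * (X \<theta> powr p + Y \<theta> powr p + Z \<theta> powr p))"
  proof (rule integral_le)
    show "(\<lambda>\<theta>. osc_bound f m i \<theta> powr p) integrable_on {0..2 * pi}"
      using p osc_bound_nonneg by (intro integrable_continuous_interval continuous_on_powr' osc_bound_continuous continuous_intros) auto
    show "(\<lambda>\<theta>. 4 powr p * (X \<theta> powr p + Y \<theta> powr p + Z \<theta> powr p)) integrable_on {0..2 * pi}"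
      by (intro integrable_continuous_interval continuous_intros cp)
    fix \<theta>
    have "osc_bound f m i \<theta> = X \<theta> + Y \<theta> + Z \<theta>"
      by (simp add: osc_bound_def X_def Y_def Z_def R_def F_def a_def)
    also have "(X \<theta> + Y \<theta> + Z \<theta>) powr p \<le> 2 powr (p - 1) * ((X \<theta> + Y \<theta>) powr p + Z \<theta> powr p)"
      using nn[of \<theta>] by (intro add_powr_le p) auto
    also have "\<dots> \<le> 2 powr (p - 1) * (2 powr (p - 1) * (X \<theta> powr p + Y \<theta> powr p) + Z \<theta> powr p)"
      using nn[of \<theta>] by (intro mult_left_mono add_right_mono add_powr_le p) auto
    also have "\<dots> \<le> 2 powr p * (2 powr p * (X \<theta> powr p + Y \<theta> powr p) + 2 powr p * Z \<theta> powr p)"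
      using p ge_one_powr_ge_zero[of 2 p] mult_right_mono[of 1 "2 powr p" "Z \<theta> powr p"]
      by (intro mult_mono add_mono mult_right_mono powr_mono) auto
    also have "\<dots> = 2 powr p * 2 powr p * (X \<theta> powr p + Y \<theta> powr p + Z \<theta> powr p)"
      by (simp add: algebra_simps)
    also have "2 powr p * 2 powr p = (4::real) powr p"
      using powr_mult[of 2 2 p] by simp
    finally show "osc_bound f m i \<theta> powr p \<le> 4 powr p * (X \<theta> powr p + Y \<theta> powr p + Z \<theta> powr p)" .
  qed
  also have "\<dots> = 4 powr p * (integral {0..2 * pi} (\<lambda>\<theta>. X \<theta> powr p) + integral {0..2 * pi} (\<lambda>\<theta>. Y \<theta> powr p)
      + integral {0..2 * pi} (\<lambda>\<theta>. Z \<theta> powr p))"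
    using ip by (simp add: Henstock_Kurzweil_Integration.integral_add integrable_add)
  also have "integral {0..2 * pi} (\<lambda>\<theta>. X \<theta> powr p) \<le> (2 * pi) powr p * integral {0..2 * pi} (\<lambda>\<theta>. R \<theta> powr p)"
  proof -
    have "integral {0..2 * pi} (\<lambda>\<theta>. X \<theta> powr p)
        = (2 ^ i) powr p * integral {0..2 * pi} (\<lambda>\<theta>. (integral {- a..a} (\<lambda>t. R (\<theta> + t))) powr p)"
      unfolding X_def by (simp add: powr_mult)
    also have "\<dots> \<le> (2 ^ i) powr p * ((2 * a) powr p * integral {0..2 * pi} (\<lambda>\<theta>. R \<theta> powr p))"
      using a by (intro mult_left_mono integral_powr_arc_le p Rc R0 continuous_intros)
        (auto simp: R_def radial_var_periodic[OF f])
    also have "\<dots> = (2 ^ i * (2 * a)) powr p * integral {0..2 * pi} (\<lambda>\<theta>. R \<theta> powr p)"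
      by (simp add: powr_mult)
    finally show ?thesis by (simp add: a)
  qed
  also have "integral {0..2 * pi} (\<lambda>\<theta>. Y \<theta> powr p) = (2 * pi) powr p * integral {0..2 * pi} (\<lambda>\<theta>. R \<theta> powr p)"
    unfolding Y_def by (simp add: powr_mult)
  also have "integral {0..2 * pi} (\<lambda>\<theta>. Z \<theta> powr p)
      \<le> (2 * pi) powr p * ((2 * a) powr p * circle_integral p (deriv f) (whitney i))"
  proof -
    have "integral {0..2 * pi} (\<lambda>\<theta>. Z \<theta> powr p)
        = (2 * pi) powr p * integral {0..2 * pi} (\<lambda>\<theta>. (integral {- a..a} (\<lambda>t. F (\<theta> + t))) powr p)"
      unfolding Z_def by (simp add: powr_mult)
    also have "\<dots> \<le> (2 * pi) powr p * ((2 * a) powr p * integral {0..2 * pi} (\<lambda>\<theta>. F \<theta> powr p))"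
      using a by (intro mult_left_mono integral_powr_arc_le p Fc F0 continuous_intros)
        (auto simp: F_def simp flip: cis_mult)
    finally show ?thesis by (simp add: circle_integral_def F_def)
  qed
  also have "4 powr p * ((2 * pi) powr p * integral {0..2 * pi} (\<lambda>\<theta>. R \<theta> powr p)
      + (2 * pi) powr p * integral {0..2 * pi} (\<lambda>\<theta>. R \<theta> powr p)
      + (2 * pi) powr p * ((2 * a) powr p * circle_integral p (deriv f) (whitney i)))
      = (4 powr p * (2 * pi) powr p) * (2 * integral {0..2 * pi} (\<lambda>\<theta>. R \<theta> powr p)
        + (2 * a) powr p * circle_integral p (deriv f) (whitney i))"
    by (simp add: algebra_simps)
  also have "4 powr p * (2 * pi) powr p = (8 * pi) powr p"
    using powr_mult[of 4 "2 * pi" p] by simp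
  finally show ?thesis by (simp add: R_def a_def)
qed

end

lemma oscillation_nonneg:
  assumes "f holomorphic_on ball 0 1" "cmod z < 1" shows "0 \<le> oscillation f m z"
proof -
  have "z \<noteq> cis t" for t using assms(2) by auto
  then show ?thesis
    unfolding oscillation_def using assms
    by (intro mult_nonneg_nonneg integral_nonneg integrable_continuous_interval continuous_intros
        continuous_on_circle[OF assms(1)] poisson_nonneg) auto
qed

lemma continuous_on_oscillation:
  assumes f: "f holomorphic_on ball 0 1" and g: "continuous_on S g" "\<And>x. x \<in> S \<Longrightarrow> cmod (g x) < 1"
  shows "continuous_on S (\<lambda>x. oscillation f m (g x))"
proof -
  have gc: "continuous_on (S \<times> {0..2 * pi}) (\<lambda>x. g (fst x))"
    by (rule continuous_on_compose2[OF g(1) continuous_on_fst[OF continuous_on_id]]) auto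
  have fgc: "continuous_on (S \<times> {0..2 * pi}) (\<lambda>x. f (g (fst x)))"
    by (rule continuous_on_disc_compose[OF f gc]) (auto intro!: g(2))
  have ne: "g (fst x) \<noteq> cis (snd x)" if "x \<in> S \<times> {0..2 * pi}" for x
    using g(2)[of "fst x"] that by auto
  have fmc: "continuous_on (S \<times> {0..2 * pi}) (\<lambda>x. f (polar (whitney m) (snd x)))"
    by (rule continuous_on_circle[OF f]) (auto intro!: continuous_intros)
  show ?thesis
    unfolding oscillation_def
    by (intro continuous_on_mult continuous_on_const continuous_on_integral_Icc continuous_on_poisson
        continuous_on_norm continuous_on_diff gc fgc fmc ne continuous_on_cis continuous_on_snd continuous_on_id)
qed

section \<open>The discrete Hardy inequality\<close>

context
  fixes f :: "complex \<Rightarrow> complex" and p :: real and v :: "nat \<Rightarrow> real" and C q :: real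
  assumes f: "f holomorphic_on ball 0 1" and p: "1 \<le> p"
    and v0: "\<And>k. 0 \<le> v k" and C: "0 \<le> C" and q: "0 < q" "q < 1"
    and decay: "\<And>i k. i \<le> k \<Longrightarrow> v k \<le> C * q ^ (k - i) * v i"
    and growth: "\<And>i k. i \<le> k \<Longrightarrow> (2 ^ i) powr p * v i \<le> C * q ^ (k - i) * ((2 ^ k) powr p * v k)"
    and doubling: "\<And>k. v k \<le> C * v (Suc k)"
    and sum: "\<And>n. (\<Sum>k<n. v k * circle_integral p (deriv f) (whitney k)) \<le> C"
begin

text \<open>In Hoelder's inequality with the weights \<open>geom_ratio ^ n\<close> the loss is \<open>(geom_ratio powr p) ^ n = q ^ n\<close>
  in the denominator, which is exactly what \<open>decay\<close> and \<open>growth\<close> provide.\<close>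

definition "geom_ratio = q powr (1 / p)"
definition "geom_const = (1 / (1 - geom_ratio)) powr (p - 1)"

lemma geom_ratio: "0 < geom_ratio" "geom_ratio < 1" "geom_ratio powr p = q"
  unfolding geom_ratio_def using q p powr_less_mono2[of "1 / p" q 1] by (auto simp: powr_powr)

lemma geom_const_nonneg: "0 \<le> geom_const"
  by (simp add: geom_const_def)

text \<open>The sum over the finer levels j >= i. \<open>growth\<close> passes from the weight at
  level i to that at level j and supplies q^(j-i) against the loss in Jensen; (2^j)^p cancels the
  length of the radial segment; \<open>doubling\<close> moves v from j to j + 1, the level of the
  circle integral.\<close>

lemma weighted_radial_var_le:
  "(2 ^ i) powr p * v i * integral {0..2 * pi} (\<lambda>\<theta>. (\<Sum>j\<in>{i..<m}. radial_var f j \<theta>) powr p)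
   \<le> geom_const * C * C *
     (\<Sum>j\<in>{i..<m}. geom_ratio ^ (j - i) * (v (Suc j) * circle_integral p (deriv f) (whitney (Suc j))))"
proof -
  define \<eta> where "\<eta> = geom_ratio"
  note \<eta> = geom_ratio[folded \<eta>_def]
  have inj: "inj_on (\<lambda>j. j - i) {i..<m}"
    by (rule inj_onI) auto
  define D where "D = (\<lambda>j. integral {0..2 * pi} (\<lambda>\<theta>. radial_var f j \<theta> powr p))"
  have cp: "continuous_on {0..2 * pi} (\<lambda>\<theta>. radial_var f j \<theta> powr p)" for j
    using p by (intro continuous_on_powr' radial_var_continuous[OF f] continuous_intros)
      (auto simp: radial_var_nonneg[OF f])
  have "integral {0..2 * pi} (\<lambda>\<theta>. (\<Sum>j\<in>{i..<m}. radial_var f j \<theta>) powr p)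
      \<le> integral {0..2 * pi} (\<lambda>\<theta>. geom_const * (\<Sum>j\<in>{i..<m}. \<eta> ^ (j - i) * (radial_var f j \<theta> powr p / q ^ (j - i))))"
  proof (rule integral_le)
    show "(\<lambda>\<theta>. (\<Sum>j\<in>{i..<m}. radial_var f j \<theta>) powr p) integrable_on {0..2 * pi}"
      using p by (intro integrable_continuous_interval continuous_on_powr' continuous_on_sum
          radial_var_continuous[OF f] continuous_intros) (auto intro!: sum_nonneg radial_var_nonneg[OF f])
    show "(\<lambda>\<theta>. geom_const * (\<Sum>j\<in>{i..<m}. \<eta> ^ (j - i) * (radial_var f j \<theta> powr p / q ^ (j - i)))) integrable_on {0..2 * pi}"
      using q by (intro integrable_continuous_interval continuous_intros cp) auto
    show "(\<Sum>j\<in>{i..<m}. radial_var f j \<theta>) powr p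
        \<le> geom_const * (\<Sum>j\<in>{i..<m}. \<eta> ^ (j - i) * (radial_var f j \<theta> powr p / q ^ (j - i)))" for \<theta>
      unfolding geom_const_def
      using sum_powr_geometric_le[OF p, of "{i..<m}" \<eta> "\<lambda>j. j - i" "\<lambda>j. radial_var f j \<theta>"] \<eta> inj
      by (simp add: radial_var_nonneg[OF f] \<eta>_def)
  qed
  also have "\<dots> = geom_const * (\<Sum>j\<in>{i..<m}. \<eta> ^ (j - i) * (D j / q ^ (j - i)))"
    unfolding D_def using q
    by (subst Henstock_Kurzweil_Integration.integral_mult_right, subst Henstock_Kurzweil_Integration.integral_sum)
       (auto intro!: integrable_continuous_interval continuous_intros cp)
  finally have "(2 ^ i) powr p * v i * integral {0..2 * pi} (\<lambda>\<theta>. (\<Sum>j\<in>{i..<m}. radial_var f j \<theta>) powr p)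
      \<le> (2 ^ i) powr p * v i * (geom_const * (\<Sum>j\<in>{i..<m}. \<eta> ^ (j - i) * (D j / q ^ (j - i))))"
    by (intro mult_left_mono mult_nonneg_nonneg v0) auto
  also have "\<dots> = geom_const * (\<Sum>j\<in>{i..<m}. \<eta> ^ (j - i) * ((2 ^ i) powr p * v i * D j / q ^ (j - i)))"
    by (simp add: sum_distrib_left mult_ac)
  also have "\<dots> \<le> geom_const * (\<Sum>j\<in>{i..<m}. \<eta> ^ (j - i) * (C * C * (v (Suc j) * circle_integral p (deriv f) (whitney (Suc j)))))"
  proof (intro mult_left_mono sum_mono geom_const_nonneg)
    fix j assume "j \<in> {i..<m}"
    then have ij: "i \<le> j" by simp
    let ?E = "circle_integral p (deriv f) (whitney (Suc j))"
    have D0: "0 \<le> D j"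
      unfolding D_def by (intro integral_nonneg integrable_continuous_interval cp) auto
    have "(2 ^ i) powr p * v i * D j / q ^ (j - i) \<le> C * q ^ (j - i) * ((2 ^ j) powr p * v j) * D j / q ^ (j - i)"
      using growth[OF ij] D0 q by (intro divide_right_mono mult_right_mono) auto
    also have "\<dots> = C * v j * ((2 ^ j) powr p * D j)"
      using q by simp
    also have "\<dots> \<le> C * (C * v (Suc j)) * ?E"
    proof (intro mult_mono doubling mult_left_mono C)
      have "(2 ^ j) powr p * D j \<le> (2 ^ j) powr p * ((1 / 2 ^ Suc j) powr p * ?E)"
        unfolding D_def by (intro mult_left_mono integral_radial_var_powr_le f p) auto
      also have "\<dots> = ((2 ^ j) * (1 / 2 ^ Suc j)) powr p * ?E"
        by (subst powr_mult) auto
      also have "\<dots> \<le> 1 * ?E"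
        using p by (intro mult_right_mono circle_integral_nonneg) (simp add: powr_le1)
      finally show "(2 ^ j) powr p * D j \<le> ?E" by simp
    qed (use C v0 D0 in auto)
    finally show "(2 ^ i) powr p * v i * D j / q ^ (j - i) \<le> C * C * (v (Suc j) * ?E)"
      by (simp add: mult_ac)
  qed (use \<eta> in auto)
  finally show ?thesis by (simp add: \<eta>_def sum_distrib_left mult_ac)
qed

lemma sum_weighted_radial_var_le:
  "(\<Sum>i<m. (2 ^ i) powr p * v i * integral {0..2 * pi} (\<lambda>\<theta>. (\<Sum>j\<in>{i..<m}. radial_var f j \<theta>) powr p))
   \<le> geom_const * C * C * (1 / (1 - geom_ratio) * C)"
proof -
  let ?y = "\<lambda>j. v (Suc j) * circle_integral p (deriv f) (whitney (Suc j))"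
  have y0: "0 \<le> ?y j" for j by (intro mult_nonneg_nonneg v0 circle_integral_nonneg)
  have "(\<Sum>i<m. (2 ^ i) powr p * v i * integral {0..2 * pi} (\<lambda>\<theta>. (\<Sum>j\<in>{i..<m}. radial_var f j \<theta>) powr p))
      \<le> (\<Sum>i<m. geom_const * C * C * (\<Sum>j\<in>{i..<m}. geom_ratio ^ (j - i) * ?y j))"
    by (intro sum_mono weighted_radial_var_le)
  also have "\<dots> = geom_const * C * C * (\<Sum>i<m. \<Sum>j\<in>{i..<m}. geom_ratio ^ (j - i) * ?y j)"
    by (simp add: sum_distrib_left)
  also have "\<dots> \<le> geom_const * C * C * (1 / (1 - geom_ratio) * C)"
  proof (intro mult_left_mono)
    have "(\<Sum>i<m. \<Sum>j\<in>{i..<m}. geom_ratio ^ (j - i) * ?y j)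
        = (\<Sum>i<m. \<Sum>j\<in>{j \<in> {..<m}. i \<le> j}. geom_ratio ^ (j - i) * ?y j)"
      by (intro sum.cong refl) auto
    also have "\<dots> \<le> 1 / (1 - geom_ratio) * (\<Sum>j<m. ?y j)"
      by (rule sum_sum_geometric_le) (use geom_ratio y0 in \<open>auto simp: inj_on_def\<close>)
    also have "\<dots> \<le> 1 / (1 - geom_ratio) * C"
    proof (rule mult_left_mono)
      have "(\<Sum>j<m. ?y j) = (\<Sum>j\<in>Suc ` {..<m}. v j * circle_integral p (deriv f) (whitney j))"
        by (simp add: sum.reindex)
      also have "\<dots> \<le> (\<Sum>j<Suc m. v j * circle_integral p (deriv f) (whitney j))"
        by (intro sum_mono2) (auto intro!: mult_nonneg_nonneg v0 circle_integral_nonneg)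
      also have "\<dots> \<le> C" by (rule sum)
      finally show "(\<Sum>j<m. ?y j) \<le> C" .
    qed (use geom_ratio in auto)
    finally show "(\<Sum>i<m. \<Sum>j\<in>{i..<m}. geom_ratio ^ (j - i) * ?y j) \<le> 1 / (1 - geom_ratio) * C" .
  qed (use C geom_const_nonneg in auto)
  finally show ?thesis .
qed

text \<open>The sum over the coarser levels i <= k. The factor 2^-(k-i) from the kernel turns
  (2^k)^p into (2^i)^p, and \<open>decay\<close> turns v k into v i with the q^(k-i) that pays for
  Jensen.\<close>

lemma weighted_oscillation_le:
  assumes km: "k \<le> m"
  shows "(2 ^ k) powr p * v k * circle_integral p (oscillation f m) (whitney k)
    \<le> geom_const * C * (\<Sum>i\<le>k. geom_ratio ^ (k - i) *
        ((2 ^ i) powr p * v i * integral {0..2 * pi} (\<lambda>\<theta>. osc_bound f m i \<theta> powr p)))"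
proof -
  define \<eta> where "\<eta> = geom_ratio"
  note \<eta> = geom_ratio[folded \<eta>_def]
  have inj: "inj_on (\<lambda>i. k - i) {..k}"
    by (rule inj_onI) auto
  define X where "X = (\<lambda>i. integral {0..2 * pi} (\<lambda>\<theta>. osc_bound f m i \<theta> powr p))"
  have cp: "continuous_on {0..2 * pi} (\<lambda>\<theta>. osc_bound f m i \<theta> powr p)" for i
    using p by (intro continuous_on_powr' osc_bound_continuous[OF f] continuous_intros)
      (auto simp: osc_bound_nonneg[OF f])
  have X0: "0 \<le> X i" for i
    unfolding X_def by (intro integral_nonneg integrable_continuous_interval cp) auto
  have w: "cmod (polar (whitney k) \<theta>) < 1" for \<theta> by (simp add: norm_mult)
  have "circle_integral p (oscillation f m) (whitney k)
      \<le> integral {0..2 * pi} (\<lambda>\<theta>. geom_const * (\<Sum>i\<le>k. \<eta> ^ (k - i) * ((osc_bound f m i \<theta> powr p / (2 ^ (k - i)) powr p) / q ^ (k - i))))"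
    unfolding circle_integral_def
  proof (rule integral_le)
    show "(\<lambda>\<theta>. norm (oscillation f m (polar (whitney k) \<theta>)) powr p) integrable_on {0..2 * pi}"
      using p by (intro integrable_continuous_interval continuous_on_powr' continuous_intros
          continuous_on_oscillation[OF f]) (auto simp: w)
    show "(\<lambda>\<theta>. geom_const * (\<Sum>i\<le>k. \<eta> ^ (k - i) * ((osc_bound f m i \<theta> powr p / (2 ^ (k - i)) powr p) / q ^ (k - i)))) integrable_on {0..2 * pi}"
      using q by (intro integrable_continuous_interval continuous_intros cp) auto
    fix \<theta>
    have "norm (oscillation f m (polar (whitney k) \<theta>)) powr p
        \<le> (\<Sum>i\<le>k. osc_bound f m i \<theta> / 2 ^ (k - i)) powr p"
      using oscillation_le_sum_osc_bound[OF f km, of \<theta>] oscillation_nonneg[OF f w[of \<theta>], of m] p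
      by (intro powr_mono2) auto
    also have "\<dots> \<le> geom_const * (\<Sum>i\<le>k. \<eta> ^ (k - i) * ((osc_bound f m i \<theta> / 2 ^ (k - i)) powr p / q ^ (k - i)))"
      unfolding geom_const_def
      using sum_powr_geometric_le[OF p, of "{..k}" \<eta> "\<lambda>i. k - i" "\<lambda>i. osc_bound f m i \<theta> / 2 ^ (k - i)"] \<eta> inj
      by (simp add: osc_bound_nonneg[OF f] \<eta>_def)
    also have "\<dots> = geom_const * (\<Sum>i\<le>k. \<eta> ^ (k - i) * ((osc_bound f m i \<theta> powr p / (2 ^ (k - i)) powr p) / q ^ (k - i)))"
      by (simp add: powr_divide osc_bound_nonneg[OF f])
    finally show "norm (oscillation f m (polar (whitney k) \<theta>)) powr p
      \<le> geom_const * (\<Sum>i\<le>k. \<eta> ^ (k - i) * ((osc_bound f m i \<theta> powr p / (2 ^ (k - i)) powr p) / q ^ (k - i)))" .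
  qed
  also have "\<dots> = geom_const * (\<Sum>i\<le>k. \<eta> ^ (k - i) * (X i / (2 ^ (k - i)) powr p / q ^ (k - i)))"
    unfolding X_def using q
    by (subst Henstock_Kurzweil_Integration.integral_mult_right, subst Henstock_Kurzweil_Integration.integral_sum)
       (auto intro!: integrable_continuous_interval continuous_intros cp)
  finally have "(2 ^ k) powr p * v k * circle_integral p (oscillation f m) (whitney k)
      \<le> (2 ^ k) powr p * v k * (geom_const * (\<Sum>i\<le>k. \<eta> ^ (k - i) * (X i / (2 ^ (k - i)) powr p / q ^ (k - i))))"
    by (intro mult_left_mono mult_nonneg_nonneg v0) auto
  also have "\<dots> = geom_const * (\<Sum>i\<le>k. \<eta> ^ (k - i) * ((2 ^ k) powr p * v k * (X i / (2 ^ (k - i)) powr p / q ^ (k - i))))"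
    by (simp add: sum_distrib_left mult_ac)
  also have "\<dots> \<le> geom_const * (\<Sum>i\<le>k. \<eta> ^ (k - i) * (C * ((2 ^ i) powr p * v i * X i)))"
  proof (intro mult_left_mono sum_mono geom_const_nonneg)
    fix i assume "i \<in> {..k}"
    then have ik: "i \<le> k" by simp
    have "(2::real) ^ k = 2 ^ i * 2 ^ (k - i)" using ik by (simp flip: power_add)
    then have pk: "((2::real) ^ k) powr p = (2 ^ i) powr p * (2 ^ (k - i)) powr p"
      by (simp add: powr_mult)
    have "(2 ^ k) powr p * v k * (X i / (2 ^ (k - i)) powr p / q ^ (k - i))
        = (2 ^ i) powr p * X i * v k / q ^ (k - i)"
      unfolding pk by simp
    also have "\<dots> \<le> (2 ^ i) powr p * X i * (C * q ^ (k - i) * v i) / q ^ (k - i)"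
      using decay[OF ik] X0[of i] q by (intro divide_right_mono mult_left_mono) auto
    also have "\<dots> = C * ((2 ^ i) powr p * v i * X i)" using q by simp
    finally show "(2 ^ k) powr p * v k * (X i / (2 ^ (k - i)) powr p / q ^ (k - i)) \<le> C * ((2 ^ i) powr p * v i * X i)" .
  qed (use \<eta> in auto)
  finally show ?thesis by (simp add: \<eta>_def X_def sum_distrib_left mult_ac)
qed

definition "osc_const = geom_const * C * (1 / (1 - geom_ratio) *
   ((8 * pi) powr p * (2 * (geom_const * C * C * (1 / (1 - geom_ratio) * C)) + (2 * pi) powr p * C)))"

text \<open>Both Hardy sums combined. Since the bound is independent of m, it survives the passage
  to the boundary. In the arc term the powers of 2^i cancel and leave the sum bounded by the Besov
  condition.\<close>

lemma sum_weighted_oscillation_le: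
  assumes nm: "n \<le> m"
  shows "(\<Sum>k<n. (2 ^ k) powr p * v k * circle_integral p (oscillation f m) (whitney k)) \<le> osc_const"
proof -
  define Y where "Y = (\<lambda>i. (2 ^ i) powr p * v i * integral {0..2 * pi} (\<lambda>\<theta>. osc_bound f m i \<theta> powr p))"
  define R where "R = (\<lambda>i. (2 ^ i) powr p * v i * integral {0..2 * pi} (\<lambda>\<theta>. (\<Sum>j\<in>{i..<m}. radial_var f j \<theta>) powr p))"
  have Y0: "0 \<le> Y i" for i
    unfolding Y_def using p osc_bound_nonneg[OF f]
    by (intro mult_nonneg_nonneg v0 integral_nonneg integrable_continuous_interval continuous_on_powr'
        osc_bound_continuous[OF f] continuous_intros) auto
  have Y_le: "Y i \<le> (8 * pi) powr p * (2 * R i + (2 * pi) powr p * (v i * circle_integral p (deriv f) (whitney i)))" for i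
  proof -
    have "Y i \<le> (2 ^ i) powr p * v i * ((8 * pi) powr p * (2 * integral {0..2 * pi} (\<lambda>\<theta>. (\<Sum>j\<in>{i..<m}. radial_var f j \<theta>) powr p)
        + (2 * pi / 2 ^ i) powr p * circle_integral p (deriv f) (whitney i)))"
      unfolding Y_def by (intro mult_left_mono integral_osc_bound_powr_le f p mult_nonneg_nonneg v0) auto
    also have "\<dots> = (8 * pi) powr p * (2 * R i + ((2 ^ i) powr p * (2 * pi / 2 ^ i) powr p) * (v i * circle_integral p (deriv f) (whitney i)))"
      by (simp add: R_def algebra_simps)
    also have "(2 ^ i) powr p * (2 * pi / 2 ^ i) powr p = (2 * pi) powr p"
      by (subst powr_mult[symmetric]) auto
    finally show ?thesis .
  qed
  have "(\<Sum>k<n. (2 ^ k) powr p * v k * circle_integral p (oscillation f m) (whitney k))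
      \<le> (\<Sum>k<n. geom_const * C * (\<Sum>i\<le>k. geom_ratio ^ (k - i) * Y i))"
    unfolding Y_def using nm by (intro sum_mono weighted_oscillation_le) auto
  also have "\<dots> = geom_const * C * (\<Sum>k<n. \<Sum>i\<le>k. geom_ratio ^ (k - i) * Y i)"
    by (simp add: sum_distrib_left)
  also have "(\<Sum>k<n. \<Sum>i\<le>k. geom_ratio ^ (k - i) * Y i) = (\<Sum>k<n. \<Sum>i\<in>{i \<in> {..<n}. i \<le> k}. geom_ratio ^ (k - i) * Y i)"
    by (intro sum.cong refl) auto
  also have "geom_const * C * \<dots> \<le> geom_const * C * (1 / (1 - geom_ratio) * (\<Sum>i<n. Y i))"
    using geom_ratio Y0 C geom_const_nonneg
    by (intro mult_left_mono sum_sum_geometric_le) (auto simp: inj_on_def)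
  also have "\<dots> \<le> osc_const"
    unfolding osc_const_def
  proof (intro mult_left_mono)
    have "(\<Sum>i<n. Y i) \<le> (\<Sum>i<m. Y i)"
      using nm Y0 by (intro sum_mono2) auto
    also have "\<dots> \<le> (\<Sum>i<m. (8 * pi) powr p * (2 * R i + (2 * pi) powr p * (v i * circle_integral p (deriv f) (whitney i))))"
      by (intro sum_mono Y_le)
    also have "\<dots> = (8 * pi) powr p * (2 * (\<Sum>i<m. R i) + (2 * pi) powr p * (\<Sum>i<m. v i * circle_integral p (deriv f) (whitney i)))"
      by (simp add: sum_distrib_left sum.distrib distrib_left)
    also have "\<dots> \<le> (8 * pi) powr p * (2 * (geom_const * C * C * (1 / (1 - geom_ratio) * C)) + (2 * pi) powr p * C)"
      unfolding R_def by (intro mult_left_mono add_mono sum sum_weighted_radial_var_le) auto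
    finally show "(\<Sum>i<n. Y i) \<le> (8 * pi) powr p * (2 * (geom_const * C * C * (1 / (1 - geom_ratio) * C)) + (2 * pi) powr p * C)" .
  qed (use geom_ratio C geom_const_nonneg in auto)
  finally show ?thesis .
qed

end

subsection \<open>Boundary values\<close>

lemma integrable_circle_continuous:
  fixes g :: "real \<Rightarrow> 'a::euclidean_space"
  shows "continuous_on {0..2 * pi} g \<Longrightarrow> integrable circle g"
  by (rule continuous_imp_integrable_real)

lemma lebesgue_integral_circle_continuous:
  fixes g :: "real \<Rightarrow> 'a::euclidean_space"
  shows "continuous_on {0..2 * pi} g \<Longrightarrow> integral\<^sup>L circle g = integral {0..2 * pi} g"
  by (intro lebesgue_integral_eq_integral integrable_circle_continuous) auto

lemma borel_measurable_circle_continuous: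
  fixes g :: "real \<Rightarrow> 'a::euclidean_space"
  shows "continuous_on {0..2 * pi} g \<Longrightarrow> g \<in> borel_measurable circle"
  by (intro borel_measurable_integrable integrable_circle_continuous)

text \<open>The limit runs along the radii \<open>whitney m\<close>. Where there is none, the value
  is whatever \<open>lim\<close> returns, so convergence is claimed almost everywhere.\<close>

definition boundary_value :: "(complex \<Rightarrow> complex) \<Rightarrow> complex \<Rightarrow> complex" where
  "boundary_value f w = lim (\<lambda>m. f (complex_of_real (whitney m) * w))"

definition boundary_osc :: "(complex \<Rightarrow> complex) \<Rightarrow> complex \<Rightarrow> real" where
  "boundary_osc f z = 1 / (2 * pi) *
     integral\<^sup>L circle (\<lambda>t. poisson z (cis t) * cmod (boundary_value f (cis t) - f z))"

lemma poisson_continuous: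
  assumes "cmod z < 1" shows "continuous_on S (\<lambda>t. poisson z (cis t))"
proof -
  have "z \<noteq> cis t" for t using assms by auto
  then show ?thesis by (intro continuous_intros) auto
qed

lemma norm_diff_const_bound: "\<bar>cmod (x - c)\<bar> \<le> cmod c + 1 * cmod x"
  using norm_triangle_ineq4[of x c] by simp

lemma continuous_on_dilated:
  assumes f: "f holomorphic_on ball 0 1"
  shows "continuous_on S (\<lambda>\<theta>. f (polar (whitney m) \<theta>))"
  by (rule continuous_on_circle[OF f]) (auto intro: continuous_on_id)

lemma dilated_disc:
  assumes f: "f holomorphic_on ball 0 1"
  shows "continuous_on (cball 0 1) (\<lambda>w. f (complex_of_real (whitney m) * w))"
    and "(\<lambda>w. f (complex_of_real (whitney m) * w)) holomorphic_on ball 0 1"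
proof -
  have *: "cmod (complex_of_real (whitney m) * w) < 1" if "cmod w \<le> 1" for w
  proof -
    have "whitney m * cmod w \<le> whitney m * 1" using that by (intro mult_left_mono) auto
    also have "\<dots> < 1" by simp
    finally show ?thesis by (simp add: norm_mult)
  qed
  show "continuous_on (cball 0 1) (\<lambda>w. f (complex_of_real (whitney m) * w))"
    using * by (intro continuous_on_disc_compose[OF f] continuous_intros) auto
  have "(f \<circ> (\<lambda>w. complex_of_real (whitney m) * w)) holomorphic_on ball 0 1"
    using * by (intro holomorphic_on_compose_gen[OF _ f] holomorphic_intros) auto
  then show "(\<lambda>w. f (complex_of_real (whitney m) * w)) holomorphic_on ball 0 1"
    by (simp add: o_def)
qed

lemma dilated_tendsto:
  assumes f: "f holomorphic_on ball 0 1" and "cmod z < 1"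
  shows "(\<lambda>m. f (complex_of_real (whitney m) * z)) \<longlonglongrightarrow> f z"
proof -
  have "isCont f z"
    using f assms holomorphic_on_imp_continuous_on[OF f] by (auto simp: continuous_on_eq_continuous_at)
  moreover have "(\<lambda>m. complex_of_real (whitney m) * z) \<longlonglongrightarrow> complex_of_real 1 * z"
    by (intro tendsto_intros whitney_tendsto)
  ultimately show ?thesis
    using isCont_tendsto_compose[of z f "\<lambda>m. complex_of_real (whitney m) * z"] by simp
qed

context
  fixes f :: "complex \<Rightarrow> complex"
  assumes f: "f holomorphic_on ball 0 1"
    and summ: "summable (\<lambda>j. integral {0..2 * pi} (radial_var f j))"
begin

text \<open>At almost every angle this bounds f on all circles of radius \<open>whitney m\<close> at
  once; being integrable, it is the majorant for dominated convergence.\<close>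

definition "dominant \<theta> = cmod (f 0) + (\<Sum>j. radial_var f j \<theta>)"

lemma integrable_radial_var: "integrable circle (radial_var f j)"
  by (intro integrable_circle_continuous radial_var_continuous[OF f])

lemma AE_summable_radial_var: "AE \<theta> in circle. summable (\<lambda>j. radial_var f j \<theta>)"
proof -
  have "(\<integral>\<^sup>+ \<theta>. (\<Sum>j. ennreal (radial_var f j \<theta>)) \<partial>circle) = (\<Sum>j. \<integral>\<^sup>+ \<theta>. ennreal (radial_var f j \<theta>) \<partial>circle)"
    using integrable_radial_var by (intro nn_integral_suminf) auto
  also have "\<dots> = (\<Sum>j. ennreal (integral {0..2 * pi} (radial_var f j)))"
    using integrable_radial_var radial_var_nonneg[OF f] radial_var_continuous[OF f]
    by (simp add: nn_integral_eq_integral lebesgue_integral_circle_continuous)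
  also have "\<dots> \<noteq> top"
    using radial_var_nonneg[OF f] radial_var_continuous[OF f]
    by (intro ennreal_suminf_neq_top summ integral_nonneg integrable_continuous_interval) auto
  finally have "AE \<theta> in circle. (\<Sum>j. ennreal (radial_var f j \<theta>)) \<noteq> \<infinity>"
    using integrable_radial_var by (intro nn_integral_PInf_AE) auto
  then show ?thesis
    by eventually_elim (intro summable_suminf_not_top radial_var_nonneg[OF f], simp)
qed

lemma integrable_dominant: "integrable circle dominant"
proof -
  have "integrable circle (\<lambda>\<theta>. \<Sum>j. radial_var f j \<theta>)"
  proof (rule integrable_suminf[OF integrable_radial_var])
    show "AE \<theta> in circle. summable (\<lambda>j. norm (radial_var f j \<theta>))"
      using AE_summable_radial_var by (simp add: radial_var_nonneg[OF f])
    show "summable (\<lambda>j. \<integral>\<theta>. norm (radial_var f j \<theta>) \<partial>circle)"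
      using summ by (simp add: radial_var_nonneg[OF f] lebesgue_integral_circle_continuous radial_var_continuous[OF f])
  qed
  then show ?thesis
    unfolding dominant_def
    by (rule Bochner_Integration.integrable_add[OF integrable_circle_continuous[OF continuous_on_const]])
qed

lemma AE_norm_le_dominant:
  "AE \<theta> in circle. \<forall>m. cmod (f (polar (whitney m) \<theta>)) \<le> dominant \<theta>"
  using AE_summable_radial_var
proof eventually_elim
  case (elim \<theta>)
  show ?case
  proof
    fix m
    have "cmod (f (polar (whitney m) \<theta>)) \<le>
        cmod (f 0) + cmod (f (polar (whitney m) \<theta>) - f (polar (whitney 0) \<theta>))"
      using norm_triangle_ineq2[of "f (polar (whitney m) \<theta>)" "f 0"] by simp
    also have "\<dots> \<le> cmod (f 0) + (\<Sum>j\<in>{0..<m}. radial_var f j \<theta>)"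
      by (intro add_left_mono norm_diff_le_sum_radial_var[OF f]) auto
    also have "\<dots> \<le> dominant \<theta>"
      unfolding dominant_def using elim by (intro add_left_mono sum_le_suminf radial_var_nonneg[OF f]) auto
    finally show "cmod (f (polar (whitney m) \<theta>)) \<le> dominant \<theta>" .
  qed
qed

lemma AE_tendsto_boundary_value:
  "AE \<theta> in circle. (\<lambda>m. f (polar (whitney m) \<theta>)) \<longlonglongrightarrow> boundary_value f (cis \<theta>)"
  using AE_summable_radial_var
proof eventually_elim
  case (elim \<theta>)
  define a where "a = (\<lambda>m. f (polar (whitney m) \<theta>))"
  have "summable (\<lambda>m. a (Suc m) - a m)"
  proof (rule summable_comparison_test[OF _ elim], intro exI allI impI)
    show "norm (a (Suc m) - a m) \<le> radial_var f m \<theta>" for m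
      using norm_diff_le_sum_radial_var[OF f, of m "Suc m" \<theta>] by (simp add: a_def)
  qed
  then have "convergent (\<lambda>n. \<Sum>m<n. a (Suc m) - a m)"
    by (simp add: summable_iff_convergent)
  then have "convergent (\<lambda>n. a n - a 0)"
    by (simp add: sum_lessThan_telescope)
  then have "convergent a"
    using convergent_diff_const_right_iff by blast
  then show ?case
    unfolding boundary_value_def a_def[symmetric] by (simp add: convergent_LIMSEQ_iff)
qed

lemma boundary_value_measurable [measurable]:
  "(\<lambda>\<theta>. boundary_value f (cis \<theta>)) \<in> borel_measurable circle"
  unfolding boundary_value_def
  by (intro borel_measurable_lim_metric borel_measurable_circle_continuous continuous_on_dilated[OF f])

text \<open>Linear growth of h makes a multiple of \<open>dominant\<close> plus a constant a
  majorant. The instances are h x = |x - c| and h x = ln (|x| + e).\<close>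

lemma boundary_value_dominated_convergence:
  fixes k :: "real \<Rightarrow> 'b::euclidean_space" and h :: "complex \<Rightarrow> real"
  assumes k: "continuous_on {0..2 * pi} k" and h: "continuous_on UNIV h" "\<And>x. \<bar>h x\<bar> \<le> a + b * cmod x" "0 \<le> b"
  shows "(\<lambda>m. integral {0..2 * pi} (\<lambda>t. h (f (polar (whitney m) t)) *\<^sub>R k t))
      \<longlonglongrightarrow> integral\<^sup>L circle (\<lambda>t. h (boundary_value f (cis t)) *\<^sub>R k t)"
    and "integrable circle (\<lambda>t. h (boundary_value f (cis t)) *\<^sub>R k t)"
proof -
  obtain B where B: "\<And>t. t \<in> {0..2 * pi} \<Longrightarrow> norm (k t) \<le> B"
    using compact_imp_bounded[OF compact_continuous_image[OF k compact_Icc]] by (fastforce simp: bounded_iff)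
  have B0: "0 \<le> B" using order.trans[OF norm_ge_zero B[of 0]] by simp
  have hm: "h \<in> borel_measurable borel" using h(1) by (rule borel_measurable_continuous_onI)
  have km: "k \<in> borel_measurable circle" by (rule borel_measurable_circle_continuous[OF k])
  have hc: "continuous_on S (\<lambda>t. h (f (polar (whitney m) t)))" for S m
    by (rule continuous_on_compose2[OF h(1) continuous_on_dilated[OF f]]) auto
  have dom: "AE t in circle. norm (h (f (polar (whitney m) t)) *\<^sub>R k t) \<le> (a + b * dominant t) * B" for m
    using AE_norm_le_dominant AE_space
  proof eventually_elim
    case (elim t)
    have "\<bar>h (f (polar (whitney m) t))\<bar> \<le> a + b * cmod (f (polar (whitney m) t))" by (rule h)
    also have "\<dots> \<le> a + b * dominant t" using elim h(3) by (intro add_left_mono mult_left_mono) auto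
    finally have "\<bar>h (f (polar (whitney m) t))\<bar> * norm (k t) \<le> (a + b * dominant t) * B"
      using B[of t] elim(2) by (intro mult_mono) (auto simp: space_restrict_space)
    then show ?case by simp
  qed
  have lim: "AE t in circle. (\<lambda>m. h (f (polar (whitney m) t)) *\<^sub>R k t)
      \<longlonglongrightarrow> h (boundary_value f (cis t)) *\<^sub>R k t"
    using AE_tendsto_boundary_value
  proof eventually_elim
    case (elim t)
    have "isCont h (boundary_value f (cis t))" using h(1) by (simp add: continuous_on_eq_continuous_at)
    then show ?case by (intro tendsto_scaleR tendsto_const isCont_tendsto_compose[OF _ elim])
  qed
  have domi: "integrable circle (\<lambda>t. (a + b * dominant t) * B)"
    by (intro integrable_mult_left Bochner_Integration.integrable_add integrable_mult_right integrable_dominant integrable_circle_continuous) auto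
  have mb: "(\<lambda>t. h (boundary_value f (cis t)) *\<^sub>R k t) \<in> borel_measurable circle"
    by (intro borel_measurable_scaleR km measurable_compose[OF boundary_value_measurable hm])
  have mm: "(\<lambda>t. h (f (polar (whitney m) t)) *\<^sub>R k t) \<in> borel_measurable circle" for m
    by (intro borel_measurable_circle_continuous continuous_intros hc k)
  have "(\<lambda>m. integral\<^sup>L circle (\<lambda>t. h (f (polar (whitney m) t)) *\<^sub>R k t))
      \<longlonglongrightarrow> integral\<^sup>L circle (\<lambda>t. h (boundary_value f (cis t)) *\<^sub>R k t)"
    by (rule integral_dominated_convergence[OF mb mm domi lim dom])
  then show "(\<lambda>m. integral {0..2 * pi} (\<lambda>t. h (f (polar (whitney m) t)) *\<^sub>R k t))
      \<longlonglongrightarrow> integral\<^sup>L circle (\<lambda>t. h (boundary_value f (cis t)) *\<^sub>R k t)"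
    by (subst (asm) lebesgue_integral_circle_continuous) (intro continuous_intros hc k)
  show "integrable circle (\<lambda>t. h (boundary_value f (cis t)) *\<^sub>R k t)"
    by (rule integrable_dominated_convergence[OF mb mm domi lim dom])
qed

lemma integrable_poisson_osc:
  assumes "cmod z < 1"
  shows "integrable circle (\<lambda>t. poisson z (cis t) * cmod (boundary_value f (cis t) - c))"
  using boundary_value_dominated_convergence(2)[OF poisson_continuous[OF assms], of "\<lambda>x. cmod (x - c)" "cmod c" 1]
    norm_diff_const_bound[of _ c]
  by (simp add: mult.commute continuous_intros)

lemma norm_diff_le_boundary_poisson:
  assumes z: "cmod z < 1"
  shows "cmod (f z - c) \<le> 1 / (2 * pi) * integral\<^sup>L circle (\<lambda>t. poisson z (cis t) * cmod (boundary_value f (cis t) - c))"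
proof (rule LIMSEQ_le)
  show "(\<lambda>m. cmod (f (complex_of_real (whitney m) * z) - c)) \<longlonglongrightarrow> cmod (f z - c)"
    by (intro tendsto_intros dilated_tendsto[OF f] z)
  show "(\<lambda>m. 1 / (2 * pi) * integral {0..2 * pi} (\<lambda>t. poisson z (cis t) * cmod (f (polar (whitney m) t) - c)))
      \<longlonglongrightarrow> 1 / (2 * pi) * integral\<^sup>L circle (\<lambda>t. poisson z (cis t) * cmod (boundary_value f (cis t) - c))"
    using boundary_value_dominated_convergence(1)[OF poisson_continuous[OF z], of "\<lambda>x. cmod (x - c)" "cmod c" 1]
      norm_diff_const_bound[of _ c]
    by (intro tendsto_mult tendsto_const) (simp add: mult.commute continuous_intros)
  show "\<exists>N. \<forall>m\<ge>N. cmod (f (complex_of_real (whitney m) * z) - c) \<le> 1 / (2 * pi) *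
      integral {0..2 * pi} (\<lambda>t. poisson z (cis t) * cmod (f (polar (whitney m) t) - c))"
    using norm_le_poisson_integral[OF dilated_disc[OF f] z] by blast
qed

lemma boundary_osc_nonneg: "cmod z < 1 \<Longrightarrow> 0 \<le> boundary_osc f z"
  using order.trans[OF norm_ge_zero norm_diff_le_boundary_poisson[of z "f z"]] by (simp add: boundary_osc_def)

text \<open>Replacing the centre f z by f w costs |f z - f w|, which is itself at most the Poisson
  average at z of the distance of the boundary values from f w; hence the factor 2. The kernel is
  then moved from z to w by Harnack's inequality.\<close>

lemma boundary_osc_harnack:
  assumes "cmod z < 1" "cmod w \<le> cmod z" "cmod (z - w) \<le> M * (1 - cmod z)" "0 \<le> M"
  shows "boundary_osc f z \<le> 2 * (1 + M)\<^sup>2 * boundary_osc f w"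
proof -
  have w: "cmod w < 1" using assms by simp
  define J where "J = 1 / (2 * pi) * integral\<^sup>L circle (\<lambda>t. poisson z (cis t) * cmod (boundary_value f (cis t) - f w))"
  have P1: "1 / (2 * pi) * integral\<^sup>L circle (\<lambda>t. poisson z (cis t)) = 1"
    using integral_unique[OF poisson_has_integral[OF assms(1)]]
    by (simp add: lebesgue_integral_circle_continuous poisson_continuous[OF assms(1)])
  have Pi: "integrable circle (\<lambda>t. poisson z (cis t))"
    by (intro integrable_circle_continuous poisson_continuous assms)
  have "boundary_osc f z \<le> 1 / (2 * pi) * integral\<^sup>L circle
      (\<lambda>t. poisson z (cis t) * cmod (boundary_value f (cis t) - f w) + cmod (f z - f w) * poisson z (cis t))"
    unfolding boundary_osc_def
  proof (intro mult_left_mono integral_mono integrable_poisson_osc Bochner_Integration.integrable_add integrable_mult_right Pi assms)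
    fix t
    have "cmod (boundary_value f (cis t) - f z) \<le> cmod (boundary_value f (cis t) - f w) + cmod (f z - f w)"
      using norm_triangle_ineq4[of "boundary_value f (cis t) - f w" "f z - f w"] by simp
    then have "poisson z (cis t) * cmod (boundary_value f (cis t) - f z)
        \<le> poisson z (cis t) * (cmod (boundary_value f (cis t) - f w) + cmod (f z - f w))"
      by (intro mult_left_mono poisson_nonneg assms)
    then show "poisson z (cis t) * cmod (boundary_value f (cis t) - f z)
        \<le> poisson z (cis t) * cmod (boundary_value f (cis t) - f w) + cmod (f z - f w) * poisson z (cis t)"
      by (simp add: algebra_simps)
  qed auto
  also have "\<dots> = J + cmod (f z - f w) * (1 / (2 * pi) * integral\<^sup>L circle (\<lambda>t. poisson z (cis t)))"
    unfolding J_def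
    by (subst Bochner_Integration.integral_add)
       (use assms integrable_poisson_osc Pi in \<open>auto simp: distrib_left\<close>)
  also have "\<dots> \<le> J + J"
    unfolding P1 using norm_diff_le_boundary_poisson[OF assms(1), of "f w"] by (simp add: J_def)
  also have "J \<le> (1 + M)\<^sup>2 * boundary_osc f w"
  proof -
    have "J \<le> 1 / (2 * pi) * integral\<^sup>L circle (\<lambda>t. (1 + M)\<^sup>2 * (poisson w (cis t) * cmod (boundary_value f (cis t) - f w)))"
      unfolding J_def
    proof (intro mult_left_mono integral_mono integrable_poisson_osc integrable_mult_right assms w)
      fix t
      have "poisson z (cis t) \<le> (1 + M)\<^sup>2 * poisson w (cis t)"
        using assms by (intro poisson_harnack) auto
      then show "poisson z (cis t) * cmod (boundary_value f (cis t) - f w)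
          \<le> (1 + M)\<^sup>2 * (poisson w (cis t) * cmod (boundary_value f (cis t) - f w))"
        by (simp add: mult.assoc[symmetric] mult_right_mono)
    qed auto
    then show ?thesis by (simp add: boundary_osc_def)
  qed
  finally show ?thesis by (simp add: mult_ac)
qed

lemma integral_dilated_tendsto:
  "(\<lambda>m. integral\<^sup>L circle (\<lambda>t. cmod (f (polar (whitney m) t) - boundary_value f (cis t)))) \<longlonglongrightarrow> 0"
proof -
  have "(\<lambda>m. integral\<^sup>L circle (\<lambda>t. cmod (f (polar (whitney m) t) - boundary_value f (cis t))))
      \<longlonglongrightarrow> integral\<^sup>L circle (\<lambda>t. 0)"
  proof (rule integral_dominated_convergence[where w = "\<lambda>t. 2 * dominant t"])
    show "AE t in circle. (\<lambda>m. cmod (f (polar (whitney m) t) - boundary_value f (cis t))) \<longlonglongrightarrow> 0"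
      using AE_tendsto_boundary_value
      by eventually_elim (simp add: tendsto_norm_zero LIM_zero)
    show "AE t in circle. norm (cmod (f (polar (whitney m) t) - boundary_value f (cis t))) \<le> 2 * dominant t" for m
      using AE_tendsto_boundary_value AE_norm_le_dominant
    proof eventually_elim
      case (elim t)
      have "cmod (boundary_value f (cis t)) \<le> dominant t"
        by (rule LIMSEQ_le_const2[OF tendsto_norm[OF elim(1)]]) (use elim(2) in auto)
      moreover have "cmod (f (polar (whitney m) t)) \<le> dominant t" using elim(2) by blast
      ultimately show ?case
        using norm_triangle_ineq4[of "f (polar (whitney m) t)" "boundary_value f (cis t)"] by simp
    qed
    show "(\<lambda>t. cmod (f (polar (whitney m) t) - boundary_value f (cis t))) \<in> borel_measurable circle" for m
      using borel_measurable_circle_continuous[OF continuous_on_dilated[OF f, of _ m]] by measurable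
  qed (auto intro: integrable_dominant)
  then show ?thesis by simp
qed

text \<open>On a smaller disc the kernel is at most 2 / (1 - r), so the difference is controlled by
  the L^1 distance between the dilated function and the boundary values. Uniformity gives continuity
  of \<open>boundary_osc\<close> and carries bounds over on several circles at once.\<close>

lemma uniform_limit_oscillation:
  assumes "r < 1"
  shows "uniform_limit (cball 0 r) (\<lambda>m z. oscillation f m z) (boundary_osc f) sequentially"
proof -
  define I where "I = (\<lambda>m. integral\<^sup>L circle (\<lambda>t. cmod (f (polar (whitney m) t) - boundary_value f (cis t))))"
  have Iint: "integrable circle (\<lambda>t. cmod (f (polar (whitney m) t) - boundary_value f (cis t)))" for m
  proof -
    have "integrable circle (\<lambda>t. boundary_value f (cis t))"
    proof (rule Bochner_Integration.integrable_bound)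
      show "integrable circle (\<lambda>t. poisson 0 (cis t) * cmod (boundary_value f (cis t) - 0))"
        by (rule integrable_poisson_osc) simp
    qed (auto simp: poisson_def)
    then show ?thesis
      by (intro integrable_norm
          Bochner_Integration.integrable_diff[OF integrable_circle_continuous[OF continuous_on_dilated[OF f]]])
  qed
  have bound: "\<bar>oscillation f m z - boundary_osc f z\<bar> \<le> 1 / (2 * pi) * (2 / (1 - r)) * I m" if z: "cmod z \<le> r" for m z
  proof -
    have z1: "cmod z < 1" using z assms by simp
    have osc: "oscillation f m z = 1 / (2 * pi) * integral\<^sup>L circle (\<lambda>t. poisson z (cis t) * cmod (f (polar (whitney m) t) - f z))"
      unfolding oscillation_def
      by (subst lebesgue_integral_circle_continuous) (auto intro!: continuous_intros poisson_continuous z1 continuous_on_dilated[OF f])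
    have i1: "integrable circle (\<lambda>t. poisson z (cis t) * cmod (f (polar (whitney m) t) - f z))"
      by (intro integrable_circle_continuous continuous_intros poisson_continuous z1 continuous_on_dilated[OF f])
    have "oscillation f m z - boundary_osc f z = 1 / (2 * pi) * integral\<^sup>L circle
        (\<lambda>t. poisson z (cis t) * cmod (f (polar (whitney m) t) - f z) - poisson z (cis t) * cmod (boundary_value f (cis t) - f z))"
      unfolding osc boundary_osc_def
      by (subst Bochner_Integration.integral_diff[OF i1 integrable_poisson_osc[OF z1]]) (simp add: right_diff_distrib)
    then have "\<bar>oscillation f m z - boundary_osc f z\<bar> = 1 / (2 * pi) * \<bar>integral\<^sup>L circle
        (\<lambda>t. poisson z (cis t) * cmod (f (polar (whitney m) t) - f z) - poisson z (cis t) * cmod (boundary_value f (cis t) - f z))\<bar>"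
      by (simp add: abs_mult)
    also have "\<dots> \<le> 1 / (2 * pi) * integral\<^sup>L circle (\<lambda>t. 2 / (1 - r) * cmod (f (polar (whitney m) t) - boundary_value f (cis t)))"
    proof (intro mult_left_mono)
      show "\<bar>integral\<^sup>L circle
        (\<lambda>t. poisson z (cis t) * cmod (f (polar (whitney m) t) - f z) - poisson z (cis t) * cmod (boundary_value f (cis t) - f z))\<bar>
        \<le> integral\<^sup>L circle (\<lambda>t. 2 / (1 - r) * cmod (f (polar (whitney m) t) - boundary_value f (cis t)))"
        unfolding real_norm_def[symmetric]
      proof (rule Bochner_Integration.integral_norm_bound_integral)
        fix t
        let ?a = "f (polar (whitney m) t)" and ?b = "boundary_value f (cis t)"
        have "\<bar>cmod (?a - f z) - cmod (?b - f z)\<bar> \<le> cmod (?a - ?b)"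
          using norm_triangle_ineq3[of "?a - f z" "?b - f z"] by simp
        moreover have "poisson z (cis t) \<le> 2 / (1 - r)"
        proof -
          have "poisson z (cis t) \<le> 2 / (1 - cmod z)" by (intro poisson_le z1) simp
          also have "\<dots> \<le> 2 / (1 - r)" using z assms by (intro divide_left_mono) auto
          finally show ?thesis .
        qed
        ultimately have "poisson z (cis t) * \<bar>cmod (?a - f z) - cmod (?b - f z)\<bar> \<le> 2 / (1 - r) * cmod (?a - ?b)"
          using assms poisson_nonneg[OF z1, of "cis t"] by (intro mult_mono) auto
        then show "norm (poisson z (cis t) * cmod (?a - f z) - poisson z (cis t) * cmod (?b - f z)) \<le> 2 / (1 - r) * cmod (?a - ?b)"
          using poisson_nonneg[OF z1, of "cis t"] by (simp add: abs_mult flip: right_diff_distrib)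
      qed (intro Bochner_Integration.integrable_diff i1 integrable_poisson_osc z1 integrable_mult_right Iint)+
    qed auto
    finally show ?thesis by (simp add: I_def)
  qed
  have lim: "(\<lambda>m. 1 / (2 * pi) * (2 / (1 - r)) * I m) \<longlonglongrightarrow> 0"
    using tendsto_mult_left[OF integral_dilated_tendsto, of "1 / (2 * pi) * (2 / (1 - r))"] by (simp add: I_def)
  show ?thesis
  proof (rule uniform_limitI)
    fix e :: real assume "0 < e"
    have "\<forall>\<^sub>F m in sequentially. 1 / (2 * pi) * (2 / (1 - r)) * I m < e"
      using order_tendstoD(2)[OF lim \<open>0 < e\<close>] .
    then show "\<forall>\<^sub>F m in sequentially. \<forall>z\<in>cball 0 r. dist (oscillation f m z) (boundary_osc f z) < e"
    proof eventually_elim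
      case (elim m)
      show ?case
      proof
        fix z :: complex assume "z \<in> cball 0 r"
        then show "dist (oscillation f m z) (boundary_osc f z) < e"
          using bound[of z m] elim by (simp add: dist_real_def)
      qed
    qed
  qed
qed

lemma continuous_on_boundary_osc:
  assumes "r < 1" shows "continuous_on (cball 0 r) (boundary_osc f)"
  by (rule uniform_limit_theorem[OF _ uniform_limit_oscillation[OF assms]])
     (use assms in \<open>auto intro!: always_eventually continuous_on_oscillation[OF f] continuous_on_id\<close>)

text \<open>Jensen's inequality for the dilates, followed by m to infinity. Adding e keeps the
  logarithm continuous at zeros and of linear growth, so dominated convergence applies.\<close>

lemma ln_norm_le_boundary_poisson:
  assumes z: "cmod z < 1" "f z \<noteq> 0" and e: "0 < e"
  shows "ln (cmod (f z)) \<le> 1 / (2 * pi) * integral\<^sup>L circle (\<lambda>t. poisson z (cis t) * ln (cmod (boundary_value f (cis t)) + e))"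
    and "integrable circle (\<lambda>t. poisson z (cis t) * ln (cmod (boundary_value f (cis t)) + e))"
proof -
  have pos: "0 < cmod x + e" for x using e by (simp add: add_nonneg_pos)
  have lc: "continuous_on UNIV (\<lambda>x. ln (cmod x + e))"
    by (intro continuous_intros) (metis pos order_less_irrefl)
  have lb: "\<bar>ln (cmod x + e)\<bar> \<le> \<bar>ln e\<bar> + 1 / e * cmod x" for x
  proof -
    have "ln (cmod x + e) = ln (e * (1 + cmod x / e))" using e by (simp add: distrib_left add.commute)
    also have "\<dots> = ln e + ln (1 + cmod x / e)"
    proof -
      have "0 < 1 + cmod x / e" using e by (intro add_pos_nonneg) auto
      then show ?thesis using e by (simp add: ln_mult)
    qed
    finally have eq: "ln (cmod x + e) = ln e + ln (1 + cmod x / e)" .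
    have "0 \<le> ln (1 + cmod x / e)" "ln (1 + cmod x / e) \<le> cmod x / e"
      using e by (auto intro!: ln_ge_zero ln_add_one_self_le_self)
    then show ?thesis unfolding eq by simp
  qed
  note dc = boundary_value_dominated_convergence[OF poisson_continuous[OF z(1)] lc lb]
  show "integrable circle (\<lambda>t. poisson z (cis t) * ln (cmod (boundary_value f (cis t)) + e))"
    using dc(2) e by (simp add: mult.commute)
  show "ln (cmod (f z)) \<le> 1 / (2 * pi) * integral\<^sup>L circle (\<lambda>t. poisson z (cis t) * ln (cmod (boundary_value f (cis t)) + e))"
  proof (rule LIMSEQ_le)
    show "(\<lambda>m. ln (cmod (f (complex_of_real (whitney m) * z)))) \<longlonglongrightarrow> ln (cmod (f z))"
      using z by (intro tendsto_ln tendsto_norm dilated_tendsto[OF f]) auto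
    show "(\<lambda>m. 1 / (2 * pi) * integral {0..2 * pi} (\<lambda>t. poisson z (cis t) * ln (cmod (f (polar (whitney m) t)) + e)))
        \<longlonglongrightarrow> 1 / (2 * pi) * integral\<^sup>L circle (\<lambda>t. poisson z (cis t) * ln (cmod (boundary_value f (cis t)) + e))"
      using dc(1) e by (intro tendsto_mult tendsto_const) (simp add: mult.commute)
    have "\<forall>\<^sub>F m in sequentially. f (complex_of_real (whitney m) * z) \<noteq> 0"
      using tendsto_imp_eventually_ne[OF dilated_tendsto[OF f z(1)] z(2)] .
    then obtain N where N: "\<And>m. m \<ge> N \<Longrightarrow> f (complex_of_real (whitney m) * z) \<noteq> 0"
      by (auto simp: eventually_sequentially)
    show "\<exists>N. \<forall>m\<ge>N. ln (cmod (f (complex_of_real (whitney m) * z))) \<le> 1 / (2 * pi) *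
        integral {0..2 * pi} (\<lambda>t. poisson z (cis t) * ln (cmod (f (polar (whitney m) t)) + e))"
    proof (intro exI[of _ N] allI impI)
      fix m assume "m \<ge> N"
      have sc: "continuous_on (sphere 0 1) (\<lambda>w. ln (cmod (f (complex_of_real (whitney m) * w)) + e))"
        by (rule continuous_on_compose2[OF lc continuous_on_subset[OF dilated_disc(1)[OF f]]]) auto
      show "ln (cmod (f (complex_of_real (whitney m) * z))) \<le> 1 / (2 * pi) *
          integral {0..2 * pi} (\<lambda>t. poisson z (cis t) * ln (cmod (f (polar (whitney m) t)) + e))"
        using norm_le_exp_poisson_integral[OF dilated_disc[OF f] sc _ z(1) N[OF \<open>m \<ge> N\<close>]] e pos by simp
    qed
  qed
qed

end

subsection \<open>Outer functions\<close>

lemma integrable_circle_mult_continuous: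
  fixes g :: "real \<Rightarrow> 'a::{euclidean_space, real_normed_field}" and u :: "real \<Rightarrow> 'a"
  assumes u: "integrable circle u" and g: "continuous_on {0..2 * pi} g"
  shows "integrable circle (\<lambda>t. g t * u t)"
proof -
  obtain B where B: "\<forall>x\<in>g ` {0..2 * pi}. norm x \<le> B"
    using compact_imp_bounded[OF compact_continuous_image[OF g compact_Icc]] unfolding bounded_iff by blast
  show ?thesis
  proof (rule Bochner_Integration.integrable_bound)
    show "integrable circle (\<lambda>t. B * norm (u t))" using u by simp
    show "(\<lambda>t. g t * u t) \<in> borel_measurable circle"
      using u borel_measurable_circle_continuous[OF g] by simp
    show "AE t in circle. norm (g t * u t) \<le> norm (B * norm (u t))"
    proof (rule AE_I2)
      fix t assume "t \<in> space circle"
      then have "norm (g t) \<le> B" using B by simp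
      then have "norm (g t) * norm (u t) \<le> B * norm (u t)" by (rule mult_right_mono) simp
      also have "\<dots> \<le> norm (B * norm (u t))" by simp
      finally show "norm (g t * u t) \<le> norm (B * norm (u t))" by (simp add: norm_mult)
    qed
  qed
qed

definition herglotz :: "(real \<Rightarrow> real) \<Rightarrow> complex \<Rightarrow> complex" where
  "herglotz u z = integral\<^sup>L circle (\<lambda>t. (cis t + z) / (cis t - z) * complex_of_real (u t))"

text \<open>Parametrised by the logarithm u of the symbol as a function of the angle.
  \<open>herglotz\<close> omits the factor 1 / (2 * pi), which reappears in the exponent.\<close>

definition outer_of :: "(real \<Rightarrow> real) \<Rightarrow> complex \<Rightarrow> complex" where
  "outer_of u z = exp (1 / (2 * complex_of_real pi) * herglotz u z)"

lemma outer_function_eq_outer_of: "outer_function \<phi> = outer_of (\<lambda>t. ln (\<phi> (cis t)))"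
  by (simp add: fun_eq_iff outer_function_def outer_of_def herglotz_def set_lebesgue_integral_def
      integral_restrict_space)

lemma cis_minus_nonzero: "cmod z < 1 \<Longrightarrow> cis t - z \<noteq> 0"
  by auto

lemma Re_herglotz_kernel:
  assumes "cmod w = 1" "cmod z < 1"
  shows "Re ((w + z) / (w - z)) = poisson z w"
proof -
  have "(Re w)\<^sup>2 + (Im w)\<^sup>2 = 1" using assms(1) cmod_power2[of w] by simp
  then have "(Re w + Re z) * (Re w - Re z) + (Im w + Im z) * (Im w - Im z) = 1 - ((Re z)\<^sup>2 + (Im z)\<^sup>2)"
    by (simp add: power2_eq_square algebra_simps)
  then show ?thesis
    unfolding poisson_def Re_divide cmod_power2 by simp
qed

text \<open>This kernel is the z-derivative of the Herglotz kernel; in t it has the periodic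
  primitive 2 \<i> / (cis t - z).\<close>

lemma integral_cauchy_kernel_square:
  assumes z: "cmod z < 1"
  shows "((\<lambda>t. 2 * cis t / (cis t - z)\<^sup>2) has_integral 0) {0..2 * pi}"
proof -
  have "((\<lambda>t. 2 * cis t / (cis t - z)\<^sup>2) has_integral 2 * \<i> / (cis (2 * pi) - z) - 2 * \<i> / (cis 0 - z)) {0..2 * pi}"
  proof (rule fundamental_theorem_of_calculus)
    fix t :: real
    have "((\<lambda>t. 2 * \<i> / (cis t - z)) has_vector_derivative (- (2 * \<i> * (\<i> * cis t)) / (cis t - z)\<^sup>2)) (at t within {0..2 * pi})"
      unfolding has_vector_derivative_def using cis_minus_nonzero[OF z]
      by (auto intro!: derivative_eq_intros ext simp: field_simps power2_eq_square scaleR_conv_of_real)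
    then show "((\<lambda>t. 2 * \<i> / (cis t - z)) has_vector_derivative 2 * cis t / (cis t - z)\<^sup>2) (at t within {0..2 * pi})"
    proof -
      have eq: "- (2 * \<i> * (\<i> * cis t)) = 2 * cis t"
        by (simp only: mult.assoc complex_i_mult_minus) simp
      assume "((\<lambda>t. 2 * \<i> / (cis t - z)) has_vector_derivative (- (2 * \<i> * (\<i> * cis t)) / (cis t - z)\<^sup>2)) (at t within {0..2 * pi})"
      then show ?thesis by (simp only: eq)
    qed
  qed simp
  then show ?thesis by simp
qed

lemma poisson_integrable_mult:
  "cmod z < 1 \<Longrightarrow> integrable circle g \<Longrightarrow> integrable circle (\<lambda>t. poisson z (cis t) * g t)"
  for g :: "real \<Rightarrow> real"
  using cis_minus_nonzero by (intro integrable_circle_mult_continuous continuous_intros) auto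

lemma lebesgue_integral_poisson:
  assumes "cmod z < 1" shows "integral\<^sup>L circle (\<lambda>t. poisson z (cis t)) = 2 * pi"
proof -
  have "z \<noteq> cis t" for t using assms by auto
  then show ?thesis
    using integral_unique[OF poisson_has_integral[OF assms]]
    by (simp add: lebesgue_integral_circle_continuous continuous_intros)
qed

context
  fixes u :: "real \<Rightarrow> real"
  assumes u: "integrable circle u"
begin

lemma integrable_circle_mult_complex:
  "continuous_on {0..2 * pi} g \<Longrightarrow> integrable circle (\<lambda>t. g t * complex_of_real (u t))"
  by (intro integrable_circle_mult_continuous) (use u in auto)

lemma herglotz_integrable:
  "cmod z < 1 \<Longrightarrow> integrable circle (\<lambda>t. (cis t + z) / (cis t - z) * complex_of_real (u t))"
  using cis_minus_nonzero by (intro integrable_circle_mult_complex continuous_intros) blast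

text \<open>Differentiation under the integral with an explicit remainder: for w = cis t, the
  Herglotz kernel minus its first-order expansion is exactly 2 w (y - z)^2 / ((w - y) (w - z)^2), of
  second order uniformly in t.\<close>

lemma has_field_derivative_herglotz:
  assumes z: "cmod z < 1"
  shows "(herglotz u has_field_derivative
      integral\<^sup>L circle (\<lambda>t. 2 * cis t / (cis t - z)\<^sup>2 * complex_of_real (u t))) (at z)"
proof -
  define D where "D = integral\<^sup>L circle (\<lambda>t. 2 * cis t / (cis t - z)\<^sup>2 * complex_of_real (u t))"
  \<comment> \<open>Half the distance to the circle, so that every y within d of z still has
    distance at least d from the circle.\<close>
  define d where "d = (1 - cmod z) / 2"
  have d: "0 < d" using z by (simp add: d_def)
  define J where "J = integral\<^sup>L circle (\<lambda>t. \<bar>u t\<bar>)"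
  have Di: "integrable circle (\<lambda>t. 2 * cis t / (cis t - z)\<^sup>2 * complex_of_real (u t))"
    using cis_minus_nonzero[OF z] by (intro integrable_circle_mult_complex continuous_intros) auto
  have bound: "cmod (herglotz u y - herglotz u z - D * (y - z)) \<le> 2 / d ^ 3 * J * (cmod (y - z))\<^sup>2"
    if y: "dist y z < d" for y
  proof -
    have y1: "cmod y \<le> 1 - d" "cmod z \<le> 1 - d"
      using y norm_triangle_ineq2[of y z] z by (auto simp: d_def dist_norm field_simps)
    have y2: "cmod y < 1" using y1 d by simp
    define A B E where "A = (\<lambda>t. (cis t + y) / (cis t - y) * complex_of_real (u t))"
      and "B = (\<lambda>t. (cis t + z) / (cis t - z) * complex_of_real (u t))"
      and "E = (\<lambda>t. 2 * cis t / (cis t - z)\<^sup>2 * complex_of_real (u t))"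
    have int: "integrable circle A" "integrable circle B" "integrable circle E"
      unfolding A_def B_def E_def by (rule herglotz_integrable[OF y2] herglotz_integrable[OF z] Di)+
    have "herglotz u y - herglotz u z - D * (y - z) = integral\<^sup>L circle (\<lambda>t. A t - B t - E t * (y - z))"
      unfolding herglotz_def D_def A_def[symmetric] B_def[symmetric] E_def[symmetric]
      using int by simp
    also have "cmod \<dots> \<le> integral\<^sup>L circle (\<lambda>t. 2 / d ^ 3 * (cmod (y - z))\<^sup>2 * \<bar>u t\<bar>)"
    proof (rule Bochner_Integration.integral_norm_bound_integral)
      show "integrable circle (\<lambda>t. 2 / d ^ 3 * (cmod (y - z))\<^sup>2 * \<bar>u t\<bar>)" using u by simp
      show "integrable circle (\<lambda>t. A t - B t - E t * (y - z))"
        using int by simp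
      fix t
      have n: "cis t - y \<noteq> 0" "cis t - z \<noteq> 0" using cis_minus_nonzero y2 z by auto
      have ge: "d \<le> cmod (cis t - y)" "d \<le> cmod (cis t - z)"
        using circle_minus_ge[of "cis t" y] circle_minus_ge[of "cis t" z] y1 by auto
      have "(cis t + y) / (cis t - y) - (cis t + z) / (cis t - z) - 2 * cis t / (cis t - z)\<^sup>2 * (y - z)
          = 2 * cis t * (y - z)\<^sup>2 / ((cis t - y) * (cis t - z)\<^sup>2)"
        using n by (simp add: divide_simps) (simp add: power2_eq_square algebra_simps)
      then have "cmod ((cis t + y) / (cis t - y) - (cis t + z) / (cis t - z) - 2 * cis t / (cis t - z)\<^sup>2 * (y - z))
          = 2 * (cmod (y - z))\<^sup>2 / (cmod (cis t - y) * (cmod (cis t - z))\<^sup>2)"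
        by (simp add: norm_mult norm_divide norm_power)
      also have "\<dots> \<le> 2 * (cmod (y - z))\<^sup>2 / (d * d\<^sup>2)"
        using ge d by (intro divide_left_mono mult_mono power_mono mult_pos_pos zero_less_power) auto
      finally have "cmod ((cis t + y) / (cis t - y) - (cis t + z) / (cis t - z) - 2 * cis t / (cis t - z)\<^sup>2 * (y - z)) * \<bar>u t\<bar>
          \<le> 2 * (cmod (y - z))\<^sup>2 / (d * d\<^sup>2) * \<bar>u t\<bar>"
        by (rule mult_right_mono) simp
      moreover have "A t - B t - E t * (y - z)
          = ((cis t + y) / (cis t - y) - (cis t + z) / (cis t - z) - 2 * cis t / (cis t - z)\<^sup>2 * (y - z)) * complex_of_real (u t)"
      proof -
        have "a * x - b * x - e * x * d = (a - b - e * d) * x" for a b e d x :: complex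
          by (simp add: algebra_simps)
        then show ?thesis unfolding A_def B_def E_def .
      qed
      moreover have "d * d\<^sup>2 = d ^ 3" by (simp add: power3_eq_cube power2_eq_square)
      ultimately show "cmod (A t - B t - E t * (y - z)) \<le> 2 / d ^ 3 * (cmod (y - z))\<^sup>2 * \<bar>u t\<bar>"
        by (simp only: norm_mult norm_of_real) (simp add: mult_ac)
    qed
    finally show ?thesis by (simp add: J_def mult_ac)
  qed
  have "(herglotz u has_derivative (\<lambda>h. D * h)) (at z within UNIV)"
  proof (rule has_derivativeI_sandwich[OF d])
    show "norm (herglotz u y - herglotz u z - D * (y - z)) / norm (y - z) \<le> 2 / d ^ 3 * J * cmod (y - z)"
      if "y \<noteq> z" "dist y z < d" for y
      using bound[OF that(2)] that(1) d by (simp add: pos_divide_le_eq power2_eq_square mult_ac)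
    show "((\<lambda>y. 2 / d ^ 3 * J * cmod (y - z)) \<longlongrightarrow> 0) (at z within UNIV)"
      using d by (auto intro!: tendsto_eq_intros)
  qed (auto intro: bounded_linear_mult_right)
  then show ?thesis by (simp add: has_field_derivative_def D_def)
qed

lemma Re_herglotz:
  assumes z: "cmod z < 1"
  shows "Re (herglotz u z) = integral\<^sup>L circle (\<lambda>t. poisson z (cis t) * u t)"
proof -
  have "Re (herglotz u z) = integral\<^sup>L circle (\<lambda>t. Re ((cis t + z) / (cis t - z) * complex_of_real (u t)))"
    unfolding herglotz_def by (rule integral_Re[symmetric]) (rule herglotz_integrable[OF z])
  also have "\<dots> = integral\<^sup>L circle (\<lambda>t. poisson z (cis t) * u t)"
  proof -
    have "Re ((cis t + z) / (cis t - z) * complex_of_real (u t)) = poisson z (cis t) * u t" for t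
    proof -
      have "Re (k * complex_of_real b) = Re k * b" for k b by simp
      then show ?thesis using Re_herglotz_kernel[OF norm_cis z, of t] by (simp only:)
    qed
    then show ?thesis by (simp only:)
  qed
  finally show ?thesis .
qed

lemma norm_outer_of:
  assumes "cmod z < 1"
  shows "cmod (outer_of u z) = exp (1 / (2 * pi) * integral\<^sup>L circle (\<lambda>t. poisson z (cis t) * u t))"
proof -
  have "1 / (2 * complex_of_real pi) = complex_of_real (1 / (2 * pi))" by simp
  then have "Re (1 / (2 * complex_of_real pi) * herglotz u z) = 1 / (2 * pi) * Re (herglotz u z)"
    by (simp only: times_complex.sel Re_complex_of_real Im_complex_of_real)
  then show ?thesis by (simp only: outer_of_def norm_exp_eq_Re Re_herglotz[OF assms])
qed

lemma has_field_derivative_outer_of: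
  assumes "cmod z < 1"
  shows "(outer_of u has_field_derivative outer_of u z * (1 / (2 * complex_of_real pi) *
      integral\<^sup>L circle (\<lambda>t. 2 * cis t / (cis t - z)\<^sup>2 * complex_of_real (u t)))) (at z)"
  unfolding outer_of_def
  by (auto intro!: derivative_eq_intros has_field_derivative_herglotz assms)

lemma outer_of_holomorphic: "outer_of u holomorphic_on ball 0 1"
  unfolding holomorphic_on_open[OF open_ball]
  by (intro ballI exI, rule has_field_derivative_outer_of) simp

text \<open>Since the kernel of the derivative has mean zero, \<open>u\<close> may be replaced by its deviation from the
  Poisson mean \<open>c\<close>; the positive and the negative part of this deviation have the same mean, and
  the positive one is controlled by \<open>exp (u - c) - 1\<close>.\<close>

lemma norm_deriv_outer_of_le:
  assumes z: "cmod z < 1"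
    and g: "integrable circle (\<lambda>t. poisson z (cis t) * g t)"
      "AE t in circle. 0 \<le> g t \<and> exp (u t) - cmod (outer_of u z) \<le> g t"
  shows "(1 - (cmod z)\<^sup>2) * cmod (deriv (outer_of u) z)
    \<le> 4 * (1 / (2 * pi) * integral\<^sup>L circle (\<lambda>t. poisson z (cis t) * g t))"
proof -
  define c where "c = 1 / (2 * pi) * integral\<^sup>L circle (\<lambda>t. poisson z (cis t) * u t)"
  have O: "cmod (outer_of u z) = exp c" by (simp add: norm_outer_of[OF z] c_def)
  define K where "K = (\<lambda>t. 2 * cis t / (cis t - z)\<^sup>2)"
  have Kc: "continuous_on {0..2 * pi} K"
    unfolding K_def using cis_minus_nonzero[OF z] by (intro continuous_intros) auto
  have K0: "integral\<^sup>L circle K = 0"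
    using integral_unique[OF integral_cauchy_kernel_square[OF z]]
    by (simp add: lebesgue_integral_circle_continuous[OF Kc] flip: K_def)
  have nK: "(1 - (cmod z)\<^sup>2) * cmod (K t) = 2 * poisson z (cis t)" for t
    by (simp add: K_def poisson_def norm_mult norm_divide norm_power)
  have zz: "0 \<le> 1 - (cmod z)\<^sup>2" using z by (simp add: power_le_one_iff abs_square_le_1)
  have Pu: "integrable circle (\<lambda>t. poisson z (cis t) * u t)"
    by (rule poisson_integrable_mult[OF z u])
  have Pc: "integrable circle (\<lambda>t. poisson z (cis t) * c)"
    by (rule poisson_integrable_mult[OF z]) (rule integrable_circle_continuous, simp)
  have Kuc: "integrable circle (\<lambda>t. K t * complex_of_real (u t - c))"
    by (intro integrable_circle_mult_continuous Kc) (use u in \<open>auto intro!: integrable_circle_continuous\<close>)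
  have "integral\<^sup>L circle (\<lambda>t. poisson z (cis t) * \<bar>u t - c\<bar>)
      \<le> integral\<^sup>L circle (\<lambda>t. 2 * exp (- c) * (poisson z (cis t) * g t) - (poisson z (cis t) * u t - poisson z (cis t) * c))"
  proof (rule integral_mono_AE)
    show "integrable circle (\<lambda>t. poisson z (cis t) * \<bar>u t - c\<bar>)"
      by (rule poisson_integrable_mult[OF z]) (use u in \<open>auto intro!: integrable_circle_continuous\<close>)
    show "integrable circle (\<lambda>t. 2 * exp (- c) * (poisson z (cis t) * g t) - (poisson z (cis t) * u t - poisson z (cis t) * c))"
      using g(1) Pu Pc by simp
    show "AE t in circle. poisson z (cis t) * \<bar>u t - c\<bar>
        \<le> 2 * exp (- c) * (poisson z (cis t) * g t) - (poisson z (cis t) * u t - poisson z (cis t) * c)"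
      using g(2)
    proof eventually_elim
      case (elim t)
      have "u t - c \<le> exp (u t - c) - 1" using exp_ge_add_one_self[of "u t - c"] by linarith
      also have "\<dots> = exp (- c) * (exp (u t) - exp c)" by (simp add: right_diff_distrib flip: exp_add)
      also have "\<dots> \<le> exp (- c) * g t" using elim by (intro mult_left_mono) (auto simp: O)
      finally have "u t - c \<le> exp (- c) * g t" .
      moreover have "0 \<le> exp (- c) * g t" using elim by simp
      ultimately have "\<bar>u t - c\<bar> \<le> 2 * (exp (- c) * g t) - (u t - c)" by (simp add: abs_if)
      then have "poisson z (cis t) * \<bar>u t - c\<bar> \<le> poisson z (cis t) * (2 * (exp (- c) * g t) - (u t - c))"
        by (intro mult_left_mono poisson_nonneg z)
      then show ?case by (simp add: algebra_simps)
    qed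
  qed
  also have "\<dots> = 2 * exp (- c) * integral\<^sup>L circle (\<lambda>t. poisson z (cis t) * g t)
      - (integral\<^sup>L circle (\<lambda>t. poisson z (cis t) * u t) - 2 * pi * c)"
    using g(1) Pu Pc by (simp add: Bochner_Integration.integral_diff lebesgue_integral_poisson[OF z])
  also have "\<dots> = 2 * exp (- c) * integral\<^sup>L circle (\<lambda>t. poisson z (cis t) * g t) - (2 * pi * c - 2 * pi * c)"
    by (simp add: c_def)
  finally have dev: "integral\<^sup>L circle (\<lambda>t. poisson z (cis t) * \<bar>u t - c\<bar>)
      \<le> 2 * exp (- c) * integral\<^sup>L circle (\<lambda>t. poisson z (cis t) * g t) - (2 * pi * c - 2 * pi * c)" .
  have "integral\<^sup>L circle (\<lambda>t. K t * complex_of_real (u t))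
      = integral\<^sup>L circle (\<lambda>t. K t * complex_of_real (u t - c) + K t * complex_of_real c)"
    by (simp add: algebra_simps)
  also have "\<dots> = integral\<^sup>L circle (\<lambda>t. K t * complex_of_real (u t - c))"
    using K0 integrable_circle_continuous[OF Kc]
    by (subst Bochner_Integration.integral_add[OF Kuc integrable_mult_left]) simp_all
  finally have "cmod (deriv (outer_of u) z) = exp c * (1 / (2 * pi) * cmod (integral\<^sup>L circle (\<lambda>t. K t * complex_of_real (u t - c))))"
    using DERIV_imp_deriv[OF has_field_derivative_outer_of[OF z]] O
    by (simp add: norm_mult norm_divide K_def)
  also have "\<dots> \<le> exp c * (1 / (2 * pi) * integral\<^sup>L circle (\<lambda>t. cmod (K t) * \<bar>u t - c\<bar>))"
    using integral_norm_bound[of circle "\<lambda>t. K t * complex_of_real (u t - c)"]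
    by (intro mult_left_mono) (auto simp: norm_mult simp flip: of_real_diff)
  finally have "(1 - (cmod z)\<^sup>2) * cmod (deriv (outer_of u) z)
      \<le> (1 - (cmod z)\<^sup>2) * (exp c * (1 / (2 * pi) * integral\<^sup>L circle (\<lambda>t. cmod (K t) * \<bar>u t - c\<bar>)))"
    by (rule mult_left_mono) (rule zz)
  also have "\<dots> = exp c * (1 / (2 * pi) * integral\<^sup>L circle (\<lambda>t. (1 - (cmod z)\<^sup>2) * cmod (K t) * \<bar>u t - c\<bar>))"
    by (simp add: mult.assoc)
  also have "(\<lambda>t. (1 - (cmod z)\<^sup>2) * cmod (K t) * \<bar>u t - c\<bar>) = (\<lambda>t. 2 * (poisson z (cis t) * \<bar>u t - c\<bar>))"
    unfolding nK by (simp add: mult.assoc)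
  also have "exp c * (1 / (2 * pi) * integral\<^sup>L circle (\<lambda>t. 2 * (poisson z (cis t) * \<bar>u t - c\<bar>)))
      = exp c * (1 / (2 * pi) * (2 * integral\<^sup>L circle (\<lambda>t. poisson z (cis t) * \<bar>u t - c\<bar>)))"
    by simp
  also have "\<dots> \<le> exp c * (1 / (2 * pi) * (2 * (2 * exp (- c) * integral\<^sup>L circle (\<lambda>t. poisson z (cis t) * g t) - (2 * pi * c - 2 * pi * c))))"
    by (intro mult_left_mono dev) auto
  also have "\<dots> = (exp c * exp (- c)) * 4 * (1 / (2 * pi) * integral\<^sup>L circle (\<lambda>t. poisson z (cis t) * g t))"
    by simp
  also have "exp c * exp (- c) = 1" by (simp flip: exp_add)
  finally show ?thesis by simp
qed

text \<open>The geometric mean is at most the arithmetic mean: the tangent to exp at the Poisson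
  mean c of u is integrated, and its linear term vanishes.\<close>

lemma norm_outer_of_le:
  assumes z: "cmod z < 1"
    and g: "integrable circle (\<lambda>t. poisson z (cis t) * g t)" "AE t in circle. exp (u t) \<le> g t"
  shows "cmod (outer_of u z) \<le> 1 / (2 * pi) * integral\<^sup>L circle (\<lambda>t. poisson z (cis t) * g t)"
proof -
  define c where "c = 1 / (2 * pi) * integral\<^sup>L circle (\<lambda>t. poisson z (cis t) * u t)"
  have O: "cmod (outer_of u z) = exp c" by (simp add: norm_outer_of[OF z] c_def)
  have Pu: "integrable circle (\<lambda>t. poisson z (cis t) * u t)"
    by (rule poisson_integrable_mult[OF z u])
  have Pc: "integrable circle (\<lambda>t. poisson z (cis t) * a)" for a
    by (rule poisson_integrable_mult[OF z]) (rule integrable_circle_continuous, simp)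
  have "2 * pi * exp c = integral\<^sup>L circle (\<lambda>t. exp c * (poisson z (cis t) * u t) + poisson z (cis t) * (exp c * (1 - c)))"
    using Pu Pc[of "exp c * (1 - c)"] Pc[of "1"]
    by (simp add: Bochner_Integration.integral_add lebesgue_integral_poisson[OF z])
       (simp add: c_def algebra_simps)
  also have "\<dots> \<le> integral\<^sup>L circle (\<lambda>t. poisson z (cis t) * g t)"
  proof (rule integral_mono_AE)
    show "integrable circle (\<lambda>t. exp c * (poisson z (cis t) * u t) + poisson z (cis t) * (exp c * (1 - c)))"
      by (intro Bochner_Integration.integrable_add integrable_mult_right Pu Pc)
    show "AE t in circle. exp c * (poisson z (cis t) * u t) + poisson z (cis t) * (exp c * (1 - c)) \<le> poisson z (cis t) * g t"
      using g(2)
    proof eventually_elim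
      case (elim t)
      have "exp c * (1 + (u t - c)) \<le> exp c * exp (u t - c)"
        by (intro mult_left_mono exp_ge_add_one_self) auto
      also have "\<dots> = exp (u t)" by (simp flip: exp_add)
      also have "\<dots> \<le> g t" by (rule elim)
      finally have "poisson z (cis t) * (exp c * (1 + (u t - c))) \<le> poisson z (cis t) * g t"
        by (intro mult_left_mono poisson_nonneg z)
      then show ?case by (simp add: algebra_simps)
    qed
  qed (rule g)
  finally show ?thesis by (simp add: O field_simps)
qed

end

subsection \<open>The outer part\<close>

lemma poisson_pos: "cmod z < 1 \<Longrightarrow> cmod w = 1 \<Longrightarrow> 0 < poisson z w"
  unfolding poisson_def
  by (intro divide_pos_pos zero_less_power) (auto simp: power_less_one_iff abs_square_less_1)

definition boundary_modulus :: "(complex \<Rightarrow> complex) \<Rightarrow> complex \<Rightarrow> real" where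
  "boundary_modulus f w = cmod (boundary_value f w)"

lemma boundary_modulus_nonneg: "0 \<le> boundary_modulus f w"
  by (simp add: boundary_modulus_def)

context
  fixes f :: "complex \<Rightarrow> complex"
  assumes f: "f holomorphic_on ball 0 1"
    and summ: "summable (\<lambda>j. integral {0..2 * pi} (radial_var f j))"
begin

lemma boundary_modulus_measurable [measurable]:
  "(\<lambda>t. boundary_modulus f (cis t)) \<in> borel_measurable circle"
  unfolding boundary_modulus_def using boundary_value_measurable[OF f summ] by measurable

lemma integrable_boundary_modulus: "integrable circle (\<lambda>t. boundary_modulus f (cis t))"
  using integrable_poisson_osc[OF f summ, of 0 0] by (simp add: boundary_modulus_def poisson_def)

text \<open>Fatou's lemma along the circles of radius \<open>whitney m\<close>.\<close>

lemma integrable_boundary_modulus_powr: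
  assumes p: "1 \<le> p" and B: "\<And>m. circle_integral p f (whitney m) \<le> B"
  shows "integrable circle (\<lambda>t. boundary_modulus f (cis t) powr p)"
proof (rule integrableI_bounded)
  let ?F = "\<lambda>m t. ennreal (cmod (f (polar (whitney m) t)) powr p)"
  have c: "continuous_on {0..2 * pi} (\<lambda>t. cmod (f (polar (whitney m) t)) powr p)" for m
    using p by (intro continuous_on_powr' continuous_intros continuous_on_dilated[OF f]) auto
  show "(\<lambda>t. boundary_modulus f (cis t) powr p) \<in> borel_measurable circle" by measurable
  have "(\<integral>\<^sup>+ t. ennreal (norm (boundary_modulus f (cis t) powr p)) \<partial>circle)
      = (\<integral>\<^sup>+ t. liminf (\<lambda>m. ?F m t) \<partial>circle)"
  proof (rule nn_integral_cong_AE)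
    show "AE t in circle. ennreal (norm (boundary_modulus f (cis t) powr p)) = liminf (\<lambda>m. ?F m t)"
      using AE_tendsto_boundary_value[OF f summ]
    proof eventually_elim
      case (elim t)
      have "(\<lambda>m. ?F m t) \<longlonglongrightarrow> ennreal (boundary_modulus f (cis t) powr p)"
        unfolding boundary_modulus_def using p elim
        by (intro tendsto_ennrealI tendsto_powr2 tendsto_norm tendsto_const) auto
      from lim_imp_Liminf[OF trivial_limit_sequentially this] show ?case by simp
    qed
  qed
  also have "\<dots> \<le> liminf (\<lambda>m. \<integral>\<^sup>+ t. ?F m t \<partial>circle)"
    by (intro nn_integral_liminf measurable_compose[OF borel_measurable_circle_continuous[OF c]]) simp
  also have "\<dots> \<le> ennreal B"
  proof -
    have "(\<integral>\<^sup>+ t. ?F m t \<partial>circle) = ennreal (circle_integral p f (whitney m))" for m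
      unfolding circle_integral_def
      by (subst nn_integral_eq_integral) (auto simp: lebesgue_integral_circle_continuous integrable_circle_continuous c)
    then have "(\<integral>\<^sup>+ t. ?F m t \<partial>circle) \<le> ennreal B" for m
      using B by (simp add: ennreal_leI)
    then have "limsup (\<lambda>m. \<integral>\<^sup>+ t. ?F m t \<partial>circle) \<le> ennreal B"
      by (intro Limsup_bounded) auto
    then show ?thesis by (meson Liminf_le_Limsup order.trans trivial_limit_sequentially)
  qed
  also have "\<dots> < \<infinity>" by simp
  finally show "(\<integral>\<^sup>+ t. ennreal (norm (boundary_modulus f (cis t) powr p)) \<partial>circle) < \<infinity>" .
qed

context
  fixes w :: complex
  assumes w: "cmod w < 1" "f w \<noteq> 0"
begin

text \<open>Jensen's inequality at w, where f is nonzero, bounds the Poisson integral of ln (\<phi>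
  + e) from below uniformly in e. Subtracted from \<phi> + 1 and multiplied by the kernel, these
  logarithms become nonnegative functions that increase as e decreases, so monotone convergence
  applies. Positivity requires its own argument, as ln 0 = 0.\<close>

lemma boundary_modulus_pos_and_ln_integrable:
  shows "AE t in circle. 0 < boundary_modulus f (cis t)"
    and "integrable circle (\<lambda>t. ln (boundary_modulus f (cis t)))"
proof -
  define \<phi> where "\<phi> = (\<lambda>t. boundary_modulus f (cis t))"
  define P where "P = (\<lambda>t. poisson w (cis t))"
  define e :: "nat \<Rightarrow> real" where "e = (\<lambda>n. 1 / Suc n)"
  define g where "g = (\<lambda>n t. P t * (\<phi> t + 1 - ln (\<phi> t + e n)))"
  have e: "0 < e n" "e n \<le> 1" "e (Suc n) \<le> e n" for n by (auto simp: e_def frac_le)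
  have P0: "0 < P t" for t unfolding P_def by (intro poisson_pos w) simp
  have \<phi>0: "0 \<le> \<phi> t" for t by (simp add: \<phi>_def boundary_modulus_nonneg)
  have \<phi>m [measurable]: "\<phi> \<in> borel_measurable circle" unfolding \<phi>_def by measurable
  have Pc: "continuous_on {0..2 * pi} P" unfolding P_def by (rule poisson_continuous[OF w(1)])
  have Pm [measurable]: "P \<in> borel_measurable circle" by (rule borel_measurable_circle_continuous[OF Pc])
  have \<phi>i: "integrable circle (\<lambda>t. \<phi> t + 1)"
    unfolding \<phi>_def by (intro Bochner_Integration.integrable_add integrable_boundary_modulus integrable_circle_continuous continuous_on_const)
  have P\<phi>i: "integrable circle (\<lambda>t. P t * (\<phi> t + 1))"
    by (rule integrable_circle_mult_continuous[OF \<phi>i Pc])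
  have lni: "integrable circle (\<lambda>t. P t * ln (\<phi> t + e n))" for n
    unfolding P_def \<phi>_def boundary_modulus_def by (rule ln_norm_le_boundary_poisson(2)[OF f summ w e(1)])
  have g0: "0 \<le> g n t" for n t
  proof -
    have "ln (\<phi> t + e n) \<le> \<phi> t + e n - 1" using \<phi>0[of t] e(1)[of n] by (intro ln_le_minus_one add_nonneg_pos)
    then show ?thesis unfolding g_def using e(2)[of n] P0[of t] by (intro mult_nonneg_nonneg) auto
  qed
  have gi: "integrable circle (g n)" for n
    using Bochner_Integration.integrable_diff[OF P\<phi>i lni[of n]] by (simp add: g_def right_diff_distrib)
  have g_mono: "g n t \<le> g (Suc n) t" for n t
    unfolding g_def using e(1)[of "Suc n"] e(3)[of n] \<phi>0[of t] P0[of t]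
    by (intro mult_left_mono diff_left_mono) (auto intro!: add_nonneg_pos)
  define B where "B = integral\<^sup>L circle (\<lambda>t. P t * (\<phi> t + 1)) - 2 * pi * ln (cmod (f w))"
  have gB: "integral\<^sup>L circle (g n) \<le> B" for n
  proof -
    have "ln (cmod (f w)) \<le> 1 / (2 * pi) * integral\<^sup>L circle (\<lambda>t. P t * ln (\<phi> t + e n))"
      unfolding P_def \<phi>_def boundary_modulus_def by (rule ln_norm_le_boundary_poisson(1)[OF f summ w e(1)])
    then have "2 * pi * ln (cmod (f w)) \<le> integral\<^sup>L circle (\<lambda>t. P t * ln (\<phi> t + e n))"
      by (simp add: field_simps)
    moreover have "integral\<^sup>L circle (g n) = integral\<^sup>L circle (\<lambda>t. P t * (\<phi> t + 1)) - integral\<^sup>L circle (\<lambda>t. P t * ln (\<phi> t + e n))"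
      unfolding Bochner_Integration.integral_diff[OF P\<phi>i lni, symmetric] by (simp add: g_def right_diff_distrib)
    ultimately show ?thesis by (simp add: B_def)
  qed
  have "(\<integral>\<^sup>+ t. (SUP n. ennreal (g n t)) \<partial>circle) = (SUP n. \<integral>\<^sup>+ t. ennreal (g n t) \<partial>circle)"
    using g_mono gi by (intro nn_integral_monotone_convergence_SUP) (auto simp: incseq_Suc_iff le_fun_def ennreal_leI)
  also have "\<dots> \<le> ennreal B"
    using gB by (intro SUP_least) (simp add: nn_integral_eq_integral gi g0 ennreal_leI)
  finally have fin: "(\<integral>\<^sup>+ t. (SUP n. ennreal (g n t)) \<partial>circle) < \<infinity>"
    by (simp add: le_less_trans)
  have "AE t in circle. (SUP n. ennreal (g n t)) \<noteq> \<infinity>"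
    using fin gi by (intro nn_integral_PInf_AE) auto
  then show pos: "AE t in circle. 0 < boundary_modulus f (cis t)"
  proof eventually_elim
    case (elim t)
    have "\<phi> t \<noteq> 0"
    proof
      assume z: "\<phi> t = 0"
      obtain c where c: "(SUP n. ennreal (g n t)) = ennreal c" "0 \<le> c"
        using elim by (cases "SUP n. ennreal (g n t)") auto
      have "g n t \<le> c" for n
      proof -
        have "ennreal (g n t) \<le> ennreal c" unfolding c(1)[symmetric] by (rule SUP_upper) simp
        then show ?thesis using c(2) by simp
      qed
      \<comment> \<open>At a zero of \<phi> these values grow like ln (n + 1), which the finite
        supremum excludes.\<close>
      moreover have "g n t = P t * (1 + ln (Suc n))" for n
        by (simp add: g_def z e_def ln_div)
      ultimately have "ln (Suc n) \<le> c / P t" for n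
        using P0[of t] by (simp add: pos_le_divide_eq algebra_simps) (smt (verit, best) mult.commute)
      moreover have "filterlim (\<lambda>n. ln (real (Suc n))) at_top sequentially"
        by real_asymp
      ultimately show False
        unfolding filterlim_at_top_dense eventually_sequentially by (meson leD order_refl)
    qed
    then show ?case using \<phi>0[of t] by (simp add: \<phi>_def)
  qed
  have "integrable circle (\<lambda>t. P t * (\<phi> t + 1 - ln (\<phi> t)))"
  proof (rule integrableI_bounded)
    show "(\<lambda>t. P t * (\<phi> t + 1 - ln (\<phi> t))) \<in> borel_measurable circle" by measurable
    have "(\<integral>\<^sup>+ t. ennreal (norm (P t * (\<phi> t + 1 - ln (\<phi> t)))) \<partial>circle)
        \<le> (\<integral>\<^sup>+ t. (SUP n. ennreal (g n t)) \<partial>circle)"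
    proof (rule nn_integral_mono_AE)
      show "AE t in circle. ennreal (norm (P t * (\<phi> t + 1 - ln (\<phi> t)))) \<le> (SUP n. ennreal (g n t))"
        using pos
      proof eventually_elim
        case (elim t)
        then have \<phi>p: "0 < \<phi> t" by (simp add: \<phi>_def)
        have "e \<longlonglongrightarrow> 0" unfolding e_def by (rule LIMSEQ_Suc[OF lim_1_over_n])
        then have "(\<lambda>n. g n t) \<longlonglongrightarrow> P t * (\<phi> t + 1 - ln (\<phi> t + 0))"
          unfolding g_def using \<phi>p by (intro tendsto_intros) auto
        then have lim: "(\<lambda>n. ennreal (g n t)) \<longlonglongrightarrow> ennreal (P t * (\<phi> t + 1 - ln (\<phi> t)))"
          by (intro tendsto_ennrealI) simp
        have "ln (\<phi> t) \<le> \<phi> t - 1" using \<phi>p by (rule ln_le_minus_one)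
        then have "0 \<le> P t * (\<phi> t + 1 - ln (\<phi> t))" using P0[of t] by (intro mult_nonneg_nonneg) auto
        moreover have "ennreal (P t * (\<phi> t + 1 - ln (\<phi> t))) \<le> (SUP n. ennreal (g n t))"
          by (rule LIMSEQ_le_const2[OF lim]) (intro exI allI impI SUP_upper UNIV_I)
        ultimately show ?case by simp
      qed
    qed
    then show "(\<integral>\<^sup>+ t. ennreal (norm (P t * (\<phi> t + 1 - ln (\<phi> t)))) \<partial>circle) < \<infinity>"
      using fin by (rule le_less_trans)
  qed
  from Bochner_Integration.integrable_diff[OF P\<phi>i this]
  have "integrable circle (\<lambda>t. P t * ln (\<phi> t))"
    by (simp add: algebra_simps)
  \<comment> \<open>The kernel is continuous and positive on the circle, so it can be divided
    out.\<close>
  moreover have "continuous_on {0..2 * pi} (\<lambda>t. 1 / P t)"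
    using P0 by (intro continuous_intros Pc) (metis order_less_irrefl)
  ultimately have "integrable circle (\<lambda>t. 1 / P t * (P t * ln (\<phi> t)))"
    by (rule integrable_circle_mult_continuous)
  moreover have "1 / P t * (P t * x) = x" for t x using P0[of t] by simp
  ultimately show "integrable circle (\<lambda>t. ln (boundary_modulus f (cis t)))"
    by (simp add: \<phi>_def)
qed

abbreviation "outer_part \<equiv> outer_of (\<lambda>t. ln (boundary_modulus f (cis t)))"

text \<open>Jensen's inequality at z with e tending to 0; because e <= 1, the function |ln \<phi>| +
  \<phi> + 1 times the kernel is a majorant.\<close>

lemma norm_le_outer_part:
  assumes z: "cmod z < 1"
  shows "cmod (f z) \<le> cmod (outer_part z)"
proof (cases "f z = 0")
  case False
  define \<phi> where "\<phi> = (\<lambda>t. boundary_modulus f (cis t))"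
  define P where "P = (\<lambda>t. poisson z (cis t))"
  define e :: "nat \<Rightarrow> real" where "e = (\<lambda>n. 1 / Suc n)"
  have e: "0 < e n" "e n \<le> 1" for n by (auto simp: e_def)
  have P0: "0 < P t" for t unfolding P_def by (intro poisson_pos z) simp
  have Pc: "continuous_on {0..2 * pi} P" unfolding P_def by (rule poisson_continuous[OF z])
  have [measurable]: "P \<in> borel_measurable circle" by (rule borel_measurable_circle_continuous[OF Pc])
  have [measurable]: "\<phi> \<in> borel_measurable circle" unfolding \<phi>_def by measurable
  have lni: "integrable circle (\<lambda>t. ln (\<phi> t))"
    unfolding \<phi>_def by (rule boundary_modulus_pos_and_ln_integrable)
  have lim: "(\<lambda>n. integral\<^sup>L circle (\<lambda>t. P t * ln (\<phi> t + e n))) \<longlonglongrightarrow> integral\<^sup>L circle (\<lambda>t. P t * ln (\<phi> t))"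
  proof (rule integral_dominated_convergence[where w = "\<lambda>t. P t * (\<bar>ln (\<phi> t)\<bar> + (\<phi> t + 1))"])
    show "integrable circle (\<lambda>t. P t * (\<bar>ln (\<phi> t)\<bar> + (\<phi> t + 1)))"
      by (rule integrable_circle_mult_continuous[OF _ Pc])
         (use lni integrable_boundary_modulus in \<open>auto simp: \<phi>_def intro!: integrable_circle_continuous\<close>)
    show "AE t in circle. (\<lambda>n. P t * ln (\<phi> t + e n)) \<longlonglongrightarrow> P t * ln (\<phi> t)"
      using boundary_modulus_pos_and_ln_integrable(1)
    proof eventually_elim
      case (elim t)
      have "e \<longlonglongrightarrow> 0" unfolding e_def by (rule LIMSEQ_Suc[OF lim_1_over_n])
      then have "(\<lambda>n. P t * ln (\<phi> t + e n)) \<longlonglongrightarrow> P t * ln (\<phi> t + 0)"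
        using elim by (intro tendsto_intros) (auto simp: \<phi>_def)
      then show ?case by simp
    qed
    show "AE t in circle. norm (P t * ln (\<phi> t + e n)) \<le> P t * (\<bar>ln (\<phi> t)\<bar> + (\<phi> t + 1))" for n
      using boundary_modulus_pos_and_ln_integrable(1)
    proof eventually_elim
      case (elim t)
      then have \<phi>p: "0 < \<phi> t" by (simp add: \<phi>_def)
      have "ln (\<phi> t + e n) \<le> \<phi> t + e n - 1" using \<phi>p e(1)[of n] by (intro ln_le_minus_one) auto
      moreover have "ln (\<phi> t) \<le> ln (\<phi> t + e n)" using \<phi>p e(1)[of n] by simp
      ultimately have "\<bar>ln (\<phi> t + e n)\<bar> \<le> \<bar>ln (\<phi> t)\<bar> + (\<phi> t + 1)"
        using e(2)[of n] \<phi>p abs_ge_minus_self[of "ln (\<phi> t)"] abs_ge_zero[of "ln (\<phi> t)"]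
        by (intro abs_leI) linarith+
      then show ?case using P0[of t] by (simp add: abs_mult mult_left_mono)
    qed
  qed measurable
  have "2 * pi * ln (cmod (f z)) \<le> integral\<^sup>L circle (\<lambda>t. P t * ln (\<phi> t))"
  proof (rule LIMSEQ_le_const[OF lim])
    have "2 * pi * ln (cmod (f z)) \<le> integral\<^sup>L circle (\<lambda>t. P t * ln (\<phi> t + e n))" for n
      using ln_norm_le_boundary_poisson(1)[OF f summ z False e(1)[of n]]
      by (simp add: P_def \<phi>_def boundary_modulus_def field_simps)
    then show "\<exists>N. \<forall>n\<ge>N. 2 * pi * ln (cmod (f z)) \<le> integral\<^sup>L circle (\<lambda>t. P t * ln (\<phi> t + e n))"
      by blast
  qed
  then have "ln (cmod (f z)) \<le> 1 / (2 * pi) * integral\<^sup>L circle (\<lambda>t. P t * ln (\<phi> t))"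
    by (simp add: field_simps)
  then have "exp (ln (cmod (f z))) \<le> exp (1 / (2 * pi) * integral\<^sup>L circle (\<lambda>t. P t * ln (\<phi> t)))"
    by (simp only: exp_le_cancel_iff)
  then show ?thesis
    using False norm_outer_of[OF boundary_modulus_pos_and_ln_integrable(2) z]
    by (simp add: P_def \<phi>_def)
qed simp

lemma norm_outer_part_le:
  assumes z: "cmod z < 1"
  shows "cmod (outer_part z) \<le> cmod (f z) + boundary_osc f z"
proof -
  let ?g = "\<lambda>t. cmod (boundary_value f (cis t) - f z) + cmod (f z)"
  have Pc: "integrable circle (\<lambda>t. poisson z (cis t) * cmod (f z))"
    by (rule integrable_circle_mult_continuous[OF _ poisson_continuous[OF z]])
       (rule integrable_circle_continuous, simp)
  have "cmod (outer_part z) \<le> 1 / (2 * pi) * integral\<^sup>L circle (\<lambda>t. poisson z (cis t) * ?g t)"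
  proof (rule norm_outer_of_le[OF boundary_modulus_pos_and_ln_integrable(2) z])
    show "integrable circle (\<lambda>t. poisson z (cis t) * ?g t)"
      unfolding distrib_left by (intro Bochner_Integration.integrable_add integrable_poisson_osc[OF f summ z] Pc)
    show "AE t in circle. exp (ln (boundary_modulus f (cis t))) \<le> ?g t"
      using boundary_modulus_pos_and_ln_integrable(1)
    proof eventually_elim
      case (elim t)
      then show ?case
        using norm_triangle_ineq2[of "boundary_value f (cis t)" "f z"]
        by (simp add: boundary_modulus_def)
    qed
  qed
  also have "\<dots> = boundary_osc f z + cmod (f z)"
    unfolding distrib_left
      Bochner_Integration.integral_add[OF integrable_poisson_osc[OF f summ z] Pc]
      integral_mult_left_zero lebesgue_integral_poisson[OF z]
    by (simp add: boundary_osc_def)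
  finally show ?thesis by simp
qed

lemma norm_deriv_outer_part_le:
  assumes z: "cmod z < 1"
  shows "(1 - cmod z) * cmod (deriv outer_part z) \<le> 4 * boundary_osc f z"
proof -
  have "(1 - (cmod z)\<^sup>2) * cmod (deriv outer_part z)
      \<le> 4 * (1 / (2 * pi) * integral\<^sup>L circle (\<lambda>t. poisson z (cis t) * cmod (boundary_value f (cis t) - f z)))"
  proof (rule norm_deriv_outer_of_le[OF boundary_modulus_pos_and_ln_integrable(2) z integrable_poisson_osc[OF f summ z]])
    \<comment> \<open>With b the boundary value, |f z| <= |O(z)| gives |b| - |O(z)| <= |b| - |f z|
      <= |b - f z|. Thus the majorant g of the general derivative estimate is the integrand of
      \<open>boundary_osc\<close>.\<close>
    show "AE t in circle. 0 \<le> cmod (boundary_value f (cis t) - f z) \<and>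
        exp (ln (boundary_modulus f (cis t))) - cmod (outer_part z) \<le> cmod (boundary_value f (cis t) - f z)"
      using boundary_modulus_pos_and_ln_integrable(1)
    proof eventually_elim
      case (elim t)
      then show ?case
        using norm_triangle_ineq2[of "boundary_value f (cis t)" "f z"] norm_le_outer_part[OF z]
        by (simp add: boundary_modulus_def)
    qed
  qed
  moreover have "(1 - cmod z) * cmod (deriv outer_part z) \<le> (1 - (cmod z)\<^sup>2) * cmod (deriv outer_part z)"
    using z by (intro mult_right_mono) (auto simp: power2_eq_square mult_left_le_one_le)
  ultimately show ?thesis by (simp add: boundary_osc_def)
qed

end

end

subsection \<open>Boundary oscillation on Whitney cells\<close>

text \<open>Either x <= a, or x / a >= 1 is at most its p-th power. With a chosen level by level
  this converts L^p bounds into L^1 bounds.\<close>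

lemma le_add_powr_div:
  fixes a x p :: real
  assumes "1 \<le> p" "0 < a" "0 \<le> x"
  shows "x \<le> a + a * (x powr p / a powr p)"
proof (cases "x \<le> a")
  case True
  have "0 \<le> a * (x powr p / a powr p)" using assms by simp
  then show ?thesis using True by linarith
next
  case False
  then have "1 \<le> x / a" using assms by simp
  then have "x / a \<le> (x / a) powr p"
    using powr_mono[OF assms(1), of "x / a"] assms by simp
  then have "a * (x / a) \<le> a * (x powr p / a powr p)"
    using assms by (intro mult_left_mono) (auto simp: powr_divide)
  then show ?thesis using assms by simp
qed

lemma norm_cis_diff_le: "cmod (cis a - cis b) \<le> \<bar>a - b\<bar>"
proof -
  have "cis a - cis b = cis a * (1 - polar 1 (b - a))"
    by (simp add: right_diff_distrib cis_mult)
  then have "cmod (cis a - cis b) = cmod (1 - polar 1 (b - a))"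
    by (simp only: norm_mult norm_cis mult_1_left)
  then have "(cmod (cis a - cis b))\<^sup>2 = 4 * (sin ((b - a) / 2))\<^sup>2"
    using cmod_1_minus_cis[of 1 "b - a"] by simp
  also have "\<dots> \<le> 4 * ((b - a) / 2)\<^sup>2"
    using abs_sin_x_le_abs_x[of "(b - a) / 2"] by (simp only: abs_le_square_iff)
  also have "\<dots> = \<bar>a - b\<bar>\<^sup>2" by (simp add: power2_eq_square field_simps)
  finally show ?thesis by (rule power2_le_imp_le) simp
qed

lemma norm_polar_diff_le:
  assumes "0 \<le> r" "r \<le> 1"
  shows "cmod (polar s a - polar r b) \<le> \<bar>s - r\<bar> + \<bar>a - b\<bar>"
proof -
  have "polar s a - polar r b
      = polar (s - r) a + complex_of_real r * (cis a - cis b)"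
    by (simp add: algebra_simps)
  then have "cmod (polar s a - polar r b) \<le> \<bar>s - r\<bar> + r * cmod (cis a - cis b)"
    using norm_triangle_ineq[of "polar (s - r) a" "complex_of_real r * (cis a - cis b)"] assms
    by (simp add: norm_mult del: of_real_diff)
  also have "r * cmod (cis a - cis b) \<le> 1 * \<bar>a - b\<bar>"
    using assms by (intro mult_mono norm_cis_diff_le) auto
  finally show ?thesis by simp
qed

text \<open>\<open>growth\<close> from level 0 forces the integrals of the p-th powers of the radial
  variation to decay like q^j. The bound x <= a + a (x / a)^p at a = \<eta>^j, where \<eta>^p = q,
  then makes the plain integrals O(\<eta>^j).\<close>

lemma summable_integral_radial_var:
  assumes f: "f holomorphic_on ball 0 1" and p: "1 \<le> p"
    and v: "\<And>k. 0 < v k" and q: "0 < q" "q < 1"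
    and growth: "\<And>i k. i \<le> k \<Longrightarrow> (2 ^ i) powr p * v i \<le> C * q ^ (k - i) * ((2 ^ k) powr p * v k)"
    and sum: "\<And>n. (\<Sum>k<n. v k * circle_integral p (deriv f) (whitney k)) \<le> C"
  shows "summable (\<lambda>j. integral {0..2 * pi} (radial_var f j))"
proof -
  define \<eta> where "\<eta> = q powr (1 / p)"
  have \<eta>: "0 < \<eta>" "\<eta> < 1" "\<eta> powr p = q"
    unfolding \<eta>_def using q p powr_less_mono2[of "1 / p" q 1] by (auto simp: powr_powr)
  define E where "E = (\<lambda>k. circle_integral p (deriv f) (whitney k))"
  have E0: "0 \<le> E k" for k by (simp add: E_def circle_integral_nonneg)
  have vE: "v k * E k \<le> C" for k
  proof -
    have "v k * E k \<le> (\<Sum>i<Suc k. v i * E i)"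
      using v E0 by (intro member_le_sum mult_nonneg_nonneg) (auto simp: less_imp_le)
    then show ?thesis using sum[of "Suc k"] by (simp add: E_def)
  qed
  have C0: "0 \<le> C" using order.trans[OF mult_nonneg_nonneg vE, of 0] v[of 0] E0[of 0] by simp
  define D where "D = (\<lambda>j. integral {0..2 * pi} (\<lambda>\<theta>. radial_var f j \<theta> powr p))"
  have cp: "continuous_on {0..2 * pi} (\<lambda>\<theta>. radial_var f j \<theta> powr p)" for j
    using p by (intro continuous_on_powr' radial_var_continuous[OF f] continuous_intros)
      (auto simp: radial_var_nonneg[OF f])
  have D0: "0 \<le> D j" for j
    unfolding D_def by (intro integral_nonneg integrable_continuous_interval cp) auto
  have D_le: "v 0 * D j \<le> C * C * q ^ Suc j" for j
  proof -
    let ?w = "((2::real) ^ Suc j) powr p"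
    have "v 0 * D j \<le> (C * q ^ Suc j * (?w * v (Suc j))) * D j"
      using growth[of 0 "Suc j"] D0 by (intro mult_right_mono) auto
    also have "\<dots> \<le> (C * q ^ Suc j * (?w * v (Suc j))) * ((1 / 2 ^ Suc j) powr p * E (Suc j))"
      unfolding D_def E_def using C0 q v
      by (intro mult_left_mono integral_radial_var_powr_le f p mult_nonneg_nonneg) (auto simp: less_imp_le)
    also have "\<dots> = C * q ^ Suc j * ((?w * (1 / 2 ^ Suc j) powr p) * (v (Suc j) * E (Suc j)))"
      by (simp only: mult_ac)
    also have "?w * (1 / 2 ^ Suc j) powr p = 1"
      by (subst powr_mult[symmetric]) auto
    also have "C * q ^ Suc j * (1 * (v (Suc j) * E (Suc j))) \<le> C * q ^ Suc j * (1 * C)"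
      using vE C0 q by (intro mult_left_mono) auto
    finally show ?thesis by (simp add: mult_ac)
  qed
  have "integral {0..2 * pi} (radial_var f j) \<le> (2 * pi + C * C * q / v 0) * \<eta> ^ j" for j
  proof -
    have "integral {0..2 * pi} (radial_var f j) \<le> integral {0..2 * pi} (\<lambda>\<theta>. \<eta> ^ j + \<eta> ^ j / q ^ j * radial_var f j \<theta> powr p)"
    proof (rule integral_le)
      show "radial_var f j integrable_on {0..2 * pi}"
        by (intro integrable_continuous_interval radial_var_continuous[OF f])
      show "(\<lambda>\<theta>. \<eta> ^ j + \<eta> ^ j / q ^ j * radial_var f j \<theta> powr p) integrable_on {0..2 * pi}"
        by (intro integrable_continuous_interval continuous_on_add continuous_on_mult continuous_on_const cp)
      show "radial_var f j \<theta> \<le> \<eta> ^ j + \<eta> ^ j / q ^ j * radial_var f j \<theta> powr p" for \<theta>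
        using le_add_powr_div[OF p, of "\<eta> ^ j" "radial_var f j \<theta>"] \<eta>(1,3) radial_var_nonneg[OF f, of j \<theta>]
        by (simp add: power_powr_swap)
    qed
    also have "\<dots> = 2 * pi * \<eta> ^ j + \<eta> ^ j / q ^ j * D j"
      unfolding D_def
      by (subst Henstock_Kurzweil_Integration.integral_add[OF _
            integrable_continuous_interval[OF continuous_on_mult[OF continuous_on_const cp]]]) auto
    also have "\<dots> \<le> 2 * pi * \<eta> ^ j + \<eta> ^ j / q ^ j * (C * C * q ^ Suc j / v 0)"
      using D_le[of j] v[of 0] \<eta> q by (intro add_left_mono mult_left_mono) (auto simp: pos_le_divide_eq mult.commute)
    also have "\<dots> = (2 * pi + C * C * q / v 0) * \<eta> ^ j"
      unfolding distrib_right using q by (simp add: mult_ac)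
    finally show ?thesis .
  qed
  moreover have "0 \<le> integral {0..2 * pi} (radial_var f j)" for j
    by (intro integral_nonneg integrable_continuous_interval radial_var_continuous[OF f] radial_var_nonneg[OF f])
  ultimately have "norm (integral {0..2 * pi} (radial_var f j)) \<le> (2 * pi + C * C * q / v 0) * \<eta> ^ j" for j
    by simp
  then have dom: "\<exists>N. \<forall>j\<ge>N. norm (integral {0..2 * pi} (radial_var f j)) \<le> (2 * pi + C * C * q / v 0) * \<eta> ^ j"
    by blast
  show ?thesis
    by (rule summable_comparison_test[OF dom], rule summable_mult, rule summable_geometric) (use \<eta> in simp)
qed

context
  fixes f :: "complex \<Rightarrow> complex"
  assumes f: "f holomorphic_on ball 0 1"
    and summ: "summable (\<lambda>j. integral {0..2 * pi} (radial_var f j))"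
begin

lemma continuous_on_boundary_osc_circle:
  assumes "0 \<le> r" "r < 1" shows "continuous_on S (\<lambda>t. boundary_osc f (polar r t))"
  by (rule continuous_on_compose2[OF continuous_on_boundary_osc[OF f summ assms(2)]])
     (use assms in \<open>auto intro!: continuous_intros simp: norm_mult\<close>)

lemma continuous_on_boundary_osc_powr:
  assumes p: "1 \<le> p" and "0 \<le> r" "r < 1" shows "continuous_on S (\<lambda>t. boundary_osc f (polar r t) powr p)"
  using assms by (intro continuous_on_powr' continuous_on_boundary_osc_circle continuous_on_const)
    (auto simp: boundary_osc_nonneg[OF f summ] norm_mult)

text \<open>The limit m to infinity is taken one partial sum at a time: its n circles lie in one
  smaller disc, where the convergence is uniform.\<close>

lemma sum_weighted_boundary_osc_le:
  assumes p: "1 \<le> p" and v0: "\<And>k. 0 \<le> v k"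
    and bound: "\<And>n m. n \<le> m \<Longrightarrow> (\<Sum>k<n. (2 ^ k) powr p * v k *
        circle_integral p (oscillation f m) (whitney k)) \<le> B"
  shows "(\<Sum>k<n. (2 ^ k) powr p * v k * circle_integral p (boundary_osc f) (whitney k))
    \<le> 2 powr (p - 1) * (B + 1)"
proof -
  define S where "S = (\<Sum>k<n. (2 ^ k) powr p * v k * (2 * pi))"
  have S0: "0 \<le> S" unfolding S_def using v0 by (intro sum_nonneg) auto
  \<comment> \<open>Small against the total weight S of the n circles, so that closeness within e
    adds at most 1 before the factor 2^(p-1); and e <= 1 gives e^p <= e.\<close>
  define e where "e = 1 / (1 + S)"
  have e: "0 < e" "e \<le> 1" "S * e \<le> 1" using S0 by (auto simp: e_def field_simps)
  have "\<forall>\<^sub>F m in sequentially. \<forall>z\<in>cball 0 (whitney n). dist (oscillation f m z) (boundary_osc f z) < e"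
    using uniform_limitD[OF uniform_limit_oscillation[OF f summ whitney_less_1] e(1)] .
  then have "\<forall>\<^sub>F m in sequentially. n \<le> m \<and> (\<forall>z\<in>cball 0 (whitney n). dist (oscillation f m z) (boundary_osc f z) < e)"
    by (intro eventually_conj eventually_ge_at_top)
  then obtain m where m: "n \<le> m" "\<And>z. cmod z \<le> whitney n \<Longrightarrow> \<bar>oscillation f m z - boundary_osc f z\<bar> < e"
    by (auto simp: eventually_sequentially dist_real_def)
  have le: "circle_integral p (boundary_osc f) (whitney k)
      \<le> 2 powr (p - 1) * (circle_integral p (oscillation f m) (whitney k) + 2 * pi * e)" if "k < n" for k
  proof -
    have w: "cmod (polar (whitney k) t) < 1" for t by (simp add: norm_mult)
    have oc: "continuous_on {0..2 * pi} (\<lambda>t. oscillation f m (polar (whitney k) t) powr p)"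
      using p oscillation_nonneg[OF f w]
      by (intro continuous_on_powr' continuous_on_oscillation[OF f] continuous_intros) (auto simp: w)
    have "circle_integral p (boundary_osc f) (whitney k)
        \<le> integral {0..2 * pi} (\<lambda>t. 2 powr (p - 1) * (oscillation f m (polar (whitney k) t) powr p + e))"
      unfolding circle_integral_def
    proof (rule integral_le)
      show "(\<lambda>t. norm (boundary_osc f (polar (whitney k) t)) powr p) integrable_on {0..2 * pi}"
        using boundary_osc_nonneg[OF f summ w]
        by (simp, intro integrable_continuous_interval continuous_on_boundary_osc_powr p) auto
      show "(\<lambda>t. 2 powr (p - 1) * (oscillation f m (polar (whitney k) t) powr p + e)) integrable_on {0..2 * pi}"
        by (intro integrable_continuous_interval continuous_on_mult continuous_on_add continuous_on_const oc)
      fix t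
      let ?z = "polar (whitney k) t"
      have "cmod ?z \<le> whitney n" using whitney_mono[of k n] that by (simp add: norm_mult)
      then have "boundary_osc f ?z \<le> oscillation f m ?z + e" using m(2)[of ?z] by linarith
      then have "boundary_osc f ?z powr p \<le> (oscillation f m ?z + e) powr p"
        using p boundary_osc_nonneg[OF f summ w] by (intro powr_mono2) auto
      also have "\<dots> \<le> 2 powr (p - 1) * (oscillation f m ?z powr p + e powr p)"
        using oscillation_nonneg[OF f w] e by (intro add_powr_le p) auto
      also have "e powr p \<le> e powr 1" using e p by (intro powr_mono') auto
      also have "e powr 1 = e" using e by simp
      finally show "norm (boundary_osc f ?z) powr p \<le> 2 powr (p - 1) * (oscillation f m ?z powr p + e)"
        using boundary_osc_nonneg[OF f summ w[of t]] by simp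
    qed
    also have "\<dots> = 2 powr (p - 1) * (integral {0..2 * pi} (\<lambda>t. oscillation f m (polar (whitney k) t) powr p) + 2 * pi * e)"
      by (subst Henstock_Kurzweil_Integration.integral_mult_right, subst Henstock_Kurzweil_Integration.integral_add)
         (auto intro!: integrable_continuous_interval oc)
    also have "integral {0..2 * pi} (\<lambda>t. oscillation f m (polar (whitney k) t) powr p)
        = circle_integral p (oscillation f m) (whitney k)"
      using oscillation_nonneg[OF f w] by (simp add: circle_integral_def)
    finally show ?thesis .
  qed
  have "(\<Sum>k<n. (2 ^ k) powr p * v k * circle_integral p (boundary_osc f) (whitney k))
      \<le> (\<Sum>k<n. (2 ^ k) powr p * v k * (2 powr (p - 1) * (circle_integral p (oscillation f m) (whitney k) + 2 * pi * e)))"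
    using v0 by (intro sum_mono mult_left_mono le) auto
  also have "\<dots> = 2 powr (p - 1) * ((\<Sum>k<n. (2 ^ k) powr p * v k * circle_integral p (oscillation f m) (whitney k)) + S * e)"
    unfolding S_def by (simp add: sum_distrib_left sum_distrib_right sum.distrib distrib_left mult_ac)
  also have "\<dots> \<le> 2 powr (p - 1) * (B + 1)"
    using bound[OF m(1)] e by (intro mult_left_mono add_mono) auto
  finally show ?thesis .
qed

text \<open>The two points are at most (1 + 4 pi) 2^-(k+1) <= 16 (1 - s) apart, so Harnack's
  inequality with M = 16 gives the constant 2 * 17^2 = 578.\<close>

lemma boundary_osc_whitney_le:
  assumes s: "whitney k \<le> s" "s \<le> whitney (Suc k)" and ab: "\<bar>a - b\<bar> \<le> 2 * pi / 2 ^ k"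
  shows "boundary_osc f (polar s a) \<le> 578 * boundary_osc f (polar (whitney k) b)"
proof -
  have s0: "0 \<le> s" "s < 1" using s by (auto dest: whitney_range)
  have s1: "1 / 2 ^ Suc k \<le> 1 - s" using s one_minus_whitney[of "Suc k"] by linarith
  have "cmod (polar s a - polar (whitney k) b) \<le> \<bar>s - whitney k\<bar> + \<bar>a - b\<bar>"
    by (rule norm_polar_diff_le) (auto simp: less_imp_le)
  also have "\<dots> \<le> 1 / 2 ^ Suc k + 2 * pi / 2 ^ k"
    using s ab whitney_diff[of k] by (intro add_mono) auto
  also have "\<dots> = (1 + 4 * pi) * (1 / 2 ^ Suc k)" by (simp add: field_simps)
  also have "\<dots> \<le> 16 * (1 - s)"
    using s1 pi_less_4 pi_approx by (intro mult_mono) auto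
  finally have "cmod (polar s a - polar (whitney k) b) \<le> 16 * (1 - cmod (polar s a))"
    using s0 by (simp add: norm_mult)
  then have "boundary_osc f (polar s a) \<le> 2 * (1 + 16)\<^sup>2 * boundary_osc f (polar (whitney k) b)"
    using s s0 by (intro boundary_osc_harnack[OF f summ]) (auto simp: norm_mult)
  then show ?thesis by simp
qed

end

section \<open>Separated sequences and Whitney cells\<close>

lemma sum_integral_arcs:
  fixes h :: "real \<Rightarrow> real" and j N :: nat
  assumes h: "continuous_on {0..2 * pi} h" and N: "0 < N" and "j \<le> N"
  shows "(\<Sum>b<j. integral {2 * pi * b / N..2 * pi * (Suc b) / N} h) = integral {0..2 * pi * j / N} h"
  using \<open>j \<le> N\<close>
proof (induction j)
  case (Suc j)
  have le: "2 * pi * Suc j / N \<le> 2 * pi"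
    using Suc.prems N by (simp add: divide_le_eq)
  have "integral {0..2 * pi * j / N} h + integral {2 * pi * j / N..2 * pi * (Suc j) / N} h = integral {0..2 * pi * (Suc j) / N} h"
  proof (rule Henstock_Kurzweil_Integration.integral_combine)
    show "2 * pi * j / N \<le> 2 * pi * Suc j / N" by (intro divide_right_mono mult_left_mono) auto
    show "h integrable_on {0..2 * pi * Suc j / N}"
      by (intro integrable_continuous_interval continuous_on_subset[OF h]) (use le in auto)
  qed auto
  then show ?case using Suc by simp
qed simp

text \<open>The annulus \<open>whitney k \<le> r < whitney (Suc k)\<close> is divided into \<open>L\<close> concentric annuli and
  \<open>2 ^ k * L\<close> sectors, so that each cell contains at most one point of the separated sequence.\<close>

lemma separated_cells:
  assumes sep: "separated_seq J z"
  obtains L :: nat where "0 < L"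
    "\<And>k. inj_on (\<lambda>n. (nat \<lfloor>(cmod (z n) - whitney k) * (2 ^ Suc k * L)\<rfloor>, nat \<lfloor>Arg2pi (z n) / (2 * pi) * (2 ^ k * L)\<rfloor>))
       {n \<in> J. whitney k \<le> cmod (z n) \<and> cmod (z n) < whitney (Suc k)}"
proof -
  obtain \<delta> where \<delta>: "0 < \<delta>" "\<And>n k. n \<in> J \<Longrightarrow> k \<in> J \<Longrightarrow> n \<noteq> k \<Longrightarrow> \<delta> < pseudo_hyperbolic_dist (z n) (z k)"
    using sep by (auto simp: separated_seq_def)
  \<comment> \<open>Two points of one cell are at most (1 + 4 pi) / L times 2^-(k+1) apart, and 1 +
    4 pi < 16. The denominator of the pseudo-hyperbolic distance is at least 2^-(k+1) in the
    annulus, so this L brings the distance below \<delta>.\<close>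
  obtain L :: nat where L: "16 / \<delta> < L" using reals_Archimedean2 by blast
  have L0: "0 < L" using L \<delta>(1) by (metis divide_pos_pos gr0I of_nat_0 order_less_asym zero_less_numeral)
  have floor_close: "\<bar>x - y\<bar> \<le> 1" if "nat \<lfloor>x\<rfloor> = nat \<lfloor>y\<rfloor>" "0 \<le> x" "0 \<le> y" for x y :: real
  proof -
    have "\<lfloor>x\<rfloor> = \<lfloor>y\<rfloor>" using that by (simp add: nat_eq_iff)
    then show ?thesis by linarith
  qed
  show ?thesis
  proof (rule that[OF L0], rule inj_onI, rule ccontr)
    fix k n m
    assume n: "n \<in> {n \<in> J. whitney k \<le> cmod (z n) \<and> cmod (z n) < whitney (Suc k)}"
      and m: "m \<in> {n \<in> J. whitney k \<le> cmod (z n) \<and> cmod (z n) < whitney (Suc k)}"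
      and eq: "(nat \<lfloor>(cmod (z n) - whitney k) * (2 ^ Suc k * L)\<rfloor>, nat \<lfloor>Arg2pi (z n) / (2 * pi) * (2 ^ k * L)\<rfloor>)
        = (nat \<lfloor>(cmod (z m) - whitney k) * (2 ^ Suc k * L)\<rfloor>, nat \<lfloor>Arg2pi (z m) / (2 * pi) * (2 ^ k * L)\<rfloor>)"
      and "n \<noteq> m"
    have r: "\<bar>cmod (z n) - cmod (z m)\<bar> * (2 ^ Suc k * L) \<le> 1"
    proof -
      have "\<bar>(cmod (z n) - whitney k) * (2 ^ Suc k * L) - (cmod (z m) - whitney k) * (2 ^ Suc k * L)\<bar> \<le> 1"
        using n m eq by (intro floor_close mult_nonneg_nonneg) auto
      moreover have "(cmod (z n) - whitney k) * (2 ^ Suc k * L) - (cmod (z m) - whitney k) * (2 ^ Suc k * L)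
          = (cmod (z n) - cmod (z m)) * (2 ^ Suc k * L)"
        by (simp add: left_diff_distrib)
      ultimately show ?thesis by (simp add: abs_mult)
    qed
    have a: "\<bar>Arg2pi (z n) - Arg2pi (z m)\<bar> / (2 * pi) * (2 ^ k * L) \<le> 1"
    proof -
      have "\<bar>Arg2pi (z n) / (2 * pi) * (2 ^ k * L) - Arg2pi (z m) / (2 * pi) * (2 ^ k * L)\<bar> \<le> 1"
        using eq Arg2pi_ge_0 by (intro floor_close mult_nonneg_nonneg divide_nonneg_nonneg) auto
      moreover have "Arg2pi (z n) / (2 * pi) * (2 ^ k * L) - Arg2pi (z m) / (2 * pi) * (2 ^ k * L)
          = (Arg2pi (z n) - Arg2pi (z m)) / (2 * pi) * (2 ^ k * L)"
        by (simp add: left_diff_distrib diff_divide_distrib)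
      ultimately show ?thesis by (simp add: abs_mult)
    qed
    have polar: "z n = polar (cmod (z n)) (Arg2pi (z n))" for n
      using Arg2pi[of "z n"] by (simp add: cis_conv_exp is_Arg_def)
    have zn: "cmod (z n) < 1" "cmod (z m) < 1" using n m by (auto dest: whitney_range)
    have "cmod (z n - z m) \<le> \<bar>cmod (z n) - cmod (z m)\<bar> + \<bar>Arg2pi (z n) - Arg2pi (z m)\<bar>"
      using norm_polar_diff_le[of "cmod (z m)" "cmod (z n)" "Arg2pi (z n)" "Arg2pi (z m)"] zn
      by (simp flip: polar)
    also have "\<dots> \<le> 1 / (2 ^ Suc k * L) + 2 * pi / (2 ^ k * L)"
      using r a L0 by (intro add_mono) (auto simp: pos_le_divide_eq pos_divide_le_eq mult_ac)
    also have "\<dots> = (1 + 4 * pi) / L * (1 / 2 ^ Suc k)" using L0 by (simp add: field_simps)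
    also have "\<dots> < 16 / L * (1 / 2 ^ Suc k)"
      using L0 pi_approx by (intro mult_strict_right_mono divide_strict_right_mono) auto
    also have "\<dots> \<le> \<delta> * (1 / 2 ^ Suc k)"
      using L L0 \<delta> by (intro mult_right_mono) (auto simp: pos_divide_le_eq pos_divide_less_eq mult.commute)
    also have "\<dots> \<le> \<delta> * cmod (1 - cnj (z n) * z m)"
    proof (intro mult_left_mono)
      have "1 / 2 ^ Suc k \<le> 1 - cmod (z n)"
        using n one_minus_whitney[of "Suc k"] by simp
      also have "\<dots> \<le> 1 - cmod (cnj (z n) * z m)"
        using zn mult_left_mono[of "cmod (z m)" 1 "cmod (z n)"] by (simp add: norm_mult)
      also have "\<dots> \<le> cmod (1 - cnj (z n) * z m)"
        using norm_triangle_ineq2[of 1 "cnj (z n) * z m"] by simp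
      finally show "1 / 2 ^ Suc k \<le> cmod (1 - cnj (z n) * z m)" .
    qed (use \<delta> in auto)
    finally have lt: "cmod (z n - z m) < \<delta> * cmod (1 - cnj (z n) * z m)" .
    then have "0 < cmod (1 - cnj (z n) * z m)"
      using \<delta>(1) by (metis mult_eq_0_iff norm_ge_zero not_less order_le_less)
    with lt have "pseudo_hyperbolic_dist (z n) (z m) < \<delta>"
      unfolding pseudo_hyperbolic_dist_def norm_divide by (simp add: pos_divide_less_eq)
    then show False using \<delta>(2)[of n m] n m \<open>n \<noteq> m\<close> by simp
  qed
qed

text \<open>The value at a point is compared with the integral over the arc of its sector, of length
  2 pi / N with N = 2^k L. Cells hold at most one point, so each arc is used at most L times, once
  per concentric layer; hence L * L * 2^k / (2 pi).\<close>

lemma sum_boundary_osc_separated_le: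
  assumes f: "f holomorphic_on ball 0 1" and p: "1 \<le> p"
    and summ: "summable (\<lambda>j. integral {0..2 * pi} (radial_var f j))"
    and sep: "separated_seq J z"
  obtains K where "0 \<le> K"
    "\<And>k F. finite F \<Longrightarrow> F \<subseteq> J \<Longrightarrow> (\<And>n. n \<in> F \<Longrightarrow> whitney k \<le> cmod (z n) \<and> cmod (z n) < whitney (Suc k))
      \<Longrightarrow> (\<Sum>n\<in>F. boundary_osc f (z n) powr p)
        \<le> K * 2 ^ k * circle_integral p (boundary_osc f) (whitney k)"
proof -
  obtain L :: nat where L: "0 < L" and inj:
    "\<And>k. inj_on (\<lambda>n. (nat \<lfloor>(cmod (z n) - whitney k) * (2 ^ Suc k * L)\<rfloor>, nat \<lfloor>Arg2pi (z n) / (2 * pi) * (2 ^ k * L)\<rfloor>))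
       {n \<in> J. whitney k \<le> cmod (z n) \<and> cmod (z n) < whitney (Suc k)}"
    using separated_cells[OF sep] by blast
  show ?thesis
  proof (rule that[of "real L * L / (2 * pi) * 578 powr p"])
    show "0 \<le> real L * L / (2 * pi) * 578 powr p" by simp
    fix k F
    assume F: "finite F" "F \<subseteq> J" "\<And>n. n \<in> F \<Longrightarrow> whitney k \<le> cmod (z n) \<and> cmod (z n) < whitney (Suc k)"
    define N :: nat where "N = 2 ^ k * L"
    have N: "0 < N" "real N = 2 ^ k * L" using L by (auto simp: N_def)
    define A where "A = (\<lambda>n. nat \<lfloor>(cmod (z n) - whitney k) * (2 ^ Suc k * L)\<rfloor>)"
    define b where "b = (\<lambda>n. nat \<lfloor>Arg2pi (z n) / (2 * pi) * (2 ^ k * L)\<rfloor>)"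
    define h where "h = (\<lambda>t. boundary_osc f (polar (whitney k) t) powr p)"
    define arc where "arc = (\<lambda>b::nat. {2 * pi * b / N..2 * pi * (Suc b) / N})"
    have hc: "continuous_on S h" for S
      unfolding h_def by (rule continuous_on_boundary_osc_powr[OF f summ p]) auto
    have h0: "0 \<le> h t" for t by (simp add: h_def)
    have injF: "inj_on (\<lambda>n. (A n, b n)) F"
      unfolding A_def b_def by (rule inj_on_subset[OF inj[of k]]) (use F in auto)
    have A: "A n < L" if "n \<in> F" for n
    proof -
      have "(cmod (z n) - whitney k) * (2 ^ Suc k * L) < (whitney (Suc k) - whitney k) * (2 ^ Suc k * L)"
        using F(3)[OF that] L by (intro mult_strict_right_mono) auto
      also have "\<dots> = L" unfolding whitney_diff by simp
      finally show ?thesis unfolding A_def using F(3)[OF that] by (simp add: nat_less_iff floor_less_iff)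
    qed
    have bN: "b n < N" for n
    proof -
      have "Arg2pi (z n) / (2 * pi) * (2 ^ k * L) < 1 * real (2 ^ k * L)"
        using Arg2pi_lt_2pi[of "z n"] L by (intro mult_strict_right_mono) auto
      then show ?thesis unfolding b_def using Arg2pi_ge_0[of "z n"] N by (simp add: nat_less_iff floor_less_iff)
    qed
    have arc: "2 * pi * b n / N \<le> Arg2pi (z n)" "Arg2pi (z n) \<le> 2 * pi * Suc (b n) / N" for n
    proof -
      let ?x = "Arg2pi (z n) / (2 * pi) * N"
      have x0: "0 \<le> ?x" using Arg2pi_ge_0 by simp
      have "real (b n) \<le> ?x" "?x \<le> real (Suc (b n))"
        unfolding b_def N(2)[symmetric] using x0 by linarith+
      then show "2 * pi * b n / N \<le> Arg2pi (z n)" "Arg2pi (z n) \<le> 2 * pi * Suc (b n) / N"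
        using N(1) by (simp_all add: field_simps)
    qed
    have main: "2 * pi / N * boundary_osc f (z n) powr p \<le> 578 powr p * integral (arc (b n)) h" if n: "n \<in> F" for n
    proof -
      have len: "2 * pi * Suc (b n) / N - 2 * pi * b n / N = 2 * pi / N"
        by (simp add: diff_divide_distrib[symmetric] algebra_simps)
      have "integral (arc (b n)) (\<lambda>t. boundary_osc f (z n) powr p) \<le> integral (arc (b n)) (\<lambda>t. 578 powr p * h t)"
      proof (rule integral_le)
        show "(\<lambda>t. boundary_osc f (z n) powr p) integrable_on arc (b n)"
          unfolding arc_def by (rule integrable_const_ivl)
        show "(\<lambda>t. 578 powr p * h t) integrable_on arc (b n)"
          unfolding arc_def by (intro integrable_continuous_interval continuous_on_mult continuous_on_const hc)
        fix t assume t: "t \<in> arc (b n)"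
        have "\<bar>Arg2pi (z n) - t\<bar> \<le> 2 * pi / N"
          using t arc[of n] len unfolding arc_def by (auto simp: abs_le_iff)
        also have "\<dots> \<le> 2 * pi / 2 ^ k"
        proof (intro divide_left_mono)
          show "2 ^ k \<le> real N" unfolding N(2) using L by (simp add: mult_le_cancel_left1)
        qed (use N in auto)
        finally have "boundary_osc f (polar (cmod (z n)) (Arg2pi (z n)))
            \<le> 578 * boundary_osc f (polar (whitney k) t)"
          using F(3)[OF n] by (intro boundary_osc_whitney_le[OF f summ]) auto
        moreover have "polar (cmod (z n)) (Arg2pi (z n)) = z n"
          using Arg2pi[of "z n"] by (simp add: cis_conv_exp is_Arg_def)
        moreover have "0 \<le> boundary_osc f (z n)"
          using F(3)[OF n] by (intro boundary_osc_nonneg[OF f summ]) (auto dest: whitney_range)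
        ultimately have "boundary_osc f (z n) powr p \<le> (578 * boundary_osc f (polar (whitney k) t)) powr p"
          using p by (intro powr_mono2) auto
        also have "\<dots> = 578 powr p * h t"
          unfolding h_def by (subst powr_mult) (auto intro!: boundary_osc_nonneg[OF f summ] simp: norm_mult)
        finally show "boundary_osc f (z n) powr p \<le> 578 powr p * h t" .
      qed
      moreover have "integral (arc (b n)) (\<lambda>t. boundary_osc f (z n) powr p) = 2 * pi / N * boundary_osc f (z n) powr p"
      proof -
        have "2 * pi * b n / N \<le> 2 * pi * Suc (b n) / N" by (intro divide_right_mono mult_left_mono) auto
        then show ?thesis unfolding arc_def using len by simp
      qed
      ultimately show ?thesis by simp
    qed
    have arc0: "0 \<le> integral (arc j) h" for j
      unfolding arc_def by (intro integral_nonneg integrable_continuous_interval hc h0)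
    have "2 * pi / N * (\<Sum>n\<in>F. boundary_osc f (z n) powr p) = (\<Sum>n\<in>F. 2 * pi / N * boundary_osc f (z n) powr p)"
      by (rule sum_distrib_left)
    also have "\<dots> \<le> (\<Sum>n\<in>F. 578 powr p * integral (arc (b n)) h)"
      by (intro sum_mono main)
    also have "\<dots> = 578 powr p * (\<Sum>(a, j)\<in>(\<lambda>n. (A n, b n)) ` F. integral (arc j) h)"
      by (simp add: sum.reindex[OF injF] sum_distrib_left)
    also have "\<dots> \<le> 578 powr p * (\<Sum>(a, j)\<in>{..<L} \<times> {..<N}. integral (arc j) h)"
      using A bN arc0 by (intro mult_left_mono sum_mono2) auto
    also have "(\<Sum>(a, j)\<in>{..<L} \<times> {..<N}. integral (arc j) h) = L * (\<Sum>j<N. integral (arc j) h)"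
      by (simp flip: sum.cartesian_product)
    also have "(\<Sum>j<N. integral (arc j) h) = integral {0..2 * pi} h"
      unfolding arc_def using sum_integral_arcs[OF hc N(1), of N] N(1) by simp
    also have "integral {0..2 * pi} h = circle_integral p (boundary_osc f) (whitney k)"
      unfolding circle_integral_def h_def using boundary_osc_nonneg[OF f summ] by (simp add: norm_mult)
    finally have "2 * pi / N * (\<Sum>n\<in>F. boundary_osc f (z n) powr p)
        \<le> 578 powr p * (L * circle_integral p (boundary_osc f) (whitney k))" .
    then show "(\<Sum>n\<in>F. boundary_osc f (z n) powr p)
        \<le> real L * L / (2 * pi) * 578 powr p * 2 ^ k * circle_integral p (boundary_osc f) (whitney k)"
      using N by (simp add: field_simps)
  qed
qed

subsection \<open>Besov spaces\<close>

lemma integral_mean_eq: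
  assumes "continuous_on {0..2 * pi} (\<lambda>\<theta>. g (polar r \<theta>))" "1 \<le> p"
  shows "integral_mean p r g = (1 / (2 * pi) * circle_integral p g r) powr (1 / p)"
proof -
  have c: "continuous_on {0..2 * pi} (\<lambda>\<theta>. cmod (g (polar r \<theta>)) powr p)"
    using assms by (intro continuous_on_powr' continuous_intros) auto
  have "(LINT \<theta>:{0..2*pi}|lebesgue. cmod (g (polar r \<theta>)) powr p)
      = integral\<^sup>L circle (\<lambda>\<theta>. cmod (g (polar r \<theta>)) powr p)"
    by (simp add: set_lebesgue_integral_def integral_restrict_space)
  then show ?thesis
    unfolding integral_mean_def circle_integral_def by (simp add: lebesgue_integral_circle_continuous[OF c])
qed

lemma integral_mean_powr_eq:
  assumes "g holomorphic_on ball 0 1" "0 \<le> r" "r < 1" "1 \<le> p"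
  shows "integral_mean p r g powr p = 1 / (2 * pi) * circle_integral p g r"
proof -
  have "continuous_on {0..2 * pi} (\<lambda>\<theta>. g (polar r \<theta>))"
    using assms by (intro continuous_on_circle continuous_on_id)
  then show ?thesis
    using assms circle_integral_nonneg[of p g r] by (simp add: integral_mean_eq powr_powr)
qed

lemma circle_integral_le_of_hardy:
  assumes f: "f \<in> hardy_space p" and p: "1 \<le> p"
  obtains B where "\<And>r. 0 \<le> r \<Longrightarrow> r < 1 \<Longrightarrow> circle_integral p f r \<le> B"
proof -
  have hol: "f holomorphic_on ball 0 1" using f by (simp add: hardy_space_def)
  obtain B where B: "\<And>r. 0 \<le> r \<Longrightarrow> r < 1 \<Longrightarrow> integral_mean p r f \<le> B"
    using f unfolding hardy_space_def bdd_above_def by force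
  show ?thesis
  proof (rule that[of "2 * pi * B powr p"])
    fix r :: real assume r: "0 \<le> r" "r < 1"
    have "1 / (2 * pi) * circle_integral p f r \<le> B powr p"
      unfolding integral_mean_powr_eq[OF hol r p, symmetric]
      using B[OF r] p by (intro powr_mono2) (auto simp: integral_mean_def)
    then show "circle_integral p f r \<le> 2 * pi * B powr p" by (simp add: field_simps)
  qed
qed

lemma hardy_spaceI:
  assumes "f holomorphic_on ball 0 1" "1 \<le> p" "\<And>r. 0 \<le> r \<Longrightarrow> r < 1 \<Longrightarrow> circle_integral p f r \<le> B"
  shows "f \<in> hardy_space p"
proof -
  have "integral_mean p r f \<le> (1 / (2 * pi) * B) powr (1 / p)" if "0 \<le> r" "r < 1" for r
  proof -
    have "continuous_on {0..2 * pi} (\<lambda>\<theta>. f (polar r \<theta>))"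
      using assms that by (intro continuous_on_circle continuous_on_id)
    then show ?thesis
      using assms(2) assms(3)[OF that] circle_integral_nonneg[of p f r]
      by (auto simp: integral_mean_eq intro!: powr_mono2 divide_right_mono)
  qed
  then have "bdd_above ((\<lambda>r. integral_mean p r f) ` {0..<1})"
    by (intro bdd_aboveI2[where M = "(1 / (2 * pi) * B) powr (1 / p)"]) simp
  then show ?thesis using assms(1) by (simp add: hardy_space_def)
qed

lemma continuous_on_circle_integral:
  assumes "g holomorphic_on ball 0 1" "1 \<le> p"
  shows "continuous_on {0..<1} (circle_integral p g)"
  unfolding circle_integral_def using assms
  by (intro continuous_on_integral_Icc continuous_on_powr' continuous_intros continuous_on_disc_compose[OF assms(1)])
     (auto simp: norm_mult)

lemma summable_on_Union:
  fixes g :: "'a \<Rightarrow> real"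
  assumes "finite \<J>" "\<And>J. J \<in> \<J> \<Longrightarrow> g summable_on J"
  shows "g summable_on \<Union> \<J>"
  using assms
proof (induction \<J>)
  case (insert J \<J>)
  have "g summable_on (\<Union> \<J> - J)"
    by (rule summable_on_subset_banach[of g "\<Union> \<J>"]) (use insert in auto)
  then have "g summable_on J \<union> (\<Union> \<J> - J)"
    using insert by (intro summable_on_Un_disjoint) auto
  then show ?case by simp
qed simp

text \<open>Serves two choices of g: the oscillation itself on circles between dyadic ones, and the
  derivative of the outer function.\<close>

lemma circle_integral_le_boundary_osc:
  assumes f: "f holomorphic_on ball 0 1" and p: "1 \<le> p"
    and summ: "summable (\<lambda>j. integral {0..2 * pi} (radial_var f j))"
    and g: "continuous_on {0..2 * pi} (\<lambda>t. g (polar r t))" and c: "0 \<le> c"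
    and le: "\<And>t. norm (g (polar r t)) \<le> c * boundary_osc f (polar (whitney k) t)"
  shows "circle_integral p g r \<le> c powr p * circle_integral p (boundary_osc f) (whitney k)"
proof -
  have nn: "0 \<le> boundary_osc f (polar (whitney k) t)" for t
    by (rule boundary_osc_nonneg[OF f summ]) (simp add: norm_mult)
  have "circle_integral p g r \<le> integral {0..2 * pi} (\<lambda>t. c powr p * boundary_osc f (polar (whitney k) t) powr p)"
    unfolding circle_integral_def
  proof (rule integral_le)
    show "(\<lambda>t. norm (g (polar r t)) powr p) integrable_on {0..2 * pi}"
      using p by (intro integrable_continuous_interval continuous_on_powr' continuous_on_norm g continuous_on_const) auto
    show "(\<lambda>t. c powr p * boundary_osc f (polar (whitney k) t) powr p) integrable_on {0..2 * pi}"
      by (intro integrable_continuous_interval continuous_on_mult continuous_on_const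
          continuous_on_boundary_osc_powr[OF f summ p]) auto
    show "norm (g (polar r t)) powr p \<le> c powr p * boundary_osc f (polar (whitney k) t) powr p" for t
      using le[of t] p c nn[of t] by (subst powr_mult[symmetric]) (auto intro!: powr_mono2)
  qed
  also have "\<dots> = c powr p * circle_integral p (boundary_osc f) (whitney k)"
    using nn by (simp add: circle_integral_def)
  finally show ?thesis .
qed

lemma circle_integral_add_le:
  assumes g: "g holomorphic_on ball 0 1" and h: "h holomorphic_on ball 0 1" and p: "1 \<le> p" and r: "0 \<le> r" "r < 1"
    and b: "continuous_on {0..2 * pi} (\<lambda>t. b (polar r t))"
    and le: "\<And>z. cmod z < 1 \<Longrightarrow> cmod (g z) \<le> cmod (h z) + norm (b z)"
  shows "circle_integral p g r \<le> 2 powr (p - 1) * (circle_integral p h r + circle_integral p b r)"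
proof -
  have c: "continuous_on {0..2 * pi} (\<lambda>t. cmod (h (polar r t)) powr p)"
    "continuous_on {0..2 * pi} (\<lambda>t. cmod (g (polar r t)) powr p)"
    "continuous_on {0..2 * pi} (\<lambda>t. norm (b (polar r t)) powr p)"
    using p r by (auto intro!: continuous_on_powr' continuous_on_norm continuous_on_circle[OF g] b
          continuous_on_circle[OF h] continuous_on_id continuous_on_const)
  have "circle_integral p g r \<le> integral {0..2 * pi} (\<lambda>t. 2 powr (p - 1) *
      (cmod (h (polar r t)) powr p + norm (b (polar r t)) powr p))"
    unfolding circle_integral_def
  proof (rule integral_le)
    fix t
    have "cmod (g (polar r t)) powr p
        \<le> (cmod (h (polar r t)) + norm (b (polar r t))) powr p"
      using le[of "polar r t"] p r by (intro powr_mono2) (auto simp: norm_mult)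
    also have "\<dots> \<le> 2 powr (p - 1) * (cmod (h (polar r t)) powr p + norm (b (polar r t)) powr p)"
      by (intro add_powr_le p) auto
    finally show "cmod (g (polar r t)) powr p
        \<le> 2 powr (p - 1) * (cmod (h (polar r t)) powr p + norm (b (polar r t)) powr p)" .
  qed (intro integrable_continuous_interval continuous_on_mult continuous_on_add continuous_on_const c)+
  also have "\<dots> = 2 powr (p - 1) * (circle_integral p h r + circle_integral p b r)"
    unfolding circle_integral_def
    by (subst Henstock_Kurzweil_Integration.integral_mult_right, subst Henstock_Kurzweil_Integration.integral_add)
       (auto intro!: integrable_continuous_interval c)
  finally show ?thesis .
qed

text \<open>The interface between the weight classes and the Hardy inequality, with one constant and
  one ratio obtained as maxima. Since a dyadic step halves 1 - r, the condition of
  \<open>weight_Dhat\<close> compares consecutive terms of v.\<close>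

lemma besov_weight_sequence:
  assumes p: "1 \<le> p" and \<nu>: "\<nu> \<in> weight_D \<inter> weight_Dhat_p p" and f: "f \<in> besov_space p \<nu>"
  defines "v \<equiv> \<lambda>k. weight_tail \<nu> (whitney k)"
  obtains C q where "0 < C" "0 < q" "q < 1" "\<And>k. 0 < v k"
    "\<And>i k. i \<le> k \<Longrightarrow> v k \<le> C * q ^ (k - i) * v i"
    "\<And>i k. i \<le> k \<Longrightarrow> (2 ^ i) powr p * v i \<le> C * q ^ (k - i) * ((2 ^ k) powr p * v k)"
    "\<And>k. v k \<le> C * v (Suc k)"
    "\<And>n. (\<Sum>k<n. v k * circle_integral p (deriv f) (whitney k)) \<le> C"
proof -
  have rad: "radial_weight \<nu>" and dh: "\<nu> \<in> weight_Dhat" and dc: "\<nu> \<in> weight_Dcheck" and dp: "\<nu> \<in> weight_Dhat_p p"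
    using \<nu> by (auto simp: weight_D_def weight_Dhat_def)
  have hol: "f holomorphic_on ball 0 1" using f by (simp add: besov_space_def hardy_space_def)
  note dhol = holomorphic_deriv_disc[OF hol]
  have v: "0 < v k" for k unfolding v_def by (rule weight_tail_pos[OF rad]) auto
  obtain C1 q1 where 1: "0 < C1" "0 < q1" "q1 < 1" "\<And>i k. i \<le> k \<Longrightarrow> v k \<le> C1 * q1 ^ (k - i) * v i"
    using weight_tail_decay[OF rad dc] unfolding v_def by blast
  obtain C2 q2 where 2: "0 < C2" "0 < q2" "q2 < 1"
    "\<And>i k. i \<le> k \<Longrightarrow> (2 ^ i) powr p * v i \<le> C2 * q2 ^ (k - i) * ((2 ^ k) powr p * v k)"
    using weight_tail_powr_growth[OF rad dc dp] p unfolding v_def by (smt (verit, ccfv_threshold))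
  obtain C3 where 3: "0 < C3" "\<And>r. 0 \<le> r \<Longrightarrow> r < 1 \<Longrightarrow> weight_tail \<nu> r \<le> C3 * weight_tail \<nu> ((1 + r) / 2)"
    using dh by (auto simp: weight_Dhat_def)
  have 3: "0 < C3" "v k \<le> C3 * v (Suc k)" for k
    using 3(1) 3(2)[of "whitney k"] by (auto simp: v_def whitney_Suc)
  obtain C4 where C4: "\<And>n. (\<Sum>k<n. v k * (1 / (2 * pi) * circle_integral p (deriv f) (whitney k))) \<le> C4"
  proof (rule sum_weight_tail_le[OF rad dc, of "\<lambda>r. 1 / (2 * pi) * circle_integral p (deriv f) r"])
    show "0 \<le> 1 / (2 * pi) * circle_integral p (deriv f) s" for s
      by (simp add: circle_integral_nonneg)
    show "1 / (2 * pi) * circle_integral p (deriv f) s \<le> 1 / (2 * pi) * circle_integral p (deriv f) t"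
      if "0 \<le> s" "s \<le> t" "t < 1" for s t
      by (intro mult_left_mono circle_integral_deriv_mono hol p that) auto
    have "set_integrable lebesgue {0..<1} (\<lambda>r. integral_mean p r (deriv f) powr p * \<nu> (complex_of_real r))"
      using f by (simp add: besov_space_def)
    also have "?this \<longleftrightarrow> set_integrable lebesgue {0..<1} (\<lambda>s. 1 / (2 * pi) * circle_integral p (deriv f) s * \<nu> (complex_of_real s))"
      by (intro set_integrable_cong refl) (simp add: integral_mean_powr_eq[OF dhol _ _ p])
    finally show "set_integrable lebesgue {0..<1} (\<lambda>s. 1 / (2 * pi) * circle_integral p (deriv f) s * \<nu> (complex_of_real s))" .
  qed (auto simp: v_def)
  have 4: "(\<Sum>k<n. v k * circle_integral p (deriv f) (whitney k)) \<le> 2 * pi * C4" for n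
  proof -
    have "(\<Sum>k<n. v k * circle_integral p (deriv f) (whitney k))
        = 2 * pi * (\<Sum>k<n. v k * (1 / (2 * pi) * circle_integral p (deriv f) (whitney k)))"
      by (simp add: sum_distrib_left)
    also have "\<dots> \<le> 2 * pi * C4" using C4 by (intro mult_left_mono) auto
    finally show ?thesis .
  qed
  define C where "C = Max {C1, C2, C3, 2 * pi * C4}"
  define q where "q = max q1 q2"
  have C: "C1 \<le> C" "C2 \<le> C" "C3 \<le> C" "2 * pi * C4 \<le> C" by (auto simp: C_def)
  have q: "0 < q" "q < 1" "q1 \<le> q" "q2 \<le> q" using 1 2 by (auto simp: q_def)
  show ?thesis
  proof (rule that[of C q])
    show "0 < C" using 1 C by linarith
    show "v k \<le> C * q ^ (k - i) * v i" if "i \<le> k" for i k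
      by (rule order.trans[OF 1(4)[OF that]], intro mult_right_mono mult_mono power_mono)
         (use 1 C q v in \<open>auto simp: less_imp_le\<close>)
    show "(2 ^ i) powr p * v i \<le> C * q ^ (k - i) * ((2 ^ k) powr p * v k)" if "i \<le> k" for i k
      by (rule order.trans[OF 2(4)[OF that]], intro mult_right_mono mult_mono power_mono)
         (use 2 C q v in \<open>auto simp: less_imp_le\<close>)
    show "v k \<le> C * v (Suc k)" for k
      by (rule order.trans[OF 3(2)], intro mult_right_mono) (use C v in \<open>auto simp: less_imp_le\<close>)
    show "(\<Sum>k<n. v k * circle_integral p (deriv f) (whitney k)) \<le> C" for n
      using 4[of n] C by linarith
  qed (use q v in auto)
qed

theorem corollary8:
  fixes p :: real and \<nu> :: "complex \<Rightarrow> real" and I :: "nat set" and z :: "nat \<Rightarrow> complex"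
  assumes "1 \<le> p"
    and "\<nu> \<in> weight_D \<inter> weight_Dhat_p p"
    and "finite_union_separated I z"
    and "besov_zero_set p \<nu> I z"
  shows "\<exists>\<phi>. outer_symbol p \<phi> \<and> outer_function \<phi> \<in> besov_space p \<nu> \<and>
           (\<lambda>n. cmod (outer_function \<phi> (z n)) powr p *
                (weight_tail \<nu> (cmod (z n)) / (1 - cmod (z n)) powr (p - 1))) summable_on I"
proof -
  note p = assms(1)
  have rad: "radial_weight \<nu>" using assms(2) by (auto simp: weight_D_def weight_Dhat_def)
  obtain f w where f: "f \<in> besov_space p \<nu>" and w: "cmod w < 1" "f w \<noteq> 0"
    and zeros: "{w \<in> ball 0 1. f w = 0} = z ` I"
    using assms(4) by (auto simp: besov_zero_set_def)
  have hardy: "f \<in> hardy_space p" and hol: "f holomorphic_on ball 0 1"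
    using f by (auto simp: besov_space_def hardy_space_def)
  obtain B where B: "\<And>r. 0 \<le> r \<Longrightarrow> r < 1 \<Longrightarrow> circle_integral p f r \<le> B"
    using circle_integral_le_of_hardy[OF hardy p] by blast
  define v where "v = (\<lambda>k. weight_tail \<nu> (whitney k))"
  obtain C q where C: "0 < C" and q: "0 < q" "q < 1" and v: "\<And>k. 0 < v k"
    and decay: "\<And>i k. i \<le> k \<Longrightarrow> v k \<le> C * q ^ (k - i) * v i"
    and growth: "\<And>i k. i \<le> k \<Longrightarrow> (2 ^ i) powr p * v i \<le> C * q ^ (k - i) * ((2 ^ k) powr p * v k)"
    and doubling: "\<And>k. v k \<le> C * v (Suc k)"
    and sumE: "\<And>n. (\<Sum>k<n. v k * circle_integral p (deriv f) (whitney k)) \<le> C"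
    unfolding v_def by (rule besov_weight_sequence[OF assms(1,2) f]) blast
  have summ: "summable (\<lambda>j. integral {0..2 * pi} (radial_var f j))"
    by (rule summable_integral_radial_var[OF hol p v q growth sumE])
  define \<beta> where "\<beta> = (\<lambda>k. circle_integral p (boundary_osc f) (whitney k))"
  \<comment> \<open>The weighted L^p bound for the boundary oscillation. It feeds all the estimates
    for the outer function: Hardy norm, Besov condition and the sum over the zeros.\<close>
  obtain M where M: "\<And>n. (\<Sum>k<n. (2 ^ k) powr p * v k * \<beta> k) \<le> M"
  proof (rule that)
    fix n
    show "(\<Sum>k<n. (2 ^ k) powr p * v k * \<beta> k) \<le> 2 powr (p - 1) * (osc_const p C q + 1)"
      unfolding \<beta>_def
      by (rule sum_weighted_boundary_osc_le[OF hol summ p less_imp_le[OF v]])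
         (rule sum_weighted_oscillation_le[OF hol p less_imp_le[OF v] less_imp_le[OF C] q decay growth doubling sumE])
  qed
  define \<phi> where "\<phi> = boundary_modulus f"
  have \<phi>_def': "\<phi> = (\<lambda>w. cmod (boundary_value f w))"
    by (simp add: \<phi>_def boundary_modulus_def fun_eq_iff)
  note pos = boundary_modulus_pos_and_ln_integrable(1)[OF hol summ w, folded \<phi>_def]
  note lni = boundary_modulus_pos_and_ln_integrable(2)[OF hol summ w, folded \<phi>_def]
  define G where "G = outer_function \<phi>"
  have G: "G = outer_of (\<lambda>t. ln (\<phi> (cis t)))"
    by (simp add: G_def outer_function_eq_outer_of)
  have G_hol: "G holomorphic_on ball 0 1" unfolding G by (rule outer_of_holomorphic[OF lni])
  have G_le: "cmod (G z) \<le> cmod (f z) + boundary_osc f z" if "cmod z < 1" for z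
    unfolding G \<phi>_def by (rule norm_outer_part_le[OF hol summ w that])
  have G'_le: "(1 - cmod z) * cmod (deriv G z) \<le> 4 * boundary_osc f z" if "cmod z < 1" for z
    unfolding G \<phi>_def by (rule norm_deriv_outer_part_le[OF hol summ w that])
  have nn: "0 \<le> boundary_osc f z" if "cmod z < 1" for z
    by (rule boundary_osc_nonneg[OF hol summ that])
  have \<beta>0: "0 \<le> \<beta> k" for k by (simp add: \<beta>_def circle_integral_nonneg)
  have t0: "0 \<le> (2 ^ k) powr p * v k * \<beta> k" for k using v[of k] \<beta>0[of k] by simp

  have symbol: "outer_symbol p \<phi>"
    unfolding outer_symbol_def
  proof (intro conjI)
    show "\<forall>w\<in>sphere 0 1. 0 \<le> \<phi> w" by (simp add: \<phi>_def')
    have "integrable circle (\<lambda>t. \<phi> (cis t) powr p)"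
      unfolding \<phi>_def by (rule integrable_boundary_modulus_powr[OF hol summ p]) (rule B; simp)
    then show "set_integrable lebesgue {0..2 * pi} (\<lambda>\<theta>. \<phi> (cis \<theta>) powr p)"
      by (simp add: set_integrable_def integrable_restrict_space)
    show "set_integrable lebesgue {0..2 * pi} (\<lambda>\<theta>. ln (\<phi> (cis \<theta>)))"
      using lni by (simp add: set_integrable_def integrable_restrict_space)
    show "AE \<theta> in lebesgue. \<theta> \<in> {0..2 * pi} \<longrightarrow> 0 < \<phi> (cis \<theta>)"
      using pos by (subst (asm) AE_restrict_space_iff) auto
  qed

  \<comment> \<open>By \<open>growth\<close> from level 0 the weights (2^k)^p v k are at least v 0 /
    C, so the bound M on the weighted sum bounds each \<beta> k.\<close>
  have \<beta>_le: "\<beta> k \<le> C * M / v 0" for k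
  proof -
    have "v 0 * \<beta> k \<le> (C * q ^ k * ((2 ^ k) powr p * v k)) * \<beta> k"
      using growth[of 0 k] \<beta>0[of k] by (intro mult_right_mono) auto
    also have "\<dots> = C * q ^ k * ((2 ^ k) powr p * v k * \<beta> k)" by (simp only: mult_ac)
    also have "\<dots> \<le> C * 1 * M"
    proof (intro mult_mono)
      have "(2 ^ k) powr p * v k * \<beta> k \<le> (\<Sum>i<Suc k. (2 ^ i) powr p * v i * \<beta> i)"
        using t0 by (intro member_le_sum) auto
      then show "(2 ^ k) powr p * v k * \<beta> k \<le> M" using M[of "Suc k"] by linarith
    qed (use C q t0 in \<open>auto simp: power_le_one\<close>)
    finally show ?thesis using v[of 0] by (simp add: pos_le_divide_eq mult.commute)
  qed

  \<comment> \<open>|G| <= |f| + \<open>boundary_osc f\<close>; the first summand has bounded means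
    by assumption, and the second is compared with its values on the nearest dyadic circle
    inside.\<close>
  have "G \<in> hardy_space p"
  proof (rule hardy_spaceI[OF G_hol p])
    fix r :: real assume r: "0 \<le> r" "r < 1"
    obtain k where k: "whitney k \<le> r" "r < whitney (Suc k)" using whitney_interval[OF r] .
    have bc: "continuous_on {0..2 * pi} (\<lambda>t. boundary_osc f (polar r t))"
      by (intro continuous_on_boundary_osc_circle[OF hol summ] r)
    have "circle_integral p (boundary_osc f) r \<le> 578 powr p * \<beta> k"
      unfolding \<beta>_def
    proof (rule circle_integral_le_boundary_osc[OF hol p summ bc])
      fix t
      have "boundary_osc f (polar r t) \<le> 578 * boundary_osc f (polar (whitney k) t)"
        using k by (intro boundary_osc_whitney_le[OF hol summ]) auto
      then show "norm (boundary_osc f (polar r t)) \<le> 578 * boundary_osc f (polar (whitney k) t)"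
        using nn[of "polar r t"] r by (simp add: norm_mult)
    qed simp
    also have "\<dots> \<le> 578 powr p * (C * M / v 0)" by (intro mult_left_mono \<beta>_le) auto
    finally have 1: "circle_integral p (boundary_osc f) r \<le> 578 powr p * (C * M / v 0)" .
    have "circle_integral p G r \<le> 2 powr (p - 1) * (circle_integral p f r + circle_integral p (boundary_osc f) r)"
      using G_le nn by (intro circle_integral_add_le G_hol hol p r bc) auto
    also have "\<dots> \<le> 2 powr (p - 1) * (B + 578 powr p * (C * M / v 0))"
      by (intro mult_left_mono add_mono 1 B r) auto
    finally show "circle_integral p G r \<le> 2 powr (p - 1) * (B + 578 powr p * (C * M / v 0))" .
  qed
  moreover have "set_integrable lebesgue {0..<1} (\<lambda>r. integral_mean p r (deriv G) powr p * \<nu> (complex_of_real r))"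
  proof -
    note G'_hol = holomorphic_deriv_disc[OF G_hol]
    have "set_integrable lebesgue {0..<1} (\<lambda>r. circle_integral p (deriv G) r * \<nu> (complex_of_real r))"
    proof (rule set_integrable_radial_weight_mult[OF rad])
      show "continuous_on {0..<1} (circle_integral p (deriv G))"
        by (rule continuous_on_circle_integral[OF G'_hol p])
      show "0 \<le> circle_integral p (deriv G) s" for s by (rule circle_integral_nonneg)
      \<comment> \<open>4624 = 2 * 4 * 578: the 2 from 1 - s >= 2^-(k+1), the 4 from the derivative
        estimate, 578 from the comparison within a Whitney annulus.\<close>
      show "circle_integral p (deriv G) s \<le> 4624 powr p * ((2 ^ k) powr p * \<beta> k)"
        if s: "whitney k \<le> s" "s < whitney (Suc k)" for k s
      proof -
        have s1: "0 \<le> s" "s < 1" using s by (auto dest: whitney_range)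
        have s2: "1 / 2 ^ Suc k \<le> 1 - s" using s one_minus_whitney[of "Suc k"] by linarith
        have "circle_integral p (deriv G) s \<le> (4624 * 2 ^ k) powr p * \<beta> k"
          unfolding \<beta>_def
        proof (rule circle_integral_le_boundary_osc[OF hol p summ])
          show "continuous_on {0..2 * pi} (\<lambda>t. deriv G (polar s t))"
            by (rule continuous_on_circle[OF G'_hol s1 continuous_on_id])
        next
          fix t
          let ?z = "polar s t"
          have z: "cmod ?z = s" using s1 by (simp add: norm_mult)
          have "1 / 2 ^ Suc k * cmod (deriv G ?z) \<le> (1 - s) * cmod (deriv G ?z)"
            by (intro mult_right_mono s2) auto
          also have "\<dots> \<le> 4 * boundary_osc f ?z" using G'_le[of ?z] s1 z by simp
          also have "\<dots> \<le> 4 * (578 * boundary_osc f (polar (whitney k) t))"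
            using s by (intro mult_left_mono boundary_osc_whitney_le[OF hol summ]) auto
          finally show "cmod (deriv G ?z) \<le> 4624 * 2 ^ k * boundary_osc f (polar (whitney k) t)"
            by (simp add: field_simps)
        qed simp
        then show ?thesis by (simp add: powr_mult mult.assoc)
      qed
      show "(\<Sum>k<n. 4624 powr p * ((2 ^ k) powr p * \<beta> k) * weight_tail \<nu> (whitney k)) \<le> 4624 powr p * M" for n
      proof -
        have "(\<Sum>k<n. 4624 powr p * ((2 ^ k) powr p * \<beta> k) * weight_tail \<nu> (whitney k))
            = 4624 powr p * (\<Sum>k<n. (2 ^ k) powr p * v k * \<beta> k)"
          by (simp add: sum_distrib_left v_def mult_ac)
        then show ?thesis using M[of n] by (simp add: mult_left_mono)
      qed
    qed
    then have "set_integrable lebesgue {0..<1} (\<lambda>r. 1 / (2 * pi) * (circle_integral p (deriv G) r * \<nu> (complex_of_real r)))"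
      by (rule set_integrable_mult_right)
    also have "?this \<longleftrightarrow> ?thesis"
      by (intro set_integrable_cong refl) (simp add: integral_mean_powr_eq[OF G'_hol _ _ p])
    finally show ?thesis .
  qed
  ultimately have besov: "G \<in> besov_space p \<nu>" by (simp add: besov_space_def)

  define T where "T = (\<lambda>n. cmod (G (z n)) powr p * (weight_tail \<nu> (cmod (z n)) / (1 - cmod (z n)) powr (p - 1)))"
  obtain \<J> where \<J>: "finite \<J>" "I = \<Union> \<J>" "\<And>J. J \<in> \<J> \<Longrightarrow> separated_seq J z"
    using assms(3) by (auto simp: finite_union_separated_def)
  have zI: "cmod (z n) < 1" "f (z n) = 0" if "n \<in> I" for n
  proof -
    have "z n \<in> {w \<in> ball 0 1. f w = 0}" unfolding zeros using that by blast
    then show "cmod (z n) < 1" "f (z n) = 0" by auto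
  qed
  have T0: "0 \<le> T n" if "n \<in> I" for n
    unfolding T_def using zI(1)[OF that] weight_tail_pos[OF rad, of "cmod (z n)"] by (auto simp: less_imp_le)
  \<comment> \<open>1 - |z n| >= 2^-(k+1) produces the (p-1)-th power of 2 * 2^k. Writing
    (2^k)^(p-1) as (2^k)^p / 2^k prepares the cancellation against the factor 2^k of the cell count,
    after which exactly the weights of the bound M remain.\<close>
  have T_le: "T n \<le> 2 powr (p - 1) * ((2 ^ k) powr p / 2 ^ k * v k * boundary_osc f (z n) powr p)"
    if n: "n \<in> I" and k: "whitney k \<le> cmod (z n)" "cmod (z n) < whitney (Suc k)" for n k
  proof -
    have "cmod (G (z n)) powr p \<le> boundary_osc f (z n) powr p"
      using G_le[OF zI(1)[OF n]] zI(2)[OF n] p by (intro powr_mono2) auto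
    moreover have "weight_tail \<nu> (cmod (z n)) / (1 - cmod (z n)) powr (p - 1) \<le> v k / (1 / 2 ^ Suc k) powr (p - 1)"
    proof (intro frac_le powr_mono2)
      show "weight_tail \<nu> (cmod (z n)) \<le> v k"
        unfolding v_def using k zI(1)[OF n] by (intro weight_tail_antimono[OF rad]) auto
      show "1 / 2 ^ Suc k \<le> 1 - cmod (z n)" using k one_minus_whitney[of "Suc k"] by linarith
    qed (use p v[of k] in auto)
    ultimately have "T n \<le> boundary_osc f (z n) powr p * (v k / (1 / 2 ^ Suc k) powr (p - 1))"
      unfolding T_def using zI(1)[OF n] weight_tail_pos[OF rad, of "cmod (z n)"]
      by (intro mult_mono) (auto simp: less_imp_le)
    also have "1 / (1 / 2 ^ Suc k) powr (p - 1) = 2 powr (p - 1) * ((2 ^ k) powr p / 2 ^ k)"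
    proof -
      have "1 / (1 / 2 ^ Suc k) powr (p - 1) = (2 * 2 ^ k) powr (p - 1)" by (simp add: powr_divide)
      also have "\<dots> = 2 powr (p - 1) * (2 ^ k) powr (p - 1)" by (rule powr_mult)
      also have "(2 ^ k) powr (p - 1) = (2 ^ k) powr p / 2 ^ k" by (simp add: powr_diff)
      finally show ?thesis .
    qed
    then have "v k / (1 / 2 ^ Suc k) powr (p - 1) = v k * (2 powr (p - 1) * ((2 ^ k) powr p / 2 ^ k))"
      by (metis times_divide_eq_right mult.right_neutral)
    finally show ?thesis by (simp add: mult_ac)
  qed
  have "T summable_on J" if J: "J \<in> \<J>" for J
  proof -
    have JI: "J \<subseteq> I" using J \<J> by auto
    obtain K where K: "0 \<le> K" "\<And>k F. finite F \<Longrightarrow> F \<subseteq> J \<Longrightarrow> (\<And>n. n \<in> F \<Longrightarrow> whitney k \<le> cmod (z n) \<and> cmod (z n) < whitney (Suc k))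
      \<Longrightarrow> (\<Sum>n\<in>F. boundary_osc f (z n) powr p) \<le> K * 2 ^ k * \<beta> k"
      using sum_boundary_osc_separated_le[OF hol p summ \<J>(3)[OF J]] unfolding \<beta>_def by blast
    have "\<exists>k. whitney k \<le> cmod (z n) \<and> cmod (z n) < whitney (Suc k)" if "n \<in> J" for n
      using whitney_interval[OF norm_ge_zero zI(1)[OF subsetD[OF JI that]]] by metis
    then obtain \<kappa> where \<kappa>: "\<And>n. n \<in> J \<Longrightarrow> whitney (\<kappa> n) \<le> cmod (z n) \<and> cmod (z n) < whitney (Suc (\<kappa> n))"
      by metis
    have bound: "sum T F \<le> 2 powr (p - 1) * K * M" if F: "F \<subseteq> J" "finite F" for F
    proof -
      have "sum T F = (\<Sum>k\<in>\<kappa> ` F. \<Sum>n\<in>{n \<in> F. \<kappa> n = k}. T n)"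
        by (rule sum.image_gen[OF F(2)])
      also have "\<dots> \<le> (\<Sum>k\<in>\<kappa> ` F. 2 powr (p - 1) * K * ((2 ^ k) powr p * v k * \<beta> k))"
      proof (rule sum_mono)
        fix k assume "k \<in> \<kappa> ` F"
        have "(\<Sum>n\<in>{n \<in> F. \<kappa> n = k}. T n)
            \<le> (\<Sum>n\<in>{n \<in> F. \<kappa> n = k}. 2 powr (p - 1) * ((2 ^ k) powr p / 2 ^ k * v k * boundary_osc f (z n) powr p))"
          using F JI \<kappa> by (intro sum_mono T_le) auto
        also have "\<dots> = 2 powr (p - 1) * ((2 ^ k) powr p / 2 ^ k * v k) * (\<Sum>n\<in>{n \<in> F. \<kappa> n = k}. boundary_osc f (z n) powr p)"
          by (simp add: sum_distrib_left mult.assoc)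
        also have "\<dots> \<le> 2 powr (p - 1) * ((2 ^ k) powr p / 2 ^ k * v k) * (K * 2 ^ k * \<beta> k)"
          using F \<kappa> v[of k] by (intro mult_left_mono K) auto
        also have "\<dots> = 2 powr (p - 1) * K * ((2 ^ k) powr p * v k * \<beta> k)" by simp
        finally show "(\<Sum>n\<in>{n \<in> F. \<kappa> n = k}. T n) \<le> 2 powr (p - 1) * K * ((2 ^ k) powr p * v k * \<beta> k)" .
      qed
      also have "\<dots> = 2 powr (p - 1) * K * (\<Sum>k\<in>\<kappa> ` F. (2 ^ k) powr p * v k * \<beta> k)"
        by (simp add: sum_distrib_left)
      also have "\<dots> \<le> 2 powr (p - 1) * K * M"
      proof (intro mult_left_mono)
        have "(\<Sum>k\<in>\<kappa> ` F. (2 ^ k) powr p * v k * \<beta> k) \<le> (\<Sum>k<Suc (Max (\<kappa> ` F)). (2 ^ k) powr p * v k * \<beta> k)"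
          using F(2) t0 by (intro sum_mono2) (auto simp: less_Suc_eq_le)
        also have "\<dots> \<le> M" by (rule M)
        finally show "(\<Sum>k\<in>\<kappa> ` F. (2 ^ k) powr p * v k * \<beta> k) \<le> M" .
      qed (use K in auto)
      finally show ?thesis .
    qed
    then show ?thesis
      using T0 JI by (intro nonneg_bdd_above_summable_on) (auto simp: bdd_above_def)
  qed
  then have "T summable_on I"
    unfolding \<J>(2) by (intro summable_on_Union \<J>(1))
  with symbol besov show ?thesis
    unfolding T_def G_def by blast
qed

end
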